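(* Instances of \textsc{L-Sided Pricing} on simple graphs in which all vertices of $L\cup R$ have the same capacity $\mu$ admit a randomized polynomial-time $1.952381$-approximation algorithm. Consequently, instances of \textsc{Capacitated Graph Pricing} on simple graphs in which all vertices have the same capacity admit a randomized polynomial-time $7.8096$-approximation algorithm.
   Context: A graph is simple if it has no parallel edges (no two customers want exactly the same bundle). An instance of \textsc{Capacitated Graph Pricing} consists of a finite graph $G=(V,E)$ (no loops), capacities $\mu_v\in\mathbb Z_{\ge0}\cup\{\infty\}$ for $v\in V$ and budgets $b_e\ge 0$ for $e\in E$ (edge $e=uv$ is a customer interested in bundle $\{u,v\}$). A feasible solution is a pair $(p,F)$ with $p:V\to\mathbb R_{\ge 0}$ and $F\subseteq E$ such that $p(u)+p(v)\le b_e$ for every $e=uv\in F$ and every vertex $w$ is incident to at most $\mu_w$ edges of $F$; its revenue is $\sum_{e=uv\in F}(p(u)+p(v))$, to be maximized. \textsc{L-Sided Pricing} is the special case in which $G=(L\cup R,E)$ is bipartite with every edge joining $L$ and $R$, and a feasible solution must additionally satisfy $p(v)=0$ for every $v\in R$. A randomized $\alpha$-approximation algorithm outputs a feasible solution whose expected revenue is at least $1/\alpha$ times the optimum revenue. *)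

theory Defs
  imports
    "HOL-Probability.Probability"
    "HOL-Computational_Algebra.Polynomial"
    "HOL-Library.Extended_Nat"
    "HOL-Library.Discrete_Functions"
begin

section \<open>Graph pricing\<close>

text \<open>The vertices are \<open>0, \<dots>, n - 1\<close>, where \<open>n\<close> is the length of the list of capacities, and
  edge \<open>j\<close> is the \<open>j\<close>-th triple (end, end, budget). As instances are inputs of algorithms, budgets
  are rational; prices in solutions are arbitrary reals.\<close>

record pricing_instance =
  capacities :: "enat list"
  customers :: "(nat \<times> nat \<times> rat) list"

abbreviation nverts :: "pricing_instance \<Rightarrow> nat" where
  "nverts I \<equiv> length (capacities I)"

abbreviation nedges :: "pricing_instance \<Rightarrow> nat" where
  "nedges I \<equiv> length (customers I)"

fun ends :: "nat \<times> nat \<times> rat \<Rightarrow> nat set" where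
  "ends (u, v, b) = {u, v}"

fun budget :: "nat \<times> nat \<times> rat \<Rightarrow> rat" where
  "budget (u, v, b) = b"

definition pricing_instance :: "pricing_instance \<Rightarrow> bool" where
  "pricing_instance I \<longleftrightarrow>
     (\<forall>(u, v, b) \<in> set (customers I). u < nverts I \<and> v < nverts I \<and> u \<noteq> v \<and> b \<ge> 0)"

definition simple :: "pricing_instance \<Rightarrow> bool" where
  "simple I \<longleftrightarrow> distinct (map ends (customers I))"

definition uniform_capacity :: "pricing_instance \<Rightarrow> bool" where
  "uniform_capacity I \<longleftrightarrow> (\<exists>\<mu>. \<forall>c \<in> set (capacities I). c = \<mu>)"

type_synonym solution = "(nat \<Rightarrow> real) \<times> nat set"

fun bundle_price :: "(nat \<Rightarrow> real) \<Rightarrow> nat \<times> nat \<times> rat \<Rightarrow> real" where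
  "bundle_price p (u, v, b) = p u + p v"

definition feasible :: "pricing_instance \<Rightarrow> solution \<Rightarrow> bool" where
  "feasible I = (\<lambda>(p, F).
     (\<forall>v < nverts I. p v \<ge> 0) \<and>
     F \<subseteq> {..<nedges I} \<and>
     (\<forall>j \<in> F. bundle_price p (customers I ! j) \<le> of_rat (budget (customers I ! j))) \<and>
     (\<forall>w < nverts I. enat (card {j \<in> F. w \<in> ends (customers I ! j)}) \<le> capacities I ! w))"

definition revenue :: "pricing_instance \<Rightarrow> solution \<Rightarrow> real" where
  "revenue I = (\<lambda>(p, F). \<Sum>j \<in> F. bundle_price p (customers I ! j))"

text \<open>An instance of the one-sided problem is \<open>(L, I)\<close>; the other side is
  \<open>R = {..<nverts I} - L\<close>.\<close>

definition lsided_instance :: "nat set \<times> pricing_instance \<Rightarrow> bool" where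
  "lsided_instance = (\<lambda>(L, I).
     pricing_instance I \<and> L \<subseteq> {..<nverts I} \<and>
     (\<forall>(u, v, b) \<in> set (customers I). u \<in> L \<longleftrightarrow> v \<notin> L))"

definition lsided_feasible :: "nat set \<times> pricing_instance \<Rightarrow> solution \<Rightarrow> bool" where
  "lsided_feasible = (\<lambda>(L, I) (p, F).
     feasible I (p, F) \<and> (\<forall>v \<in> {..<nverts I} - L. p v = 0))"

definition lsided_revenue :: "nat set \<times> pricing_instance \<Rightarrow> solution \<Rightarrow> real" where
  "lsided_revenue = (\<lambda>(L, I). revenue I)"

text \<open>The suprema that define the optimum below are over nonempty bounded sets.\<close>

lemma zero_solution:
  "feasible I (\<lambda>_. 0, {})" "lsided_feasible (L, I) (\<lambda>_. 0, {})"
  by (auto simp: feasible_def lsided_feasible_def zero_enat_def[symmetric])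

lemma revenue_bounded:
  assumes "pricing_instance I" "feasible I s"
  shows "revenue I s \<le> (\<Sum>j < nedges I. of_rat (budget (customers I ! j)))"
proof -
  obtain p F where s: "s = (p, F)" by (cases s)
  have F: "F \<subseteq> {..<nedges I}"
    and le: "\<And>j. j \<in> F \<Longrightarrow> bundle_price p (customers I ! j) \<le> of_rat (budget (customers I ! j))"
    using assms(2) by (auto simp: feasible_def s)
  have nonneg: "budget (customers I ! j) \<ge> 0" if "j < nedges I" for j
    using assms(1) nth_mem[OF that]
    by (cases "customers I ! j") (fastforce simp: pricing_instance_def)
  have "revenue I s \<le> (\<Sum>j \<in> F. of_rat (budget (customers I ! j)))"
    unfolding revenue_def s by (simp add: sum_mono le)
  also have "\<dots> \<le> (\<Sum>j < nedges I. of_rat (budget (customers I ! j)))"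
    by (rule sum_mono2) (use F nonneg in auto)
  finally show ?thesis .
qed


section \<open>Probabilistic random access machines with logarithmic cost\<close>

text \<open>The memory maps addresses to natural numbers of unbounded size. Every instruction is charged
  the binary length of all addresses and operands that it touches (the logarithmic cost criterion
  of Aho, Hopcroft and Ullman), so that polynomial cost on this machine is the same as polynomial
  time on a probabilistic Turing machine.\<close>

type_synonym mem = "nat \<Rightarrow> nat"

datatype loc = Cell nat | Ptr nat

datatype operand = Const nat | At loc

datatype arith = Plus | Minus | Times | Div

datatype instr =
    Arith arith loc operand operand
  | Coin loc
  | IfLess operand operand nat

definition nbits :: "nat \<Rightarrow> nat" where
  "nbits n = Suc (floor_log n)"

fun addr :: "mem \<Rightarrow> loc \<Rightarrow> nat" where
  "addr m (Cell i) = i"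
| "addr m (Ptr i) = m i"

fun operand_val :: "mem \<Rightarrow> operand \<Rightarrow> nat" where
  "operand_val m (Const c) = c"
| "operand_val m (At l) = m (addr m l)"

text \<open>Subtraction truncates at \<open>0\<close>, and division by \<open>0\<close> yields \<open>0\<close>.\<close>

fun arith_val :: "arith \<Rightarrow> nat \<Rightarrow> nat \<Rightarrow> nat" where
  "arith_val Plus a b = a + b"
| "arith_val Minus a b = a - b"
| "arith_val Times a b = a * b"
| "arith_val Div a b = a div b"

fun loc_cost :: "mem \<Rightarrow> loc \<Rightarrow> nat" where
  "loc_cost m (Cell i) = nbits i"
| "loc_cost m (Ptr i) = nbits i + nbits (m i)"

fun operand_cost :: "mem \<Rightarrow> operand \<Rightarrow> nat" where
  "operand_cost m (Const c) = nbits c"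
| "operand_cost m (At l) = loc_cost m l + nbits (m (addr m l))"

record config =
  pc :: nat
  mem :: mem
  cost :: nat

definition halted :: "instr list \<Rightarrow> config \<Rightarrow> bool" where
  "halted P c \<longleftrightarrow> pc c \<ge> length P"

fun exec_instr :: "instr \<Rightarrow> config \<Rightarrow> config pmf" where
  "exec_instr (Arith f d a b) c = return_pmf
     \<lparr>pc = Suc (pc c),
      mem = (mem c)(addr (mem c) d := arith_val f (operand_val (mem c) a) (operand_val (mem c) b)),
      cost = cost c + loc_cost (mem c) d + operand_cost (mem c) a + operand_cost (mem c) b\<rparr>"
| "exec_instr (Coin d) c = map_pmf
     (\<lambda>x. \<lparr>pc = Suc (pc c), mem = (mem c)(addr (mem c) d := of_bool x),
           cost = cost c + loc_cost (mem c) d\<rparr>)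
     (bernoulli_pmf (1/2))"
| "exec_instr (IfLess a b k) c = return_pmf
     \<lparr>pc = (if operand_val (mem c) a < operand_val (mem c) b then k else Suc (pc c)),
      mem = mem c,
      cost = cost c + operand_cost (mem c) a + operand_cost (mem c) b\<rparr>"

definition step :: "instr list \<Rightarrow> config \<Rightarrow> config pmf" where
  "step P c = (if halted P c then return_pmf c else exec_instr (P ! pc c) c)"

primrec run :: "instr list \<Rightarrow> nat \<Rightarrow> config \<Rightarrow> config pmf" where
  "run P 0 c = return_pmf c"
| "run P (Suc k) c = bind_pmf (step P c) (run P k)"

text \<open>The input is stored in cells \<open>1, 2, \<dots>\<close>, its length in cell \<open>0\<close>.\<close>

definition initial :: "nat list \<Rightarrow> config" where
  "initial xs =
     \<lparr>pc = 0,
      mem = (\<lambda>i. if i = 0 then length xs else if i \<le> length xs then xs ! (i - 1) else 0),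
      cost = 0\<rparr>"

definition input_size :: "nat list \<Rightarrow> nat" where
  "input_size xs = nbits (length xs) + (\<Sum>x\<leftarrow>xs. nbits x)"


section \<open>Approximation algorithms\<close>

text \<open>Each step costs at least \<open>1\<close>, so a machine with cost bound \<open>T\<close> has halted after \<open>T\<close> steps
  whatever the outcomes of the coins; the bound is worst-case, and feasibility is required for
  all outcomes.\<close>

definition has_randomized_approximation ::
  "('i \<Rightarrow> bool) \<Rightarrow> ('i \<Rightarrow> nat list) \<Rightarrow> ('i \<Rightarrow> mem \<Rightarrow> 's) \<Rightarrow>
   ('i \<Rightarrow> 's \<Rightarrow> bool) \<Rightarrow> ('i \<Rightarrow> 's \<Rightarrow> real) \<Rightarrow> real \<Rightarrow> bool" where
  "has_randomized_approximation inst enc dec feas val \<alpha> \<longleftrightarrow>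
     (\<exists>(P :: instr list) (q :: nat poly). \<forall>I. inst I \<longrightarrow>
        (let T = poly q (input_size (enc I)); D = run P T (initial (enc I))
         in (\<forall>c \<in> set_pmf D. halted P c \<and> cost c \<le> T \<and> feas I (dec I (mem c))) \<and>
            measure_pmf.expectation D (\<lambda>c. val I (dec I (mem c)))
              \<ge> 1 / \<alpha> * (SUP s \<in> {s. feas I s}. val I s)))"

fun encode_capacity :: "enat \<Rightarrow> nat" where
  "encode_capacity (enat k) = Suc k"
| "encode_capacity \<infinity> = 0"

fun encode_customer :: "nat \<times> nat \<times> rat \<Rightarrow> nat list" where
  "encode_customer (u, v, b) = [u, v, nat (fst (quotient_of b)), nat (snd (quotient_of b))]"

definition encode_pricing :: "pricing_instance \<Rightarrow> nat list" where
  "encode_pricing I =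
     [nverts I, nedges I] @ map encode_capacity (capacities I) @
     concat (map encode_customer (customers I))"

definition encode_lsided :: "nat set \<times> pricing_instance \<Rightarrow> nat list" where
  "encode_lsided = (\<lambda>(L, I). encode_pricing I @ map (\<lambda>v. of_bool (v \<in> L)) [0..<nverts I])"

text \<open>The price of vertex \<open>v\<close> is the fraction of cells \<open>2 v\<close> and \<open>2 v + 1\<close>; the indicator of \<open>F\<close>
  is in the \<open>nedges I\<close> cells from \<open>2 * nverts I\<close> onwards.\<close>

definition decode_pricing :: "pricing_instance \<Rightarrow> mem \<Rightarrow> solution" where
  "decode_pricing I m =
     ((\<lambda>v. real (m (2 * v)) / real (m (2 * v + 1))),
      {j. j < nedges I \<and> m (2 * nverts I + j) \<noteq> 0})"

definition decode_lsided :: "nat set \<times> pricing_instance \<Rightarrow> mem \<Rightarrow> solution" where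
  "decode_lsided = (\<lambda>(L, I). decode_pricing I)"

end

theory Submission
  imports Defs
begin

text \<open>Every left vertex makes two half-offers, each a price together with at most \<open>\<mu>\<close>
  of its edges; a fair coin selects one of the two, and every right vertex accepts the \<open>\<mu>\<close>
  highest offers. The half-offers are chosen by a deterministic greedy procedure that visits the left vertices
  twice, that is, it visits each vertex of the doubled instance once. For a threshold \<open>b\<close>, if
  \<open>k\<close> half-offers of at least \<open>b\<close> reach a right vertex, then the expected number of
  accepted offers of at least \<open>b\<close> is at least \<open>\<mu> (1 - (1 - 1 / (2 \<mu>)) ^ k)\<close>;
  the potential integrates this bound over \<open>b\<close> and sums it over the right vertices. If the
  optimum is \<open>V\<close>, a round that ends with potential \<open>\<Phi>\<close> has increased it by at
  least \<open>(V - \<Phi>) / 2\<close>, so the two rounds lead to \<open>V / 3\<close> and then \<open>5 V /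
  9\<close>, and \<open>9 / 5 < 1.952381\<close>. In the general problem the sides are chosen by fair coins:
  then every customer contributes a quarter of its price in expectation, which gives \<open>36 / 5 <
  7.8096\<close>. The algorithm is written in a small language with nested counting loops, whose programs are
  compiled to the machine; its integer arithmetic clears the common denominator of the budgets and scales the
  weights by \<open>(2 \<mu>) ^ (2 m)\<close>, so all words have polynomial length.\<close>


section \<open>Selling to the highest offers\<close>

text \<open>The number of sales \<open>min \<mu> k\<close> is replaced by the smaller
  \<open>\<mu> (1 - (1 - 1/\<mu>) ^ k)\<close> because a power factorizes over the independent coins
  of the left vertices. A vertex with one half-offer above the threshold contributes the mean of
  \<open>1\<close> and \<open>1 - 1/\<mu>\<close>, which is \<open>1 - 1/(2 \<mu>)\<close>; with
  both it contributes \<open>1 - 1/\<mu>\<close>, less than the square of that. So the half-offers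
  may be counted as if they were independent. Here simplicity enters: a left vertex has at most one
  edge to a given right vertex. The gain of \<open>(V - \<Phi>) / 2\<close> per round has two
  sources. One more half-offer lowers a product by its share \<open>1/(2 \<mu>)\<close>, which after
  multiplication by \<open>\<mu>\<close> is half of the product. And since a right vertex has at
  most \<open>\<mu>\<close> edges of the optimal solution, the products met by these edges fall
  short of \<open>1\<close> by at most \<open>\<Phi>\<close> in total. Two half-offers are the least
  number for this argument: one certain offer per vertex gives, by the same calculation, only
  \<open>\<Phi> \<ge> V - \<Phi>\<close> and the ratio \<open>2\<close>.\<close>

definition beats :: "(nat \<Rightarrow> nat) \<Rightarrow> nat \<Rightarrow> nat \<Rightarrow> bool" where
  "beats g f e \<longleftrightarrow> g e < g f + of_bool (f < e)"

definition rank :: "nat set \<Rightarrow> (nat \<Rightarrow> nat) \<Rightarrow> nat \<Rightarrow> nat" where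
  "rank S g e = card {f \<in> S. beats g f e}"

definition top_set :: "nat \<Rightarrow> nat set \<Rightarrow> (nat \<Rightarrow> nat) \<Rightarrow> nat set" where
  "top_set k S g = {e \<in> S. rank S g e < k}"

text \<open>Ties go to the smaller index, so \<open>beats\<close> is a strict linear order. The
  definition, a single comparison with an added bit, is the form that the programs evaluate; the
  proofs use this one.\<close>

lemma beats_alt: "beats g f e \<longleftrightarrow> g e < g f \<or> g e = g f \<and> f < e"
  by (auto simp: beats_def)

lemma rank_less:
  assumes "finite S" "e \<in> S" "beats g e f"
  shows "rank S g e < rank S g f"
  unfolding rank_def
  by (rule psubset_card_mono) (use assms in \<open>auto simp: beats_alt\<close>)

lemma rank_less_iff:
  assumes "finite S" "e \<in> S" "f \<in> S"
  shows "rank S g e < rank S g f \<longleftrightarrow> beats g e f"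
proof
  assume less: "rank S g e < rank S g f"
  show "beats g e f"
  proof (rule ccontr)
    assume "\<not> beats g e f"
    then have "e = f \<or> beats g f e" by (auto simp: beats_alt)
    then show False using less rank_less[OF assms(1,3), of g e] by auto
  qed
qed (rule rank_less[OF assms(1,2)])

lemma inj_on_rank: "finite S \<Longrightarrow> inj_on (rank S g) S"
proof (rule inj_onI)
  fix e f assume "finite S" "e \<in> S" "f \<in> S" "rank S g e = rank S g f"
  then have "\<not> beats g e f" "\<not> beats g f e"
    using rank_less by (metis less_irrefl)+
  then show "e = f" by (auto simp: beats_alt)
qed

lemma rank_image:
  assumes "finite S" shows "rank S g ` S = {..<card S}"
proof (rule card_subset_eq)
  have "rank S g e < card S" if "e \<in> S" for e
    unfolding rank_def by (rule psubset_card_mono) (use assms that in \<open>auto simp: beats_alt\<close>)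
  then show "rank S g ` S \<subseteq> {..<card S}" by auto
  show "card (rank S g ` S) = card {..<card S}"
    by (simp add: card_image inj_on_rank assms)
qed simp

lemma card_top_set:
  assumes "finite S" shows "card (top_set k S g) = min k (card S)"
proof -
  have "rank S g ` top_set k S g = {..<min k (card S)}"
  proof -
    have "rank S g ` top_set k S g = rank S g ` S \<inter> {..<k}" by (auto simp: top_set_def)
    then show ?thesis by (auto simp: rank_image[OF assms])
  qed
  moreover have "inj_on (rank S g) (top_set k S g)"
    by (rule inj_on_subset[OF inj_on_rank[OF assms]]) (auto simp: top_set_def)
  ultimately show ?thesis
    using card_image[of "rank S g" "top_set k S g"] by simp
qed

lemma top_set_subset: "top_set k S g \<subseteq> S"
  by (auto simp: top_set_def)

text \<open>An element of \<open>U\<close> is beaten only by elements of \<open>U\<close>, so its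
  rank in \<open>S\<close> is its rank in \<open>U\<close>, and the best \<open>k\<close> of
  \<open>U\<close> belong to the best \<open>k\<close> of \<open>S\<close>. To be applied to the
  offers above a threshold.\<close>

lemma card_top_set_upper:
  assumes "finite S" "U \<subseteq> S" and up: "\<And>e f. e \<in> U \<Longrightarrow> f \<in> S \<Longrightarrow> beats g f e \<Longrightarrow> f \<in> U"
  shows "min k (card U) \<le> card (top_set k S g \<inter> U)"
proof -
  have "top_set k U g \<subseteq> top_set k S g \<inter> U"
  proof
    fix e assume e: "e \<in> top_set k U g"
    then have "{f \<in> S. beats g f e} = {f \<in> U. beats g f e}"
      using up assms(2) by (auto simp: top_set_def)
    then show "e \<in> top_set k S g \<inter> U"
      using e assms(2) by (auto simp: top_set_def rank_def)
  qed
  then have "card (top_set k U g) \<le> card (top_set k S g \<inter> U)"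
    by (rule card_mono[rotated]) (use finite_subset[OF assms(2,1)] in auto)
  then show ?thesis
    using card_top_set[of U k g] finite_subset[OF assms(2,1)] by simp
qed

text \<open>Exchange argument with a threshold: \<open>c\<close> is the largest value of
  \<open>T\<close> outside the top set, every top element outside \<open>T\<close> is worth at least
  \<open>c\<close>, and there are at least as many of the latter as of the former.\<close>

lemma sum_le_sum_top_set:
  assumes "finite S" "T \<subseteq> S" "card T \<le> k"
  shows "sum g T \<le> sum g (top_set k S g)"
proof (cases "T \<subseteq> top_set k S g")
  case True
  then show ?thesis
    using finite_subset[OF top_set_subset assms(1)] by (intro sum_mono2) auto
next
  case False
  let ?P = "top_set k S g"
  have fin: "finite T" "finite ?P"
    using finite_subset[OF assms(2,1)] finite_subset[OF top_set_subset assms(1)] by auto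
  from False obtain t where t: "t \<in> T" "t \<in> S" "\<not> rank S g t < k"
    using assms(2) by (auto simp: top_set_def)
  have "rank S g t \<le> card S"
    unfolding rank_def by (rule card_mono) (use assms in auto)
  \<comment> \<open>A missed element has rank at least \<open>k\<close>, hence \<open>S\<close> has
    at least \<open>k\<close> elements and the top set is full.\<close>
  then have "card ?P = k" using t card_top_set[OF assms(1), of k g] by simp
  then have card: "card (T - ?P) \<le> card (?P - T)"
    using assms(3) card_le_sym_Diff[OF fin] by simp
  define c where "c = Max (g ` (T - ?P))"
  have ne: "g ` (T - ?P) \<noteq> {}" using False by auto
  have le_c: "g e \<le> c" if "e \<in> T - ?P" for e
    unfolding c_def by (rule Max_ge) (use fin that in auto)
  have "c \<in> g ` (T - ?P)" unfolding c_def by (rule Max_in) (use fin ne in auto)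
  then obtain z where z: "z \<in> T - ?P" "c = g z" by auto
  have c_le: "c \<le> g e" if "e \<in> ?P - T" for e
  proof -
    have "rank S g e < rank S g z" using that z assms(2) by (auto simp: top_set_def)
    then have "beats g e z"
      using rank_less_iff[OF assms(1), of e z g] that z assms(2) by (auto simp: top_set_def)
    then show ?thesis using z by (auto simp: beats_alt)
  qed
  have "sum g (T - ?P) \<le> card (T - ?P) * c"
    using sum_bounded_above[of "T - ?P" g c] le_c by simp
  also have "\<dots> \<le> card (?P - T) * c" using card by simp
  also have "\<dots> \<le> sum g (?P - T)"
    using sum_bounded_below[of "?P - T" c g] c_le by simp
  finally have "sum g (T - ?P) \<le> sum g (?P - T)" .
  then have "sum g (T \<inter> ?P) + sum g (T - ?P) \<le> sum g (?P \<inter> T) + sum g (?P - T)"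
    by (simp add: Int_commute)
  then show ?thesis
    using sum.Int_Diff[OF fin(1), of g ?P] sum.Int_Diff[OF fin(2), of g T] by simp
qed


section \<open>Greedy offers in the doubled instance\<close>

text \<open>The distance from \<open>B i\<close> down to the next budget in the order
  \<open>beats\<close>, or to 0. Among equal budgets only the one with the largest index can have a
  nonzero gap, so the gaps are the increments between distinct budget levels: they play the role of
  the measure when integrating over thresholds.\<close>

definition gap :: "nat \<Rightarrow> (nat \<Rightarrow> nat) \<Rightarrow> nat \<Rightarrow> nat" where
  "gap m B i = Min (insert (B i) {B i - B h | h. h < m \<and> beats B i h})"

text \<open>Telescoping from above: the best element \<open>j\<close> of a downward closed set has
  as its gap the distance to the maximum of the remaining elements, because these are exactly the
  indices that \<open>j\<close> beats.\<close>

lemma sum_gap_downset: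
  assumes "finite C" "C \<subseteq> {..<m}" "\<And>h i. i \<in> C \<Longrightarrow> h < m \<Longrightarrow> beats B i h \<Longrightarrow> h \<in> C"
  shows "sum (gap m B) C = Max (insert 0 (B ` C))"
  using assms
proof (induction "card C" arbitrary: C)
  case 0
  then show ?case by simp
next
  case (Suc k)
  have "bij_betw (rank C B) C {..<card C}"
    using rank_image[OF Suc.prems(1), of B] inj_on_rank[OF Suc.prems(1), of B]
    by (auto simp: bij_betw_def)
  then obtain j where j: "j \<in> C" "rank C B j = 0"
    using Suc.hyps(2) by (metis bij_betw_iff_bijections lessThan_iff zero_less_Suc)
  have none: "\<not> beats B f j" if "f \<in> C" for f
    using j(2) that Suc.prems(1) by (auto simp: rank_def)
  have above: "beats B j f" if "f \<in> C" "f \<noteq> j" for f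
    using none[OF that(1)] that(2) by (auto simp: beats_alt)
  have le_B: "B h \<le> B j" if "h \<in> C" for h
    using above[OF that] by (cases "h = j") (auto simp: beats_alt)
  let ?C = "C - {j}"
  have IH: "sum (gap m B) ?C = Max (insert 0 (B ` ?C))"
  proof (rule Suc.hyps(1))
    show "k = card ?C" using Suc.hyps(2) Suc.prems(1) j by simp
    show "h \<in> ?C" if "i \<in> ?C" "h < m" "beats B i h" for h i
      using Suc.prems(3)[OF _ that(2,3)] that none[of i] by auto
  qed (use Suc.prems(1,2) in auto)
  have eq: "{B j - B h | h. h < m \<and> beats B j h} = (\<lambda>h. B j - B h) ` ?C"
  proof -
    have "h < m \<and> beats B j h \<longleftrightarrow> h \<in> ?C" for h
      using Suc.prems(2) Suc.prems(3)[OF j(1), of h] above[of h] by (auto simp: beats_alt)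
    then show ?thesis by auto
  qed
  define M where "M = Max (insert 0 (B ` ?C))"
  have fin: "finite ?C" using Suc.prems by auto
  have M_le: "M \<le> B j"
    unfolding M_def using fin le_B by auto
  have M_in: "M = 0 \<or> (\<exists>h\<in>?C. M = B h)"
    unfolding M_def using Max_in[of "insert 0 (B ` ?C)"] fin by auto
  have M_ge: "B h \<le> M" if "h \<in> ?C" for h
    unfolding M_def using that fin by auto
  have "gap m B j = B j - M"
    unfolding gap_def eq
  proof (rule Min_eqI)
    show "B j - M \<in> insert (B j) ((\<lambda>h. B j - B h) ` ?C)"
      using M_in by auto
    fix y assume "y \<in> insert (B j) ((\<lambda>h. B j - B h) ` ?C)"
    then show "B j - M \<le> y" using M_ge by (auto intro!: diff_le_mono2)
  qed (use fin in auto)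
  moreover have "sum (gap m B) C = gap m B j + sum (gap m B) ?C"
    using j Suc.prems(1) by (simp add: sum.remove)
  moreover have "Max (insert 0 (B ` C)) = B j"
    by (rule Max_eqI) (use Suc.prems(1) j(1) le_B in auto)
  ultimately show ?case using IH M_le M_def by simp
qed

lemma sum_gap:
  assumes "s < m"
  shows "(\<Sum>i | i < m \<and> B i \<le> B s. gap m B i) = B s"
proof -
  have "(\<Sum>i | i < m \<and> B i \<le> B s. gap m B i) = Max (insert 0 (B ` {i. i < m \<and> B i \<le> B s}))"
    by (rule sum_gap_downset) (auto simp: beats_alt)
  also have "\<dots> = B s"
    by (rule Max_eqI) (use assms in auto)
  finally show ?thesis .
qed

lemma gap_le: "gap m B i \<le> B i"
  unfolding gap_def by (rule Min_le) auto

text \<open>Edge \<open>e + m\<close> is the copy of edge \<open>e\<close> at the copy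
  \<open>l e + n\<close> of its left end, while right ends are shared: the two copies of a left
  vertex carry its two half-offers. The assumption on \<open>d\<close> is the telescoping property
  of the budget gaps.\<close>

locale market =
  fixes m n \<mu> :: nat and l r B d :: "nat \<Rightarrow> nat"
  assumes mu_pos: "\<mu> > 0"
    and inj: "e < 2*m \<Longrightarrow> f < 2*m \<Longrightarrow> l e = l f \<Longrightarrow> r e = r f \<Longrightarrow> e = f"
    and l_less: "e < m \<Longrightarrow> l e < n"
    and l_copy: "e < m \<Longrightarrow> l (e + m) = l e + n"
    and r_copy: "e < m \<Longrightarrow> r (e + m) = r e"
    and B_copy: "e < m \<Longrightarrow> B (e + m) = B e"
    and gap: "s < m \<Longrightarrow> (\<Sum>i | i < m \<and> B i \<le> B s. d i) = B s"
begin

text \<open>The integer form of \<open>(1 - 1/(2 \<mu>)) ^ k\<close>, multiplied by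
  \<open>(2 \<mu>) ^ (2 * m)\<close>, where \<open>k\<close> counts the half-offers of at least
  \<open>B i\<close> that reach \<open>x\<close>.\<close>

definition weight :: "(nat \<Rightarrow> nat) \<Rightarrow> nat \<Rightarrow> nat \<Rightarrow> nat" where
  "weight A x i = (\<Prod>f<2*m. if r f = x \<and> B i \<le> A f then 2*\<mu> - 1 else 2*\<mu>)"

text \<open>The candidate \<open>s\<close> encodes a vertex \<open>l s\<close> together with a price
  \<open>B s\<close>. Offering this price along \<open>e\<close> adds one factor to the product of
  \<open>r e\<close> at every threshold up to \<open>B s\<close>; up to a common factor,
  \<open>gain\<close> is the resulting increase of the potential if the vertex has made no offer
  before.\<close>

definition gain :: "(nat \<Rightarrow> nat) \<Rightarrow> nat \<Rightarrow> nat \<Rightarrow> nat" where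
  "gain A s e = (if l e = l s \<and> B s \<le> B e
     then \<Sum>i | i < m \<and> B i \<le> B s. d i * weight A (r e) i else 0)"

definition chosen :: "(nat \<Rightarrow> nat) \<Rightarrow> nat \<Rightarrow> nat set" where
  "chosen A s = {e \<in> top_set \<mu> {..<2*m} (gain A s). 0 < gain A s e}"

definition total :: "(nat \<Rightarrow> nat) \<Rightarrow> nat \<Rightarrow> nat" where
  "total A s = sum (gain A s) (chosen A s)"

text \<open>The greedy procedure as a relation: which of several best candidates is taken stays
  open, so the analysis does not depend on how the program breaks ties.\<close>

inductive reach :: "nat \<Rightarrow> (nat \<Rightarrow> nat) \<Rightarrow> (nat \<Rightarrow> nat) \<Rightarrow> bool" where
  reach_0: "(\<And>e. e < 2*m \<Longrightarrow> A e = 0) \<Longrightarrow> (\<And>u. u < 2*n \<Longrightarrow> p u = 0) \<Longrightarrow> reach 0 A p"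
| reach_skip: "reach U A p \<Longrightarrow> (\<And>s. s < 2*m \<Longrightarrow> l s = U \<Longrightarrow> total A s = 0) \<Longrightarrow>
    reach (Suc U) A p"
| reach_pick: "reach U A p \<Longrightarrow> s < 2*m \<Longrightarrow> l s = U \<Longrightarrow> 0 < total A s \<Longrightarrow>
    (\<And>s'. s' < 2*m \<Longrightarrow> l s' = U \<Longrightarrow> total A s' \<le> total A s) \<Longrightarrow>
    reach (Suc U) (\<lambda>e. if e \<in> chosen A s then B s else A e) (p(U := B s))"

lemma gap':
  assumes "s < 2*m" shows "(\<Sum>i | i < m \<and> B i \<le> B s. d i) = B s"
proof (cases "s < m")
  case False
  with assms have "s - m < m" "s - m + m = s" by auto
  then show ?thesis using gap[of "s - m"] B_copy[of "s - m"] by simp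
qed (rule gap)

lemma gap_zero:
  assumes "i < m" "B i = 0" shows "d i = 0"
  using gap[OF assms(1)] assms by simp

lemma l_less2: "e < 2*m \<Longrightarrow> l e < 2*n"
  using l_less[of e] l_less[of "e - m"] l_copy[of "e - m"] by (cases "e < m") auto

lemma chosenD: "e \<in> chosen A s \<Longrightarrow> e < 2*m \<and> l e = l s \<and> B s \<le> B e \<and> 0 < gain A s e"
  by (auto simp: chosen_def top_set_def gain_def split: if_splits)

lemma finite_chosen: "finite (chosen A s)"
  by (rule finite_subset[of _ "{..<2*m}"]) (auto dest: chosenD)

lemma card_chosen: "card (chosen A s) \<le> \<mu>"
proof -
  have "card (chosen A s) \<le> card (top_set \<mu> {..<2*m} (gain A s))"
    by (rule card_mono) (auto simp: chosen_def intro: finite_subset[OF top_set_subset])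
  then show ?thesis by (simp add: card_top_set)
qed

lemma total_eq: "total A s = sum (gain A s) (top_set \<mu> {..<2*m} (gain A s))"
  unfolding total_def chosen_def
  by (rule sum.mono_neutral_left) (auto intro: finite_subset[OF top_set_subset])

text \<open>A visited vertex writes offers only on its own edges, so what holds at the other
  vertices persists. These facts yield the budget constraints and the left capacities of the
  solution; that a nonzero price is a positive budget at the vertex shows later that the right side
  stays free of charge.\<close>

lemma reach_facts:
  assumes "reach U A p"
  shows "(\<forall>e<2*m. (l e \<ge> U \<longrightarrow> A e = 0) \<and> (A e = 0 \<or> (A e = p (l e) \<and> A e \<le> B e \<and> (\<exists>s<2*m. A e = B s)))) \<and>
    (\<forall>u<2*n. (u \<ge> U \<longrightarrow> p u = 0) \<and> (p u \<noteq> 0 \<longrightarrow> (\<exists>e<2*m. l e = u \<and> p u = B e \<and> 0 < B e)) \<and> card {e. e < 2*m \<and> l e = u \<and> 0 < A e} \<le> \<mu>)"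
  using assms
proof (induction rule: reach.induct)
  case (reach_0 A p)
  have "{e. e < 2*m \<and> l e = u \<and> 0 < A e} = {}" for u using reach_0(1) by auto
  then have "card {e. e < 2*m \<and> l e = u \<and> 0 < A e} \<le> \<mu>" for u by (metis card.empty le0)
  then show ?case using reach_0 by auto
next
  case (reach_skip U A p)
  then show ?case by auto
next
  case (reach_pick U A p s)
  let ?A = "\<lambda>e. if e \<in> chosen A s then B s else A e"
  have ch: "e < 2*m" "l e = U" "B s \<le> B e" if "e \<in> chosen A s" for e
    using chosenD[OF that] reach_pick by auto
  have old: "A e = 0" if "e < 2*m" "l e = U" for e
    using reach_pick.IH that by auto
  have edges: "(l e \<ge> Suc U \<longrightarrow> ?A e = 0) \<and>
    (?A e = 0 \<or> (?A e = (p(U := B s)) (l e) \<and> ?A e \<le> B e \<and> (\<exists>s<2*m. ?A e = B s)))" if "e < 2*m" for e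
  proof (cases "e \<in> chosen A s")
    case True
    then show ?thesis using ch[OF True] reach_pick.hyps by auto
  next
    case False
    then show ?thesis using reach_pick.IH old that by auto
  qed
  have verts: "(u \<ge> Suc U \<longrightarrow> (p(U := B s)) u = 0) \<and>
     ((p(U := B s)) u \<noteq> 0 \<longrightarrow> (\<exists>e<2*m. l e = u \<and> (p(U := B s)) u = B e \<and> 0 < B e)) \<and>
     card {e. e < 2*m \<and> l e = u \<and> 0 < ?A e} \<le> \<mu>" if "u < 2*n" for u
  proof (cases "u = U")
    case True
    have "{e. e < 2*m \<and> l e = u \<and> 0 < ?A e} \<subseteq> chosen A s"
      using old True by auto
    then have "card {e. e < 2*m \<and> l e = u \<and> 0 < ?A e} \<le> \<mu>"
      using card_mono[OF finite_chosen] card_chosen order_trans by blast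
    then show ?thesis using True reach_pick.hyps by auto
  next
    case False
    then have "{e. e < 2*m \<and> l e = u \<and> 0 < ?A e} = {e. e < 2*m \<and> l e = u \<and> 0 < A e}"
      using ch by auto
    then show ?thesis using False reach_pick.IH that by auto
  qed
  show ?case using edges verts by blast
qed

section \<open>The potential and its increase in one greedy choice\<close>

definition q :: real where "q = 1 - 1 / (2 * real \<mu>)"

text \<open>The last identity makes one added half-offer worth half of the current product.\<close>

lemma q_bounds: "0 \<le> q" "q \<le> 1" "real (2*\<mu> - 1) = 2 * real \<mu> * q" "real \<mu> * (1 - q) = 1/2"
  using mu_pos by (auto simp: q_def field_simps of_nat_diff)

definition rho :: "(nat \<Rightarrow> nat) \<Rightarrow> nat \<Rightarrow> nat \<Rightarrow> real" where
  "rho A x i = (\<Prod>f<2*m. if r f = x \<and> B i \<le> A f then q else 1)"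

lemma rho_bounds: "0 \<le> rho A x i" "rho A x i \<le> 1"
  unfolding rho_def using q_bounds by (auto intro!: prod_nonneg prod_le_1)

lemma weight_rho: "real (weight A x i) = (2 * real \<mu>) ^ (2*m) * rho A x i"
proof -
  have "real (weight A x i) = (\<Prod>f<2*m. (2 * real \<mu>) * (if r f = x \<and> B i \<le> A f then q else 1))"
    unfolding weight_def of_nat_prod by (rule prod.cong) (use q_bounds in auto)
  then show ?thesis by (simp add: prod.distrib rho_def)
qed

definition rgain :: "(nat \<Rightarrow> nat) \<Rightarrow> nat \<Rightarrow> nat \<Rightarrow> real" where
  "rgain A s e = (\<Sum>i | i < m \<and> B i \<le> B s. d i * rho A (r e) i)"

lemma gain_rgain:
  "real (gain A s e) = (if l e = l s \<and> B s \<le> B e then (2 * real \<mu>) ^ (2*m) * rgain A s e else 0)"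
  by (simp add: gain_def rgain_def weight_rho sum_distrib_left mult_ac)

text \<open>The benchmark side of the greedy choice: the edges of an optimal solution at
  \<open>l s\<close> are one of the competing sets \<open>T\<close>, their number being bounded by
  the left capacity.\<close>

lemma total_ge:
  assumes "T \<subseteq> {e. e < 2*m \<and> l e = l s \<and> B s \<le> B e}" "card T \<le> \<mu>"
  shows "(2 * real \<mu>) ^ (2*m) * (\<Sum>e\<in>T. rgain A s e) \<le> real (total A s)"
proof -
  have "(2 * real \<mu>) ^ (2*m) * (\<Sum>e\<in>T. rgain A s e) = real (sum (gain A s) T)"
    unfolding of_nat_sum sum_distrib_left using assms by (intro sum.cong) (auto simp: gain_rgain)
  also have "\<dots> \<le> real (total A s)"
    unfolding total_eq of_nat_le_iff by (rule sum_le_sum_top_set) (use assms in auto)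
  finally show ?thesis .
qed

lemma total_rgain: "real (total A s) = (2 * real \<mu>) ^ (2*m) * (\<Sum>e\<in>chosen A s. rgain A s e)"
  unfolding total_def of_nat_sum sum_distrib_left
  by (intro sum.cong) (auto simp: gain_rgain dest!: chosenD)

definition potential :: "(nat \<Rightarrow> nat) \<Rightarrow> real" where
  "potential A = (\<Sum>x\<in>r ` {..<2*m}. \<Sum>i<m. d i * (\<mu> * (1 - rho A x i)))"

lemma rho_antimono:
  assumes "\<And>e. e < 2*m \<Longrightarrow> A e \<le> A' e"
  shows "rho A' x i \<le> rho A x i"
  unfolding rho_def
  by (rule prod_mono) (use assms q_bounds order_trans in \<open>fastforce\<close>)

text \<open>Diminishing returns: larger offers only shrink the products. Gains measured at the end
  of a round therefore bound from below those seen when a choice was made.\<close>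

lemma rgain_antimono:
  assumes "\<And>e. e < 2*m \<Longrightarrow> A e \<le> A' e"
  shows "rgain A' s e \<le> rgain A s e"
  unfolding rgain_def by (intro sum_mono mult_left_mono rho_antimono assms) auto

text \<open>A vertex \<open>x\<close> receives at most one offer from each vertex \<open>U\<close>, since the graph is simple.\<close>

lemma rho_pick:
  assumes s: "s < 2*m" and i: "i < m" "0 < B i" and old: "\<And>e. e < 2*m \<Longrightarrow> l e = l s \<Longrightarrow> A e = 0"
  shows "rho (\<lambda>e. if e \<in> chosen A s then B s else A e) x i =
    (if x \<in> r ` chosen A s \<and> B i \<le> B s then q * rho A x i else rho A x i)"
proof (cases "x \<in> r ` chosen A s \<and> B i \<le> B s")
  case True
  then obtain e where e: "e \<in> chosen A s" "x = r e" by auto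
  have e': "e < 2*m" "l e = l s" using chosenD[OF e(1)] by auto
  have uniq: "f = e" if "f \<in> chosen A s" "r f = x" for f
    using that chosenD[OF that(1)] e e' by (metis inj)
  let ?h = "\<lambda>A f. if r f = x \<and> B i \<le> A f then q else (1::real)"
  let ?A = "\<lambda>e. if e \<in> chosen A s then B s else A e"
  have "rho ?A x i = ?h ?A e * (\<Prod>f\<in>{..<2*m} - {e}. ?h ?A f)"
    unfolding rho_def by (rule prod.remove) (use e' in auto)
  also have "(\<Prod>f\<in>{..<2*m} - {e}. ?h ?A f) = (\<Prod>f\<in>{..<2*m} - {e}. ?h A f)"
    by (intro prod.cong) (use uniq in auto)
  also have "(\<Prod>f\<in>{..<2*m} - {e}. ?h A f) = rho A x i"
  proof -
    have "rho A x i = ?h A e * (\<Prod>f\<in>{..<2*m} - {e}. ?h A f)"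
      unfolding rho_def by (rule prod.remove) (use e' in auto)
    moreover have "A e = 0" using old e' by auto
    ultimately show ?thesis using i by simp
  qed
  finally show ?thesis using True e by simp
next
  case False
  have "rho (\<lambda>e. if e \<in> chosen A s then B s else A e) x i = rho A x i"
    unfolding rho_def
  proof (intro prod.cong refl)
    fix f assume "f \<in> {..<2*m}"
    then show "(if r f = x \<and> B i \<le> (if f \<in> chosen A s then B s else A f) then q else 1) =
      (if r f = x \<and> B i \<le> A f then q else 1)"
      using False i old[of f] chosenD[of f A s] by auto
  qed
  then show ?thesis using False by auto
qed

text \<open>At a chosen right end every product for a threshold up to \<open>B s\<close> changes
  from \<open>rho\<close> to \<open>q * rho\<close>, and
  \<open>\<mu> (rho - q * rho) = rho / 2\<close>. The chosen edges have distinct right ends, so the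
  sum over right ends is a sum over chosen edges.\<close>

lemma potential_pick:
  assumes s: "s < 2*m" and old: "\<And>e. e < 2*m \<Longrightarrow> l e = l s \<Longrightarrow> A e = 0"
  shows "potential (\<lambda>e. if e \<in> chosen A s then B s else A e) =
    potential A + (\<Sum>e\<in>chosen A s. rgain A s e) / 2"
proof -
  let ?A = "\<lambda>e. if e \<in> chosen A s then B s else A e"
  have "potential ?A - potential A =
    (\<Sum>x\<in>r ` {..<2*m}. \<Sum>i<m. d i * (\<mu> * (rho A x i - rho ?A x i)))"
    unfolding potential_def sum_subtractf[symmetric]
    by (intro sum.cong refl) (simp add: algebra_simps)
  also have "\<dots> = (\<Sum>x\<in>r ` {..<2*m}. if x \<in> r ` chosen A s
      then \<Sum>i<m. (if B i \<le> B s then d i * rho A x i / 2 else 0) else 0)"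
  proof (intro sum.cong refl)
    fix x
    have *: "d i * (\<mu> * (rho A x i - rho ?A x i)) =
      (if x \<in> r ` chosen A s \<and> B i \<le> B s then d i * rho A x i / 2 else 0)" if "i < m" for i
    \<comment> \<open>At threshold 0 even an absent offer counts, so the product rule covers only
      positive thresholds; the others have \<open>d i = 0\<close>.\<close>
    proof (cases "B i = 0")
      case True
      then show ?thesis using gap_zero[OF that] by simp
    next
      case False
      then have eq: "rho ?A x i = (if x \<in> r ` chosen A s \<and> B i \<le> B s then q * rho A x i else rho A x i)"
        using rho_pick[OF s that _ old] by simp
      have "\<mu> * (rho A x i - q * rho A x i) = (\<mu> * (1 - q)) * rho A x i"
        by (simp add: algebra_simps)
      also have "\<dots> = rho A x i / 2" by (simp only: q_bounds(4))
      finally have half: "\<mu> * (rho A x i - q * rho A x i) = rho A x i / 2" .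
      show ?thesis
      proof (cases "x \<in> r ` chosen A s \<and> B i \<le> B s")
        case True
        then show ?thesis unfolding eq by (simp only: if_True half simp_thms times_divide_eq_right)
      next
        case False
        then show ?thesis unfolding eq by (simp only: if_False) simp
      qed
    qed
    show "(\<Sum>i<m. d i * (\<mu> * (rho A x i - rho ?A x i))) =
      (if x \<in> r ` chosen A s then \<Sum>i<m. (if B i \<le> B s then d i * rho A x i / 2 else 0) else 0)"
      using * by simp
  qed
  also have "\<dots> = (\<Sum>x\<in>r ` chosen A s. \<Sum>i<m. (if B i \<le> B s then d i * rho A x i / 2 else 0))"
    by (rule sum.mono_neutral_cong_right) (auto dest: chosenD)
  also have "\<dots> = (\<Sum>e\<in>chosen A s. \<Sum>i<m. (if B i \<le> B s then d i * rho A (r e) i / 2 else 0))"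
    by (rule sum.reindex_cong[of r]) (auto intro!: inj_onI dest!: chosenD intro: inj)
  also have "\<dots> = (\<Sum>e\<in>chosen A s. rgain A s e / 2)"
  proof (intro sum.cong refl)
    fix e
    have "rgain A s e / 2 = (\<Sum>i | i \<in> {..<m} \<and> B i \<le> B s. d i * rho A (r e) i / 2)"
      by (simp add: rgain_def sum_divide_distrib)
    also have "\<dots> = (\<Sum>i<m. (if B i \<le> B s then d i * rho A (r e) i / 2 else 0))"
      by (rule sum.inter_filter) simp
    finally show "(\<Sum>i<m. (if B i \<le> B s then d i * rho A (r e) i / 2 else 0)) = rgain A s e / 2" ..
  qed
  finally show ?thesis by (simp add: sum_divide_distrib)
qed

end


section \<open>Randomized rounding\<close>

text \<open>Bernoulli's inequality gives the bound \<open>k\<close>, nonnegativity of the power the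
  bound \<open>\<mu>\<close>.\<close>

lemma min_ge_geometric:
  assumes "\<mu> > 0"
  shows "real \<mu> * (1 - (1 - 1 / real \<mu>) ^ k) \<le> real (min \<mu> k)"
proof -
  have "1 + real k * (- (1 / real \<mu>)) \<le> (1 + - (1 / real \<mu>)) ^ k"
    by (rule Bernoulli_inequality) (use assms in auto)
  then have "real \<mu> * (1 - (1 - 1 / real \<mu>) ^ k) \<le> real \<mu> * (real k * (1 / real \<mu>))"
    by (intro mult_left_mono) auto
  also have "\<dots> = real k" using assms by simp
  finally have 1: "real \<mu> * (1 - (1 - 1 / real \<mu>) ^ k) \<le> real k" .
  have "0 \<le> (1 - 1 / real \<mu>) ^ k" using assms by (intro zero_le_power) auto
  then have "real \<mu> * (1 - (1 - 1 / real \<mu>) ^ k) \<le> real \<mu> * 1"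
    by (intro mult_left_mono) auto
  then show ?thesis using 1 by (auto simp: min_def)
qed

lemma prod_double:
  fixes h :: "nat \<Rightarrow> 'a :: comm_monoid_mult"
  shows "(\<Prod>f<2*m. h f) = (\<Prod>f<m. h f * h (f + m))"
proof -
  have "(\<Prod>f<2*m. h f) = prod h {0..<m} * prod h {m..<m+m}"
    by (simp add: prod.atLeastLessThan_concat atLeast0LessThan[symmetric] mult_2)
  also have "prod h {m..<m+m} = (\<Prod>f<m. h (f + m))"
    using prod.shift_bounds_nat_ivl[of h 0 m m] by (simp add: atLeast0LessThan)
  finally show ?thesis by (simp add: prod.distrib atLeast0LessThan)
qed

abbreviation coins :: "nat set \<Rightarrow> (nat \<Rightarrow> bool) pmf" where
  "coins A \<equiv> Pi_pmf A False (\<lambda>_. bernoulli_pmf (1/2))"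

lemma finite_coins: "finite A \<Longrightarrow> finite (set_pmf (coins A))"
  by (simp add: set_Pi_pmf finite_PiE_dflt)

lemma integrable_coins: "finite A \<Longrightarrow> integrable (measure_pmf (coins A)) (f :: _ \<Rightarrow> real)"
  by (intro integrable_measure_pmf_finite finite_coins)

lemma expectation_mono_finite:
  fixes f g :: "'a \<Rightarrow> real"
  assumes "finite (set_pmf p)" "\<And>x. x \<in> set_pmf p \<Longrightarrow> f x \<le> g x"
  shows "measure_pmf.expectation p f \<le> measure_pmf.expectation p g"
  by (rule integral_mono_AE)
    (use assms in \<open>auto intro: integrable_measure_pmf_finite simp: AE_measure_pmf_iff\<close>)

context market
begin

text \<open>Progress while the vertices from \<open>a\<close> to below \<open>U\<close> are visited,
  against a benchmark that uses the edges \<open>T\<close> and charges the budget of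
  \<open>sg (l e)\<close> at \<open>l e\<close>. At each vertex the greedy choice is at least as
  good as the benchmark there, and by diminishing returns its gain may be measured in the final
  state \<open>A\<close>. The state at \<open>a\<close> is existentially quantified since
  \<open>reach\<close> is a relation.\<close>

lemma reach_phase:
  assumes "reach U A p" "a \<le> U"
  shows "\<exists>A0 p0. reach a A0 p0 \<and> (\<forall>e<2*m. A0 e \<le> A e) \<and>
    (\<forall>sg T. T \<subseteq> {e. e < 2*m \<and> a \<le> l e \<and> l e < U} \<longrightarrow>
       (\<forall>e\<in>T. sg (l e) < 2*m \<and> l (sg (l e)) = l e \<and> B (sg (l e)) \<le> B e) \<longrightarrow>
       (\<forall>u. card {e \<in> T. l e = u} \<le> \<mu>) \<longrightarrow>
       potential A0 + (\<Sum>e\<in>T. rgain A (sg (l e)) e) / 2 \<le> potential A)"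
  using assms
proof (induction U arbitrary: A p)
  case 0
  then have "(\<Sum>e\<in>T. rgain A (sg (l e)) e) = 0"
    if "T \<subseteq> {e. e < 2*m \<and> a \<le> l e \<and> l e < 0}" for T sg using that by (intro sum.neutral) auto
  then show ?case using 0 by - (rule exI[of _ A], rule exI[of _ p], auto)
next
  case (Suc U A' p')
  show ?case
  proof (cases "a \<le> U")
    case False
    have "(\<Sum>e\<in>T. rgain A' (sg (l e)) e) = 0"
      if "T \<subseteq> {e. e < 2*m \<and> a \<le> l e \<and> l e < Suc U}" for T sg
      using that False by (intro sum.neutral) auto
    then have "\<forall>sg T. T \<subseteq> {e. e < 2*m \<and> a \<le> l e \<and> l e < Suc U} \<longrightarrow>
        potential A' + (\<Sum>e\<in>T. rgain A' (sg (l e)) e) / 2 \<le> potential A'" by simp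
    moreover have "a = Suc U" using False Suc.prems by simp
    ultimately show ?thesis using Suc.prems by - (rule exI[of _ A'], rule exI[of _ p'], blast)
  next
    case True
    \<comment> \<open>Both ways of extending \<open>reach\<close> are brought to one form: the
      potential grows by at least half the gain of any admissible edge set at
      \<open>U\<close>.\<close>
    obtain A p where A: "reach U A p" "\<And>e. e < 2*m \<Longrightarrow> A e \<le> A' e"
      and step: "\<And>s T. T \<subseteq> {e. e < 2*m \<and> l e = U \<and> B s \<le> B e} \<Longrightarrow> s < 2*m \<Longrightarrow> l s = U \<Longrightarrow>
        card T \<le> \<mu> \<Longrightarrow> potential A + (\<Sum>e\<in>T. rgain A s e) / 2 \<le> potential A'"
      and mono: "potential A \<le> potential A'"
    proof -
      have pos: "0 < (2 * real \<mu>) ^ (2*m)" using mu_pos by simp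
      have total: "(\<Sum>e\<in>T. rgain A s e) \<le> (\<Sum>e\<in>chosen A s'. rgain A s' e)"
        if "T \<subseteq> {e. e < 2*m \<and> l e = U \<and> B s \<le> B e}" "l s = U" "card T \<le> \<mu>"
          "total A s \<le> total A s'" for A T s s'
      proof -
        have "(2 * real \<mu>) ^ (2*m) * (\<Sum>e\<in>T. rgain A s e) \<le> real (total A s)"
          by (rule total_ge) (use that in auto)
        also have "\<dots> \<le> real (total A s')" using that by simp
        also have "\<dots> = (2 * real \<mu>) ^ (2*m) * (\<Sum>e\<in>chosen A s'. rgain A s' e)"
          by (rule total_rgain)
        finally show ?thesis using pos by (rule mult_left_le_imp_le)
      qed
      show ?thesis using Suc.prems(1)
      proof (cases rule: reach.cases)
        case (reach_skip)
        show ?thesis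
        proof (rule that[of A' p'])
          fix s T
          assume T: "T \<subseteq> {e. e < 2*m \<and> l e = U \<and> B s \<le> B e}" "s < 2*m" "l s = U" "card T \<le> \<mu>"
          have "(2 * real \<mu>) ^ (2*m) * (\<Sum>e\<in>T. rgain A' s e) \<le> real (total A' s)"
            by (rule total_ge) (use T in auto)
          also have "\<dots> = 0" using reach_skip T by simp
          finally have "(2 * real \<mu>) ^ (2*m) * (\<Sum>e\<in>T. rgain A' s e) \<le> (2 * real \<mu>) ^ (2*m) * 0"
            by simp
          then have "(\<Sum>e\<in>T. rgain A' s e) \<le> 0" using pos by (rule mult_left_le_imp_le)
          then show "potential A' + (\<Sum>e\<in>T. rgain A' s e) / 2 \<le> potential A'" by simp
        qed (use reach_skip in auto)
      next
        case (reach_pick A p s)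
        have old: "A e = 0" if "e < 2*m" "l e = l s" for e
          using reach_facts[OF reach_pick(3)] that reach_pick by auto
        have pot: "potential A' = potential A + (\<Sum>e\<in>chosen A s. rgain A s e) / 2"
          unfolding reach_pick(1) by (rule potential_pick[OF reach_pick(4) old])
        show ?thesis
        proof (rule that[of A p])
          show "A e \<le> A' e" if "e < 2*m" for e
            unfolding reach_pick(1) using old[OF that] chosenD[of e A s] by auto
          show "potential A + (\<Sum>e\<in>T. rgain A s' e) / 2 \<le> potential A'"
            if "T \<subseteq> {e. e < 2*m \<and> l e = U \<and> B s' \<le> B e}" "s' < 2*m" "l s' = U" "card T \<le> \<mu>" for s' T
            using total[OF that(1,3,4) reach_pick(7)[OF that(2,3)]] pot by simp
          show "potential A \<le> potential A'"
            using pot by (simp add: rgain_def sum_nonneg rho_bounds)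
        qed (use reach_pick in auto)
      qed
    qed
    from Suc.IH[OF A(1) True] obtain A0 p0 where A0: "reach a A0 p0" "\<forall>e<2*m. A0 e \<le> A e"
      and IH: "\<And>sg T. T \<subseteq> {e. e < 2*m \<and> a \<le> l e \<and> l e < U} \<Longrightarrow>
       (\<forall>e\<in>T. sg (l e) < 2*m \<and> l (sg (l e)) = l e \<and> B (sg (l e)) \<le> B e) \<Longrightarrow>
       (\<forall>u. card {e \<in> T. l e = u} \<le> \<mu>) \<Longrightarrow>
       potential A0 + (\<Sum>e\<in>T. rgain A (sg (l e)) e) / 2 \<le> potential A" by blast
    have "potential A0 + (\<Sum>e\<in>T. rgain A' (sg (l e)) e) / 2 \<le> potential A'"
      if T: "T \<subseteq> {e. e < 2*m \<and> a \<le> l e \<and> l e < Suc U}"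
        and sg: "\<forall>e\<in>T. sg (l e) < 2*m \<and> l (sg (l e)) = l e \<and> B (sg (l e)) \<le> B e"
        and deg: "\<forall>u. card {e \<in> T. l e = u} \<le> \<mu>" for sg T
    proof -
      let ?T1 = "{e \<in> T. l e < U}" and ?T2 = "{e \<in> T. l e = U}"
      have fin: "finite T" using T by (rule finite_subset) auto
      have "potential A0 + (\<Sum>e\<in>?T1. rgain A (sg (l e)) e) / 2 \<le> potential A"
      proof (rule IH)
        show "\<forall>u. card {e \<in> ?T1. l e = u} \<le> \<mu>"
        proof
          fix u
          have "card {e \<in> ?T1. l e = u} \<le> card {e \<in> T. l e = u}"
            by (rule card_mono) (use fin in auto)
          then show "card {e \<in> ?T1. l e = u} \<le> \<mu>" using deg by (meson order_trans)
        qed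
      qed (use T sg in auto)
      moreover have "potential A + (\<Sum>e\<in>?T2. rgain A (sg U) e) / 2 \<le> potential A'"
      \<comment> \<open>Without a benchmark edge at \<open>U\<close> nothing is known about
        \<open>sg U\<close>, and monotonicity of the potential has to suffice.\<close>
      proof (cases "?T2 = {}")
        case True
        then show ?thesis using mono by (simp only: True sum.empty)
      next
        case False
        then obtain f where "f \<in> T" "l f = U" by auto
        then show ?thesis by (intro step) (use T sg deg in auto)
      qed
      moreover have "(\<Sum>e\<in>T. rgain A (sg (l e)) e) =
          (\<Sum>e\<in>?T1. rgain A (sg (l e)) e) + (\<Sum>e\<in>?T2. rgain A (sg U) e)"
      proof -
        have "T = ?T1 \<union> ?T2" using T by auto
        then have "(\<Sum>e\<in>T. rgain A (sg (l e)) e) = (\<Sum>e\<in>?T1 \<union> ?T2. rgain A (sg (l e)) e)" by simp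
        also have "\<dots> = (\<Sum>e\<in>?T1. rgain A (sg (l e)) e) + (\<Sum>e\<in>?T2. rgain A (sg (l e)) e)"
          by (rule sum.union_disjoint) (use fin in auto)
        finally show ?thesis by simp
      qed
      moreover have "(\<Sum>e\<in>T. rgain A' (sg (l e)) e) \<le> (\<Sum>e\<in>T. rgain A (sg (l e)) e)"
        by (intro sum_mono rgain_antimono A)
      ultimately show ?thesis by simp
    qed
    then show ?thesis
      using A0 A(2) by - (rule exI[of _ A0], rule exI[of _ p0], auto intro: order_trans)
  qed
qed

text \<open>The gains fall short of the benchmark by terms \<open>d i * (1 - rho A x i)\<close>. For
  each right end \<open>x\<close> and each \<open>i\<close> at most \<open>\<mu>\<close> edges of
  \<open>T\<close> produce such a term, and \<open>\<mu>\<close> copies of all of them make up the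
  potential.\<close>

lemma sum_rgain_ge:
  assumes T: "T \<subseteq> {..<2*m}" and deg: "\<And>x. card {e \<in> T. r e = x} \<le> \<mu>"
    and sg: "\<And>e. e \<in> T \<Longrightarrow> sg e < 2*m"
  shows "(\<Sum>e\<in>T. real (B (sg e))) - potential A \<le> (\<Sum>e\<in>T. rgain A (sg e) e)"
proof -
  have fin: "finite T" using T finite_subset by auto
  have "(\<Sum>e\<in>T. real (B (sg e))) - (\<Sum>e\<in>T. rgain A (sg e) e) =
    (\<Sum>e\<in>T. \<Sum>i | i < m \<and> B i \<le> B (sg e). d i * (1 - rho A (r e) i))"
    unfolding sum_subtractf[symmetric]
  proof (intro sum.cong refl)
    fix e assume "e \<in> T"
    have "real (B (sg e)) = (\<Sum>i | i < m \<and> B i \<le> B (sg e). real (d i))"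
      using gap'[OF sg[OF \<open>e \<in> T\<close>]] by (metis of_nat_sum)
    then show "real (B (sg e)) - rgain A (sg e) e =
      (\<Sum>i | i < m \<and> B i \<le> B (sg e). d i * (1 - rho A (r e) i))"
      by (simp add: rgain_def sum_subtractf[symmetric] algebra_simps)
  qed
  also have "\<dots> \<le> (\<Sum>e\<in>T. \<Sum>i<m. d i * (1 - rho A (r e) i))"
    by (intro sum_mono sum_mono2) (auto simp: rho_bounds)
  also have "\<dots> = (\<Sum>x\<in>r ` {..<2*m}. \<Sum>e | e \<in> T \<and> r e = x. \<Sum>i<m. d i * (1 - rho A (r e) i))"
    by (rule sum.group[symmetric]) (use T fin in auto)
  also have "\<dots> = (\<Sum>x\<in>r ` {..<2*m}. card {e \<in> T. r e = x} * (\<Sum>i<m. d i * (1 - rho A x i)))"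
    by simp
  also have "\<dots> \<le> (\<Sum>x\<in>r ` {..<2*m}. \<mu> * (\<Sum>i<m. d i * (1 - rho A x i)))"
    by (intro sum_mono mult_right_mono sum_nonneg) (auto simp: deg rho_bounds)
  also have "\<dots> = potential A"
    by (simp add: potential_def sum_distrib_left mult_ac)
  finally show ?thesis by simp
qed

text \<open>Both rounds are compared with the same benchmark. The first gives
  \<open>\<Phi>1 \<ge> (V - \<Phi>1) / 2\<close>, so \<open>\<Phi>1 \<ge> V / 3\<close>; the second
  gives \<open>\<Phi>2 \<ge> V / 3 + (V - \<Phi>2) / 2\<close>, that is
  \<open>3/2 \<Phi>2 \<ge> 5/6 V\<close>.\<close>

lemma potential_reach:
  assumes reach: "reach (2*n) A p" and F: "F \<subseteq> {..<m}"
    and sg: "\<And>j. j \<in> F \<Longrightarrow> sg (l j) < m \<and> l (sg (l j)) = l j \<and> B (sg (l j)) \<le> B j"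
    and degl: "\<And>u. card {j \<in> F. l j = u} \<le> \<mu>" and degr: "\<And>x. card {j \<in> F. r j = x} \<le> \<mu>"
  shows "5/9 * (\<Sum>j\<in>F. real (B (sg (l j)))) \<le> potential A"
proof -
  let ?V = "\<Sum>j\<in>F. real (B (sg (l j)))"
  obtain A1 p1 where A1: "reach n A1 p1"
    and ph2: "\<And>sg T. T \<subseteq> {e. e < 2*m \<and> n \<le> l e \<and> l e < 2*n} \<Longrightarrow>
       (\<forall>e\<in>T. sg (l e) < 2*m \<and> l (sg (l e)) = l e \<and> B (sg (l e)) \<le> B e) \<Longrightarrow>
       (\<forall>u. card {e \<in> T. l e = u} \<le> \<mu>) \<Longrightarrow>
       potential A1 + (\<Sum>e\<in>T. rgain A (sg (l e)) e) / 2 \<le> potential A"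
    using reach_phase[OF reach, of n] by auto
  obtain A0 p0 where A0: "reach 0 A0 p0"
    and ph1: "\<And>sg T. T \<subseteq> {e. e < 2*m \<and> 0 \<le> l e \<and> l e < n} \<Longrightarrow>
       (\<forall>e\<in>T. sg (l e) < 2*m \<and> l (sg (l e)) = l e \<and> B (sg (l e)) \<le> B e) \<Longrightarrow>
       (\<forall>u. card {e \<in> T. l e = u} \<le> \<mu>) \<Longrightarrow>
       potential A0 + (\<Sum>e\<in>T. rgain A1 (sg (l e)) e) / 2 \<le> potential A1"
    using reach_phase[OF A1, of 0] by auto
  have pos: "potential A0 \<ge> 0"
    unfolding potential_def by (intro sum_nonneg mult_nonneg_nonneg) (auto simp: rho_bounds)
  have "?V - potential A1 \<le> (\<Sum>j\<in>F. rgain A1 (sg (l j)) j)"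
    by (rule sum_rgain_ge) (use F degr sg in fastforce)+
  moreover have "potential A0 + (\<Sum>e\<in>F. rgain A1 (sg (l e)) e) / 2 \<le> potential A1"
    by (rule ph1) (use F sg degl l_less in fastforce)+
  ultimately have 1: "?V / 3 \<le> potential A1" using pos by simp
  \<comment> \<open>The second round visits the copies, so the benchmark is carried over to them:
    left ends are shifted back by \<open>n\<close> before \<open>sg\<close> is applied, and the
    resulting edge is shifted forward by \<open>m\<close>.\<close>
  let ?T = "(\<lambda>j. j + m) ` F" and ?sg = "\<lambda>u. sg (u - n) + m"
  have inj_add: "inj_on (\<lambda>j. j + m) X" for X by (auto simp: inj_on_def)
  have Fm: "j < m" if "j \<in> F" for j using F that by auto
  have "(\<Sum>e\<in>?T. real (B (?sg (l e)))) - potential A \<le> (\<Sum>e\<in>?T. rgain A (?sg (l e)) e)"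
  proof (rule sum_rgain_ge)
    show "card {e \<in> ?T. r e = x} \<le> \<mu>" for x
    proof -
      have "{e \<in> ?T. r e = x} = (\<lambda>j. j + m) ` {j \<in> F. r j = x}"
        using r_copy Fm by auto
      then show ?thesis by (simp add: card_image[OF inj_add] degr)
    qed
  qed (use Fm l_copy sg in force)+
  moreover have "potential A1 + (\<Sum>e\<in>?T. rgain A (?sg (l e)) e) / 2 \<le> potential A"
  proof (rule ph2)
    show "\<forall>u. card {e \<in> ?T. l e = u} \<le> \<mu>"
    proof
      fix u
      have "{e \<in> ?T. l e = u} \<subseteq> (\<lambda>j. j + m) ` {j \<in> F. l j = u - n}"
        using l_copy Fm by auto
      then have "card {e \<in> ?T. l e = u} \<le> card ((\<lambda>j. j + m) ` {j \<in> F. l j = u - n})"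
        by (rule card_mono[rotated]) (use finite_subset[OF F] in auto)
      then show "card {e \<in> ?T. l e = u} \<le> \<mu>"
        using degl[of "u - n"] by (simp add: card_image[OF inj_add])
    qed
    show "\<forall>e\<in>?T. ?sg (l e) < 2*m \<and> l (?sg (l e)) = l e \<and> B (?sg (l e)) \<le> B e"
      using sg Fm l_copy B_copy by auto
    show "?T \<subseteq> {e. e < 2*m \<and> n \<le> l e \<and> l e < 2*n}"
      using Fm l_copy l_less by fastforce
  qed
  moreover have "(\<Sum>e\<in>?T. real (B (?sg (l e)))) = ?V"
    by (subst sum.reindex[OF inj_add]) (use Fm l_copy sg B_copy in auto)
  ultimately show ?thesis using 1 by simp
qed

section \<open>Selection of one half-offer per vertex by coins\<close>

definition offer :: "(nat \<Rightarrow> nat) \<Rightarrow> (nat \<Rightarrow> bool) \<Rightarrow> nat \<Rightarrow> nat" where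
  "offer A \<omega> j = A (if \<omega> (l j) then j + m else j)"

definition sold :: "(nat \<Rightarrow> nat) \<Rightarrow> (nat \<Rightarrow> bool) \<Rightarrow> nat set" where
  "sold A \<omega> = {j. j < m \<and> 0 < offer A \<omega> j \<and>
     rank {f. f < m \<and> r f = r j} (offer A \<omega>) j < \<mu>}"

definition bidders :: "(nat \<Rightarrow> nat) \<Rightarrow> (nat \<Rightarrow> bool) \<Rightarrow> nat \<Rightarrow> nat \<Rightarrow> nat" where
  "bidders A \<omega> x i = card {j. j < m \<and> r j = x \<and> B i \<le> offer A \<omega> j}"

text \<open>An offer is 0 or a budget, hence the sum of the gaps of all thresholds up to it. At a
  fixed positive threshold the bidders of \<open>x\<close> form an upper set of the ranking, so at
  least \<open>min \<mu> k\<close> of the \<open>k\<close> bidders are served.\<close>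

lemma sum_sold_ge:
  assumes A: "\<And>e. e < 2*m \<Longrightarrow> A e = 0 \<or> (\<exists>s<2*m. A e = B s)"
  shows "(\<Sum>x\<in>r ` {..<2*m}. \<Sum>i<m. d i * (\<mu> * (1 - (1 - 1 / real \<mu>) ^ bidders A \<omega> x i)))
    \<le> (\<Sum>j\<in>sold A \<omega>. real (offer A \<omega> j))"
proof -
  let ?X = "offer A \<omega>"
  have fin: "finite (sold A \<omega>)" by (rule finite_subset[of _ "{..<m}"]) (auto simp: sold_def)
  have layers: "real (?X j) = (\<Sum>i<m. if B i \<le> ?X j then real (d i) else 0)" if "j < m" for j
  proof -
    have "?X j = 0 \<or> (\<exists>s<2*m. ?X j = B s)"
      unfolding offer_def using A[of j] A[of "j + m"] that by auto
    then have "?X j = (\<Sum>i | i < m \<and> B i \<le> ?X j. d i)"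
      using gap' gap_zero by auto
    also have "\<dots> = (\<Sum>i<m. if B i \<le> ?X j then d i else 0)"
      by (subst sum.inter_filter[symmetric]) auto
    finally have "real (?X j) = real (\<Sum>i<m. if B i \<le> ?X j then d i else 0)" by simp
    then show ?thesis by (simp add: if_distrib cong: if_cong)
  qed
  have "(\<Sum>j\<in>sold A \<omega>. real (?X j)) =
    (\<Sum>x\<in>r ` {..<2*m}. \<Sum>j | j \<in> sold A \<omega> \<and> r j = x. real (?X j))"
    by (rule sum.group[symmetric]) (use fin in \<open>auto simp: sold_def\<close>)
  also have "\<dots> = (\<Sum>x\<in>r ` {..<2*m}. \<Sum>i<m. real (d i) * card {j. j \<in> sold A \<omega> \<and> r j = x \<and> B i \<le> ?X j})"
  proof (rule sum.cong[OF refl])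
    fix x
    have "(\<Sum>j | j \<in> sold A \<omega> \<and> r j = x. real (?X j)) =
      (\<Sum>j | j \<in> sold A \<omega> \<and> r j = x. \<Sum>i<m. if B i \<le> ?X j then real (d i) else 0)"
      by (intro sum.cong refl layers) (auto simp: sold_def)
    also have "\<dots> = (\<Sum>i<m. \<Sum>j | j \<in> sold A \<omega> \<and> r j = x. if B i \<le> ?X j then real (d i) else 0)"
      by (rule sum.swap)
    also have "\<dots> = (\<Sum>i<m. real (d i) * card {j. j \<in> sold A \<omega> \<and> r j = x \<and> B i \<le> ?X j})"
    proof (intro sum.cong refl)
      fix i
      have "(\<Sum>j | j \<in> sold A \<omega> \<and> r j = x. if B i \<le> ?X j then real (d i) else 0) =
        (\<Sum>j \<in> {j \<in> {j. j \<in> sold A \<omega> \<and> r j = x}. B i \<le> ?X j}. real (d i))"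
        by (rule sum.inter_filter[symmetric]) (use fin in auto)
      then show "(\<Sum>j | j \<in> sold A \<omega> \<and> r j = x. if B i \<le> ?X j then real (d i) else 0) =
        real (d i) * card {j. j \<in> sold A \<omega> \<and> r j = x \<and> B i \<le> ?X j}"
        by (simp add: conj_assoc)
    qed
    finally show "(\<Sum>j | j \<in> sold A \<omega> \<and> r j = x. real (?X j)) =
      (\<Sum>i<m. real (d i) * card {j. j \<in> sold A \<omega> \<and> r j = x \<and> B i \<le> ?X j})" .
  qed
  also have "(\<Sum>x\<in>r ` {..<2*m}. \<Sum>i<m. d i * (\<mu> * (1 - (1 - 1 / real \<mu>) ^ bidders A \<omega> x i))) \<le> \<dots>"
  proof (intro sum_mono)
    fix x i assume "i \<in> {..<m}"
    let ?S = "{f. f < m \<and> r f = x}"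
    let ?U = "{j \<in> ?S. B i \<le> ?X j}"
    show "d i * (\<mu> * (1 - (1 - 1 / real \<mu>) ^ bidders A \<omega> x i)) \<le>
      real (d i) * card {j. j \<in> sold A \<omega> \<and> r j = x \<and> B i \<le> ?X j}"
    proof (cases "B i = 0")
      case True
      then show ?thesis using gap_zero \<open>i \<in> {..<m}\<close> by simp
    next
      case False
      have "min \<mu> (card ?U) \<le> card (top_set \<mu> ?S ?X \<inter> ?U)"
        by (rule card_top_set_upper) (auto simp: beats_alt)
      also have "\<dots> \<le> card {j. j \<in> sold A \<omega> \<and> r j = x \<and> B i \<le> ?X j}"
        by (rule card_mono) (use False fin in \<open>auto simp: sold_def top_set_def\<close>)
      finally have "min \<mu> (bidders A \<omega> x i) \<le> card {j. j \<in> sold A \<omega> \<and> r j = x \<and> B i \<le> ?X j}"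
        by (simp add: bidders_def conj_assoc)
      then have "\<mu> * (1 - (1 - 1 / real \<mu>) ^ bidders A \<omega> x i) \<le>
          card {j. j \<in> sold A \<omega> \<and> r j = x \<and> B i \<le> ?X j}"
        using min_ge_geometric[OF mu_pos, of "bidders A \<omega> x i"] by linarith
      then show ?thesis by (intro mult_left_mono) auto
    qed
  qed
  finally show ?thesis .
qed

text \<open>Independence turns the expectation of the power into a product over the left vertices.
  Each of them has at most one edge to \<open>x\<close>, and its mean factor is compared with the
  two factors that this edge and its copy have in \<open>rho\<close>.\<close>

lemma expectation_bidders:
  "measure_pmf.expectation (coins {..<n}) (\<lambda>\<omega>. (1 - 1 / real \<mu>) ^ bidders A \<omega> x i) \<le> rho A x i"
proof -
  let ?c = "1 - 1 / real \<mu>"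
  let ?h = "\<lambda>e. if B i \<le> A e then ?c else 1" and ?g = "\<lambda>e. if B i \<le> A e then q else 1"
  let ?S = "{j. j < m \<and> r j = x}"
  let ?z = "\<lambda>u b. \<Prod>j | j \<in> ?S \<and> l j = u. ?h (if b then j + m else j)"
  have c: "0 \<le> ?c" "?c \<le> 1" using mu_pos by auto
  \<comment> \<open>If exactly one half-offer meets the threshold, the mean is exactly
    \<open>q\<close>; if both do, \<open>1 - 1/\<mu>\<close> lies below \<open>q * q\<close> by
    \<open>1/(4 \<mu>^2)\<close>.\<close>
  have cq: "?c \<le> q * q" "(?c + 1) / 2 = q"
    using mu_pos by (auto simp: q_def field_simps)
  have "?c ^ bidders A \<omega> x i = (\<Prod>u<n. ?z u (\<omega> u))" for \<omega>
  proof -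
    have "(\<Prod>u<n. ?z u (\<omega> u)) = (\<Prod>u<n. \<Prod>j | j \<in> ?S \<and> l j = u. ?h (if \<omega> (l j) then j + m else j))"
      by (intro prod.cong) auto
    also have "\<dots> = (\<Prod>j\<in>?S. ?h (if \<omega> (l j) then j + m else j))"
      by (rule prod.group) (auto simp: l_less)
    also have "\<dots> = (\<Prod>j\<in>?S. if B i \<le> offer A \<omega> j then ?c else 1)"
      by (simp add: offer_def)
    also have "\<dots> = (\<Prod>j\<in>{j \<in> ?S. B i \<le> offer A \<omega> j}. ?c)"
      by (rule prod.inter_filter[symmetric]) auto
    also have "\<dots> = ?c ^ bidders A \<omega> x i"
      by (simp add: bidders_def conj_assoc)
    finally show ?thesis by simp
  qed
  then have "measure_pmf.expectation (coins {..<n}) (\<lambda>\<omega>. ?c ^ bidders A \<omega> x i) =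
    measure_pmf.expectation (coins {..<n}) (\<lambda>\<omega>. \<Prod>u<n. ?z u (\<omega> u))" by simp
  also have "\<dots> = (\<Prod>u<n. measure_pmf.expectation (bernoulli_pmf (1/2)) (?z u))"
    by (rule expectation_prod_Pi_pmf)
      (use c in \<open>auto intro!: prod_nonneg integrable_measure_pmf_finite\<close>)
  also have "\<dots> \<le> (\<Prod>u<n. \<Prod>j | j \<in> ?S \<and> l j = u. ?g j * ?g (j + m))"
  proof (rule prod_mono, intro conjI)
    fix u
    have "?z u b \<ge> 0" for b using c by (auto intro!: prod_nonneg)
    then show "0 \<le> measure_pmf.expectation (bernoulli_pmf (1/2)) (?z u)"
      by (intro integral_nonneg_AE) auto
    show "measure_pmf.expectation (bernoulli_pmf (1/2)) (?z u) \<le>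
      (\<Prod>j | j \<in> ?S \<and> l j = u. ?g j * ?g (j + m))"
    proof (cases "{j. j \<in> ?S \<and> l j = u} = {}")
      case True
      show ?thesis unfolding True by simp
    next
      case False
      then obtain j where j: "j < m" "r j = x" "l j = u" by auto
      have "f = j" if "f < m" "r f = x" "l f = u" for f
        using inj[of f j] that j by simp
      then have single: "{j. j \<in> ?S \<and> l j = u} = {j}" using j by blast
      have "measure_pmf.expectation (bernoulli_pmf (1/2)) (?z u) = (?h j + ?h (j + m)) / 2"
        unfolding single by simp
      also have "\<dots> \<le> ?g j * ?g (j + m)" using cq c by (auto simp: algebra_simps)
      finally show ?thesis unfolding single by simp
    qed
  qed
  also have "\<dots> = (\<Prod>j\<in>?S. ?g j * ?g (j + m))"
    by (rule prod.group) (auto simp: l_less)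
  also have "\<dots> = (\<Prod>j<m. if r j = x then ?g j * ?g (j + m) else 1)"
    by (subst prod.inter_filter[symmetric]) auto
  also have "\<dots> = rho A x i"
    unfolding rho_def prod_double by (intro prod.cong) (auto simp: r_copy)
  finally show ?thesis .
qed

theorem expected_revenue:
  assumes reach: "reach (2*n) A p" and F: "F \<subseteq> {..<m}"
    and sg: "\<And>j. j \<in> F \<Longrightarrow> sg (l j) < m \<and> l (sg (l j)) = l j \<and> B (sg (l j)) \<le> B j"
    and degl: "\<And>u. card {j \<in> F. l j = u} \<le> \<mu>" and degr: "\<And>x. card {j \<in> F. r j = x} \<le> \<mu>"
  shows "5/9 * (\<Sum>j\<in>F. real (B (sg (l j)))) \<le>
    measure_pmf.expectation (coins {..<n}) (\<lambda>\<omega>. \<Sum>j\<in>sold A \<omega>. real (offer A \<omega> j))"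
proof -
  let ?E = "measure_pmf.expectation (coins {..<n})"
  have int: "integrable (measure_pmf (coins {..<n})) (f :: _ \<Rightarrow> real)" for f
    by (rule integrable_coins) auto
  have "potential A \<le> (\<Sum>x\<in>r ` {..<2*m}. \<Sum>i<m.
      d i * (\<mu> * (1 - ?E (\<lambda>\<omega>. (1 - 1 / real \<mu>) ^ bidders A \<omega> x i))))"
    unfolding potential_def
    by (intro sum_mono mult_left_mono diff_mono expectation_bidders) auto
  also have "\<dots> = ?E (\<lambda>\<omega>. \<Sum>x\<in>r ` {..<2*m}. \<Sum>i<m.
      d i * (\<mu> * (1 - (1 - 1 / real \<mu>) ^ bidders A \<omega> x i)))"
    by (simp add: Bochner_Integration.integral_sum Bochner_Integration.integral_diff int)
  also have "\<dots> \<le> ?E (\<lambda>\<omega>. \<Sum>j\<in>sold A \<omega>. real (offer A \<omega> j))"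
    by (rule expectation_mono_finite[OF finite_coins])
      (use sum_sold_ge reach_facts[OF reach] in auto)
  finally show ?thesis using potential_reach[OF assms] by linarith
qed

end


section \<open>Structured programs\<close>

type_synonym state = "nat \<Rightarrow> nat \<Rightarrow> nat"

datatype exp = Lit nat | Arr nat exp | Bin arith exp exp

datatype com = Store nat exp exp | Seq com com | If exp exp com com | For nat exp com

definition upd :: "state \<Rightarrow> nat \<Rightarrow> nat \<Rightarrow> nat \<Rightarrow> state" where
  "upd s a i v = s(a := (s a)(i := v))"

lemma upd_apply: "upd s a i v b j = (if b = a \<and> j = i then v else s b j)"
  by (simp add: upd_def)

fun val :: "exp \<Rightarrow> state \<Rightarrow> nat" where
  "val (Lit c) s = c"
| "val (Arr a e) s = s a (val e s)"
| "val (Bin f e1 e2) s = arith_val f (val e1 s) (val e2 s)"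

text \<open>Array \<open>0\<close> holds the scalar variables, the loop variables among them.\<close>

primrec exec :: "com \<Rightarrow> state \<Rightarrow> state" where
  "exec (Store a e1 e2) s = upd s a (val e1 s) (val e2 s)"
| "exec (Seq c1 c2) s = exec c2 (exec c1 s)"
| "exec (If e1 e2 c1 c2) s = (if val e1 s < val e2 s then exec c1 s else exec c2 s)"
| "exec (For x e c) s = fold (\<lambda>i s. exec c (upd s 0 x i)) [0..<val e s] s"

fun bounded_exp :: "nat \<Rightarrow> exp \<Rightarrow> state \<Rightarrow> bool" where
  "bounded_exp W (Lit c) s \<longleftrightarrow> c \<le> W"
| "bounded_exp W (Arr a e) s \<longleftrightarrow> bounded_exp W e s \<and> s a (val e s) \<le> W"
| "bounded_exp W (Bin f e1 e2) s \<longleftrightarrow> bounded_exp W e1 s \<and> bounded_exp W e2 s \<and>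
     arith_val f (val e1 s) (val e2 s) \<le> W"

text \<open>All intermediate values stay below \<open>W\<close>, array indices included, and all
  loop counts below \<open>k\<close>: the first bound controls the logarithmic cost of an
  instruction, the second the number of instructions.\<close>

primrec bounded :: "nat \<Rightarrow> nat \<Rightarrow> com \<Rightarrow> state \<Rightarrow> bool" where
  "bounded W k (Store a e1 e2) s \<longleftrightarrow> bounded_exp W e1 s \<and> bounded_exp W e2 s"
| "bounded W k (Seq c1 c2) s \<longleftrightarrow> bounded W k c1 s \<and> bounded W k c2 (exec c1 s)"
| "bounded W k (If e1 e2 c1 c2) s \<longleftrightarrow> bounded_exp W e1 s \<and> bounded_exp W e2 s \<and>
     (if val e1 s < val e2 s then bounded W k c1 s else bounded W k c2 s)"
| "bounded W k (For x e c) s \<longleftrightarrow> bounded_exp W e s \<and> val e s \<le> k \<and>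
     (\<forall>i < val e s. bounded W k c (upd (fold (\<lambda>i s. exec c (upd s 0 x i)) [0..<i] s) 0 x i))"

text \<open>The arrays are interleaved; the cells below \<open>base\<close> hold temporary values.\<close>

abbreviation base :: nat where "base \<equiv> 32"
abbreviation stride :: nat where "stride \<equiv> 16"

definition cell :: "nat \<Rightarrow> nat \<Rightarrow> nat" where
  "cell a i = stride * i + (base + a)"

lemma cell_eq_iff: "a < stride \<Longrightarrow> b < stride \<Longrightarrow> cell a i = cell b j \<longleftrightarrow> a = b \<and> i = j"
proof
  assume less: "a < stride" "b < stride" and eq: "cell a i = cell b j"
  then have "16 * i + a = 16 * j + b" by (simp add: cell_def)
  then have "(16 * i + a) mod 16 = (16 * j + b) mod 16" by (rule arg_cong)
  then have "a = b" using less by simp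
  then show "a = b \<and> i = j" using eq by (simp add: cell_def)
qed simp

lemma cell_ge: "cell a i \<ge> base"
  by (simp add: cell_def)

definition represents :: "mem \<Rightarrow> state \<Rightarrow> bool" where
  "represents m s \<longleftrightarrow> (\<forall>a < stride. \<forall>i. m (cell a i) = s a i)"

fun wf_exp :: "exp \<Rightarrow> bool" where
  "wf_exp (Lit c) \<longleftrightarrow> True"
| "wf_exp (Arr a e) \<longleftrightarrow> a < stride \<and> wf_exp e"
| "wf_exp (Bin f e1 e2) \<longleftrightarrow> wf_exp e1 \<and> wf_exp e2"

text \<open>Array numbers below \<open>stride\<close> keep the arrays disjoint. Loop variables below
  \<open>64\<close> have cells at addresses of at most \<open>size_bound W\<close> as soon as
  \<open>64 \<le> W\<close>.\<close>

primrec wf_com :: "com \<Rightarrow> bool" where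
  "wf_com (Store a e1 e2) \<longleftrightarrow> a < stride \<and> wf_exp e1 \<and> wf_exp e2"
| "wf_com (Seq c1 c2) \<longleftrightarrow> wf_com c1 \<and> wf_com c2"
| "wf_com (If e1 e2 c1 c2) \<longleftrightarrow> wf_exp e1 \<and> wf_exp e2 \<and> wf_com c1 \<and> wf_com c2"
| "wf_com (For x e c) \<longleftrightarrow> wf_exp e \<and> wf_com c \<and> x < 64"

fun temps_exp :: "exp \<Rightarrow> nat" where
  "temps_exp (Lit c) = 1"
| "temps_exp (Arr a e) = temps_exp e"
| "temps_exp (Bin f e1 e2) = max (temps_exp e1) (Suc (temps_exp e2))"

primrec temps :: "com \<Rightarrow> nat" where
  "temps (Store a e1 e2) = max (temps_exp e1) (Suc (temps_exp e2))"
| "temps (Seq c1 c2) = max (temps c1) (temps c2)"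
| "temps (If e1 e2 c1 c2) = max (max (temps_exp e1) (Suc (temps_exp e2))) (max (temps c1) (temps c2))"
| "temps (For x e c) = max (temps_exp e) (Suc (Suc (temps c)))"

text \<open>Stack discipline: the value ends up in cell \<open>d\<close>, and on the way only cells
  from \<open>d\<close> upward are written.\<close>

fun compile_exp :: "nat \<Rightarrow> exp \<Rightarrow> instr list" where
  "compile_exp d (Lit c) = [Arith Plus (Cell d) (Const c) (Const 0)]"
| "compile_exp d (Arr a e) = compile_exp d e @
     [Arith Times (Cell d) (Const stride) (At (Cell d)),
      Arith Plus (Cell d) (At (Cell d)) (Const (base + a)),
      Arith Plus (Cell d) (At (Ptr d)) (Const 0)]"
| "compile_exp d (Bin f e1 e2) = compile_exp d e1 @ compile_exp (Suc d) e2 @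
     [Arith f (Cell d) (At (Cell d)) (At (Cell (Suc d)))]"

definition jump :: "nat \<Rightarrow> instr" where
  "jump k = IfLess (Const 0) (Const 1) k"

text \<open>Jumps are absolute, hence the start address \<open>p\<close>. A loop keeps its bound in
  cell \<open>d\<close> and a private counter in cell \<open>Suc d\<close>; the loop variable in
  array 0 is a copy, so the body cannot disturb the iteration. In a conditional the code of the
  false branch comes first.\<close>

primrec compile :: "nat \<Rightarrow> nat \<Rightarrow> com \<Rightarrow> instr list" where
  "compile p d (Store a e1 e2) = compile_exp d e1 @ compile_exp (Suc d) e2 @
     [Arith Times (Cell d) (Const stride) (At (Cell d)),
      Arith Plus (Cell d) (At (Cell d)) (Const (base + a)),
      Arith Plus (Ptr d) (At (Cell (Suc d))) (Const 0)]"
| "compile p d (Seq c1 c2) = (let xs = compile p d c1 in xs @ compile (p + length xs) d c2)"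
| "compile p d (If e1 e2 c1 c2) =
     (let xs = compile_exp d e1 @ compile_exp (Suc d) e2;
          p2 = Suc (p + length xs);
          ys = compile p2 d c2;
          p1 = Suc (p2 + length ys);
          zs = compile p1 d c1
      in xs @ [IfLess (At (Cell d)) (At (Cell (Suc d))) p1] @ ys @ [jump (p1 + length zs)] @ zs)"
| "compile p d (For x e c) =
     (let xs = compile_exp d e;
          h = Suc (p + length xs);
          ys = compile (h + 4) (Suc (Suc d)) c;
          end = h + 4 + length ys + 1
      in xs @ [Arith Plus (Cell (Suc d)) (Const 0) (Const 0),
           IfLess (At (Cell (Suc d))) (At (Cell d)) (h + 2), jump end,
           Arith Plus (Cell (cell 0 x)) (At (Cell (Suc d))) (Const 0),
           Arith Plus (Cell (Suc d)) (At (Cell (Suc d))) (Const 1)] @ ys @ [jump h])"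

primrec exp_length :: "exp \<Rightarrow> nat" where
  "exp_length (Lit c) = 1"
| "exp_length (Arr a e) = exp_length e + 3"
| "exp_length (Bin f e1 e2) = exp_length e1 + exp_length e2 + 1"

text \<open>Both branches of a conditional and \<open>k\<close> rounds of every loop are charged, so
  the bound depends only on the program and \<open>k\<close>. Besides its body a round takes four
  instructions (test, copy of the counter, increment, jump), and a loop three more (initialization,
  failing test, exit).\<close>

primrec time :: "nat \<Rightarrow> com \<Rightarrow> nat" where
  "time k (Store a e1 e2) = exp_length e1 + exp_length e2 + 3"
| "time k (Seq c1 c2) = time k c1 + time k c2"
| "time k (If e1 e2 c1 c2) = exp_length e1 + exp_length e2 + 2 + time k c1 + time k c2"
| "time k (For x e c) = exp_length e + 3 + k * (time k c + 4)"

lemma length_compile_exp [simp]: "length (compile_exp d e) = exp_length e"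
  by (induction e arbitrary: d) auto


subsection \<open>Runs of the machine\<close>

definition dstep :: "instr list \<Rightarrow> config \<Rightarrow> config \<Rightarrow> bool" where
  "dstep P c c' \<longleftrightarrow> pc c < length P \<and> exec_instr (P ! pc c) c = return_pmf c'"

text \<open>Here \<open>t\<close> bounds the cost in units of \<open>\<kappa>\<close>, not the
  number of steps. Steps are bounded through \<open>w + j \<le> w'\<close>: a machine that stays
  within its cost bound also halts within that many steps.\<close>

definition reaches :: "instr list \<Rightarrow> nat \<Rightarrow> nat \<Rightarrow> nat \<Rightarrow> mem \<Rightarrow> nat \<Rightarrow> mem \<Rightarrow> bool" where
  "reaches P \<kappa> t p m p' m' \<longleftrightarrow> (\<forall>w. \<exists>j w'. (dstep P ^^ j) \<lparr>pc = p, mem = m, cost = w\<rparr> \<lparr>pc = p', mem = m', cost = w'\<rparr>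
     \<and> w + j \<le> w' \<and> w' \<le> w + \<kappa> * t)"

lemma reaches_refl: "reaches P \<kappa> t p m p m"
  unfolding reaches_def
proof
  fix w
  show "\<exists>j w'. (dstep P ^^ j) \<lparr>pc = p, mem = m, cost = w\<rparr> \<lparr>pc = p, mem = m, cost = w'\<rparr>
     \<and> w + j \<le> w' \<and> w' \<le> w + \<kappa> * t"
    by (intro exI[of _ 0] exI[of _ w]) auto
qed

lemma reaches_trans:
  assumes "reaches P \<kappa> t1 p m p' m'" "reaches P \<kappa> t2 p' m' p'' m''"
  shows "reaches P \<kappa> (t1 + t2) p m p'' m''"
  unfolding reaches_def
proof
  fix w
  from assms(1) obtain j w' where 1: "(dstep P ^^ j) \<lparr>pc = p, mem = m, cost = w\<rparr> \<lparr>pc = p', mem = m', cost = w'\<rparr>"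
    "w + j \<le> w'" "w' \<le> w + \<kappa> * t1" unfolding reaches_def by blast
  from assms(2) obtain j' w'' where 2: "(dstep P ^^ j') \<lparr>pc = p', mem = m', cost = w'\<rparr> \<lparr>pc = p'', mem = m'', cost = w''\<rparr>"
    "w' + j' \<le> w''" "w'' \<le> w' + \<kappa> * t2" unfolding reaches_def by blast
  have "(dstep P ^^ (j + j')) \<lparr>pc = p, mem = m, cost = w\<rparr> \<lparr>pc = p'', mem = m'', cost = w''\<rparr>"
    using 1 2 by (auto simp: relpowp_add)
  then show "\<exists>j w'. (dstep P ^^ j) \<lparr>pc = p, mem = m, cost = w\<rparr> \<lparr>pc = p'', mem = m'', cost = w'\<rparr>
     \<and> w + j \<le> w' \<and> w' \<le> w + \<kappa> * (t1 + t2)"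
    using 1 2 by (intro exI[of _ "j + j'"] exI[of _ w'']) (auto simp: algebra_simps)
qed

lemma reaches_mono:
  assumes "reaches P \<kappa> t p m p' m'" "t \<le> t'"
  shows "reaches P \<kappa> t' p m p' m'"
proof -
  have "\<kappa> * t \<le> \<kappa> * t'" using assms(2) by simp
  then show ?thesis using assms(1) unfolding reaches_def by (meson add_left_mono order_trans)
qed

lemma nbits_mono: "x \<le> y \<Longrightarrow> nbits x \<le> nbits y"
  by (simp add: nbits_def floor_log_le_iff)

lemma nbits_pos: "1 \<le> nbits x"
  by (simp add: nbits_def)

fun operand_small :: "nat \<Rightarrow> mem \<Rightarrow> operand \<Rightarrow> bool" where
  "operand_small Z m (Const c) \<longleftrightarrow> c \<le> Z"
| "operand_small Z m (At (Cell i)) \<longleftrightarrow> i \<le> Z \<and> m i \<le> Z"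
| "operand_small Z m (At (Ptr i)) \<longleftrightarrow> i \<le> Z \<and> m i \<le> Z \<and> m (m i) \<le> Z"

fun loc_small :: "nat \<Rightarrow> mem \<Rightarrow> loc \<Rightarrow> bool" where
  "loc_small Z m (Cell i) \<longleftrightarrow> i \<le> Z"
| "loc_small Z m (Ptr i) \<longleftrightarrow> i \<le> Z \<and> m i \<le> Z"

lemma operand_cost_small:
  "operand_small Z m a \<Longrightarrow> 1 \<le> operand_cost m a \<and> operand_cost m a \<le> 3 * nbits Z"
proof (induction Z m a rule: operand_small.induct)
  case (1 Z m c)
  then show ?case using nbits_mono[of c Z] nbits_pos[of c] by simp
next
  case (2 Z m i)
  then show ?case using nbits_mono[of i Z] nbits_mono[of "m i" Z] nbits_pos[of i] by simp
next
  case (3 Z m i)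
  then show ?case
    using nbits_mono[of i Z] nbits_mono[of "m i" Z] nbits_mono[of "m (m i)" Z] nbits_pos[of i] by simp
qed

lemma loc_cost_small:
  "loc_small Z m d \<Longrightarrow> 1 \<le> loc_cost m d \<and> loc_cost m d \<le> 2 * nbits Z"
proof (induction Z m d rule: loc_small.induct)
  case (1 Z m i)
  then show ?case using nbits_mono[of i Z] nbits_pos[of i] by simp
next
  case (2 Z m i)
  then show ?case using nbits_mono[of i Z] nbits_mono[of "m i" Z] nbits_pos[of i] by simp
qed

text \<open>The dearest instruction is \<open>Arith\<close>: at most two words for the target and
  three for each operand, that is \<open>2 + 3 + 3\<close>.\<close>

definition kappa :: "nat \<Rightarrow> nat" where "kappa Z = 8 * nbits Z"

lemma reaches_1I:
  assumes "\<And>w. \<exists>w'. dstep P \<lparr>pc = p, mem = m, cost = w\<rparr> \<lparr>pc = p', mem = m', cost = w'\<rparr> \<and> w + 1 \<le> w' \<and> w' \<le> w + \<kappa>"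
  shows "reaches P \<kappa> 1 p m p' m'"
  unfolding reaches_def
proof
  fix w
  obtain w' where "dstep P \<lparr>pc = p, mem = m, cost = w\<rparr> \<lparr>pc = p', mem = m', cost = w'\<rparr>"
    "w + 1 \<le> w'" "w' \<le> w + \<kappa>" using assms[of w] by blast
  then show "\<exists>j w'. (dstep P ^^ j) \<lparr>pc = p, mem = m, cost = w\<rparr> \<lparr>pc = p', mem = m', cost = w'\<rparr>
     \<and> w + j \<le> w' \<and> w' \<le> w + \<kappa> * 1"
    by (intro exI[of _ 1] exI[of _ w']) (auto simp: relpowp_1)
qed

lemma reaches_Arith:
  assumes "p < length P" "P ! p = Arith f d a b"
    "loc_small Z m d" "operand_small Z m a" "operand_small Z m b"
  shows "reaches P (kappa Z) 1 p m (Suc p)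
    (m(addr m d := arith_val f (operand_val m a) (operand_val m b)))"
  using assms loc_cost_small[OF assms(3)] operand_cost_small[OF assms(4)] operand_cost_small[OF assms(5)]
  by (intro reaches_1I) (auto simp: dstep_def kappa_def)

lemma reaches_IfLess:
  assumes "p < length P" "P ! p = IfLess a b k" "operand_small Z m a" "operand_small Z m b"
  shows "reaches P (kappa Z) 1 p m (if operand_val m a < operand_val m b then k else Suc p) m"
  using assms operand_cost_small[OF assms(3)] operand_cost_small[OF assms(4)]
  by (intro reaches_1I) (auto simp: dstep_def kappa_def)

lemma reaches_jump:
  assumes "p < length P" "P ! p = jump k" "1 \<le> Z"
  shows "reaches P (kappa Z) 1 p m k m"
  using reaches_IfLess[of p P "Const 0" "Const 1" k Z m] assms by (simp add: jump_def)

definition code_at :: "instr list \<Rightarrow> nat \<Rightarrow> instr list \<Rightarrow> bool" where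
  "code_at P p xs \<longleftrightarrow> (\<forall>i < length xs. p + i < length P \<and> P ! (p + i) = xs ! i)"

lemma code_at_Nil: "code_at P p []"
  by (simp add: code_at_def)

lemma code_at_Cons: "code_at P p (x # xs) \<longleftrightarrow> p < length P \<and> P ! p = x \<and> code_at P (Suc p) xs"
  by (simp add: code_at_def All_less_Suc2)

lemma code_at_append: "code_at P p (xs @ ys) \<longleftrightarrow> code_at P p xs \<and> code_at P (p + length xs) ys"
  by (induction xs arbitrary: p) (auto simp: code_at_Nil code_at_Cons)

lemma represents_temp: "represents m s \<Longrightarrow> d < base \<Longrightarrow> represents (m(d := v)) s"
  unfolding represents_def using cell_ge by (metis fun_upd_other linorder_not_less)

lemma represents_store:
  "represents m s \<Longrightarrow> a < stride \<Longrightarrow> represents (m(cell a i := v)) (upd s a i v)"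
  by (auto simp: represents_def upd_apply cell_eq_iff)

lemma add_max_le_iff [simp]: "d + max a b \<le> (c :: nat) \<longleftrightarrow> d + a \<le> c \<and> d + b \<le> c"
  by auto

lemma bounded_exp_le: "bounded_exp W e s \<Longrightarrow> val e s \<le> W"
  by (cases e) auto

text \<open>The largest address \<open>cell a i\<close> with \<open>a < stride\<close> and
  \<open>i \<le> W\<close> is \<open>16 * W + 47\<close>; values and temporary cells are
  smaller.\<close>

definition size_bound :: "nat \<Rightarrow> nat" where
  "size_bound W = stride * W + 48"

lemma size_bound: "W \<le> size_bound W" "base \<le> size_bound W"
  by (auto simp: size_bound_def)

lemma reaches_address:
  assumes code: "code_at P p [Arith Times (Cell d) (Const stride) (At (Cell d)),
      Arith Plus (Cell d) (At (Cell d)) (Const (base + a))]"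
    and "d < base" "a < stride" "m d \<le> W"
  shows "reaches P (kappa (size_bound W)) 2 p m (p + 2) (m(d := cell a (m d)))"
proof -
  have "reaches P (kappa (size_bound W)) 1 p m (Suc p) (m(d := stride * m d))"
    using reaches_Arith[of p P Times "Cell d" "Const stride" "At (Cell d)" "size_bound W" m] assms
    by (simp add: code_at_Cons size_bound_def)
  moreover have "reaches P (kappa (size_bound W)) 1 (Suc p) (m(d := stride * m d)) (Suc (Suc p))
     ((m(d := stride * m d))(d := stride * m d + (base + a)))"
    using reaches_Arith[of "Suc p" P Plus "Cell d" "At (Cell d)" "Const (base + a)" "size_bound W" "m(d := stride * m d)"] assms
    by (simp add: code_at_Cons size_bound_def)
  ultimately have "reaches P (kappa (size_bound W)) (1 + 1) p m (Suc (Suc p))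
     ((m(d := stride * m d))(d := stride * m d + (base + a)))" by (rule reaches_trans)
  then show ?thesis by (simp add: cell_def numeral_2_eq_2)
qed

lemma cell_le_size_bound: "a < stride \<Longrightarrow> i \<le> W \<Longrightarrow> cell a i \<le> size_bound W"
  by (simp add: cell_def size_bound_def)

text \<open>The clause on cells below \<open>d\<close> protects a first operand while the second one
  is computed.\<close>

lemma compile_exp_correct:
  assumes "code_at P p (compile_exp d e)" "represents m s" "bounded_exp W e s" "wf_exp e"
    "d + temps_exp e \<le> base"
  shows "\<exists>m'. reaches P (kappa (size_bound W)) (exp_length e) p m (p + exp_length e) m' \<and>
    m' d = val e s \<and> represents m' s \<and> (\<forall>x<d. m' x = m x)"
  using assms
proof (induction e arbitrary: d p m)
  case (Lit c)
  have "reaches P (kappa (size_bound W)) 1 p m (Suc p) (m(d := c))"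
    using reaches_Arith[of p P Plus "Cell d" "Const c" "Const 0" "size_bound W" m] Lit
    by (simp add: code_at_Cons size_bound_def)
  then show ?case using Lit represents_temp[of m s d c] by (intro exI[of _ "m(d := c)"]) (simp add: fun_upd_def)
next
  case (Arr a e)
  have code: "code_at P p (compile_exp d e)"
    "code_at P (p + exp_length e) [Arith Times (Cell d) (Const stride) (At (Cell d)),
      Arith Plus (Cell d) (At (Cell d)) (Const (base + a))]"
    "p + exp_length e + 2 < length P"
    "P ! (p + exp_length e + 2) = Arith Plus (Cell d) (At (Ptr d)) (Const 0)"
    using Arr.prems(1) by (simp_all add: code_at_append code_at_Cons code_at_Nil)
  obtain m1 where m1: "reaches P (kappa (size_bound W)) (exp_length e) p m (p + exp_length e) m1"
    "m1 d = val e s" "represents m1 s" "\<forall>x<d. m1 x = m x"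
    using Arr.IH[OF code(1) Arr.prems(2)] Arr.prems by auto
  have temps: "0 < temps_exp e" by (induction e) auto
  then have d: "d < base" using Arr.prems by simp
  have le: "m1 d \<le> W" "s a (val e s) \<le> W"
    using Arr.prems m1(2) bounded_exp_le[of W e s] by auto
  define m2 where "m2 = m1(d := cell a (m1 d))"
  have m2: "reaches P (kappa (size_bound W)) 2 (p + exp_length e) m1 (p + exp_length e + 2) m2"
    unfolding m2_def by (rule reaches_address[OF code(2)]) (use d le Arr.prems in auto)
  have rep2: "represents m2 s" unfolding m2_def by (rule represents_temp[OF m1(3) d])
  have get: "m2 (m2 d) = s a (val e s)"
    using rep2 Arr.prems m1(2) by (simp add: represents_def m2_def)
  define m3 where "m3 = m2(d := s a (val e s))"
  have "reaches P (kappa (size_bound W)) 1 (p + exp_length e + 2) m2 (Suc (p + exp_length e + 2)) m3"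
    using reaches_Arith[OF code(3,4), of "size_bound W" m2] get d le Arr.prems cell_le_size_bound[of a "m1 d" W] size_bound[of W]
    by (simp add: m3_def) (simp add: m2_def)
  from reaches_trans[OF reaches_trans[OF m1(1) m2] this]
  have "reaches P (kappa (size_bound W)) (exp_length (Arr a e)) p m (p + exp_length (Arr a e)) m3"
    by (simp add: eval_nat_numeral)
  moreover have "represents m3 s" unfolding m3_def by (rule represents_temp[OF rep2 d])
  moreover have "m3 d = val (Arr a e) s" "\<forall>x<d. m3 x = m x"
    using m1(4) by (auto simp: m3_def m2_def)
  ultimately show ?case by blast
next
  case (Bin f e1 e2)
  have code: "code_at P p (compile_exp d e1)" "code_at P (p + exp_length e1) (compile_exp (Suc d) e2)"
    "p + exp_length e1 + exp_length e2 < length P"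
    "P ! (p + exp_length e1 + exp_length e2) = Arith f (Cell d) (At (Cell d)) (At (Cell (Suc d)))"
    using Bin.prems(1) by (simp_all add: code_at_append code_at_Cons code_at_Nil add_ac)
  obtain m1 where m1: "reaches P (kappa (size_bound W)) (exp_length e1) p m (p + exp_length e1) m1"
    "m1 d = val e1 s" "represents m1 s" "\<forall>x<d. m1 x = m x"
    using Bin.IH(1)[OF code(1) Bin.prems(2)] Bin.prems by auto
  obtain m2 where m2: "reaches P (kappa (size_bound W)) (exp_length e2) (p + exp_length e1) m1 (p + exp_length e1 + exp_length e2) m2"
    "m2 (Suc d) = val e2 s" "represents m2 s" "\<forall>x<Suc d. m2 x = m1 x"
    using Bin.IH(2)[OF code(2) m1(3)] Bin.prems by auto
  have temps: "0 < temps_exp e2" by (induction e2) auto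
  then have d: "Suc d < base" using Bin.prems by simp
  have le: "val e1 s \<le> W" "val e2 s \<le> W"
    using Bin.prems bounded_exp_le by auto
  define m3 where "m3 = m2(d := val (Bin f e1 e2) s)"
  have "reaches P (kappa (size_bound W)) 1 (p + exp_length e1 + exp_length e2) m2 (Suc (p + exp_length e1 + exp_length e2)) m3"
    using reaches_Arith[OF code(3,4), of "size_bound W" m2] m2 m1 d le Bin.prems size_bound[of W]
    by (simp add: m3_def)
  from reaches_trans[OF reaches_trans[OF m1(1) m2(1)] this]
  have "reaches P (kappa (size_bound W)) (exp_length (Bin f e1 e2)) p m (p + exp_length (Bin f e1 e2)) m3"
    by (simp add: add_ac)
  moreover have "represents m3 s" unfolding m3_def by (rule represents_temp[OF m2(3)]) (use d in simp)
  moreover have "m3 d = val (Bin f e1 e2) s" "\<forall>x<d. m3 x = m x"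
    using m1(4) m2(4) by (auto simp: m3_def)
  ultimately show ?case by blast
qed

lemma compile_two_exps:
  assumes "code_at P p (compile_exp d e1 @ compile_exp (Suc d) e2)" "represents m s"
    "bounded_exp W e1 s" "bounded_exp W e2 s" "wf_exp e1" "wf_exp e2"
    "d + max (temps_exp e1) (Suc (temps_exp e2)) \<le> base"
  shows "\<exists>m'. reaches P (kappa (size_bound W)) (exp_length e1 + exp_length e2) p m (p + exp_length e1 + exp_length e2) m' \<and>
    m' d = val e1 s \<and> m' (Suc d) = val e2 s \<and> represents m' s \<and> (\<forall>x<d. m' x = m x) \<and>
    Suc d < base \<and> val e1 s \<le> W \<and> val e2 s \<le> W"
proof -
  obtain m1 where m1: "reaches P (kappa (size_bound W)) (exp_length e1) p m (p + exp_length e1) m1"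
    "m1 d = val e1 s" "represents m1 s" "\<forall>x<d. m1 x = m x"
    using compile_exp_correct[of P p d e1 m s W] assms by (force simp: code_at_append)
  obtain m2 where m2: "reaches P (kappa (size_bound W)) (exp_length e2) (p + exp_length e1) m1 (p + exp_length e1 + exp_length e2) m2"
    "m2 (Suc d) = val e2 s" "represents m2 s" "\<forall>x<Suc d. m2 x = m1 x"
    using compile_exp_correct[of P "p + exp_length e1" "Suc d" e2 m1 s W] m1 assms by (force simp: code_at_append)
  have "0 < temps_exp e2" by (induction e2) auto
  then have "Suc d < base" using assms by simp
  then show ?thesis
    using m1 m2 reaches_trans[OF m1(1) m2(1)] assms bounded_exp_le by (intro exI[of _ m2]) auto
qed

lemma fold_upt_Suc: "fold f [0..<Suc i] s = f i (fold f [0..<i] s)"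
  by simp

text \<open>The clause on cells below \<open>d\<close> protects the bounds and counters of the
  enclosing loops, whose bodies are compiled two cells higher.\<close>

lemma compile_correct:
  assumes "code_at P p (compile p d c)" "represents m s" "bounded W k c s" "wf_com c"
    "d + temps c \<le> base" "64 \<le> W"
  shows "\<exists>m'. reaches P (kappa (size_bound W)) (time k c) p m (p + length (compile p d c)) m' \<and>
    represents m' (exec c s) \<and> (\<forall>x<d. m' x = m x)"
  using assms
proof (induction c arbitrary: d p m s)
  case (Store a e1 e2)
  let ?q = "p + exp_length e1 + exp_length e2"
  have code: "code_at P p (compile_exp d e1 @ compile_exp (Suc d) e2)"
    "code_at P ?q [Arith Times (Cell d) (Const stride) (At (Cell d)),
      Arith Plus (Cell d) (At (Cell d)) (Const (base + a))]"
    "?q + 2 < length P"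
    "P ! (?q + 2) = Arith Plus (Ptr d) (At (Cell (Suc d))) (Const 0)"
    using Store.prems(1) by (simp_all add: code_at_append code_at_Cons code_at_Nil add_ac)
  obtain m1 where m1: "reaches P (kappa (size_bound W)) (exp_length e1 + exp_length e2) p m ?q m1"
    "m1 d = val e1 s" "m1 (Suc d) = val e2 s" "represents m1 s" "\<forall>x<d. m1 x = m x"
    and d: "Suc d < base" and le: "val e1 s \<le> W" "val e2 s \<le> W"
    using compile_two_exps[OF code(1) Store.prems(2)] Store.prems by auto
  define m2 where "m2 = m1(d := cell a (m1 d))"
  have m2: "reaches P (kappa (size_bound W)) 2 ?q m1 (?q + 2) m2"
    unfolding m2_def by (rule reaches_address[OF code(2)]) (use d le m1 Store.prems in auto)
  have rep2: "represents m2 s" unfolding m2_def by (rule represents_temp[OF m1(4)]) (use d in simp)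
  define m3 where "m3 = m2(cell a (val e1 s) := val e2 s)"
  have "reaches P (kappa (size_bound W)) 1 (?q + 2) m2 (Suc (?q + 2)) m3"
    using reaches_Arith[OF code(3,4), of "size_bound W" m2] d le m1 Store.prems
      cell_le_size_bound[of a "m1 d" W] size_bound[of W]
    by (simp add: m3_def) (simp add: m2_def)
  from reaches_trans[OF reaches_trans[OF m1(1) m2] this]
  have "reaches P (kappa (size_bound W)) (time k (Store a e1 e2)) p m (p + length (compile p d (Store a e1 e2))) m3"
    by (simp add: eval_nat_numeral add.assoc)
  moreover have "represents m3 (exec (Store a e1 e2) s)"
    using represents_store[OF rep2, of a] Store.prems by (simp add: m3_def)
  moreover have "\<forall>x<d. m3 x = m x"
    using m1(5) d cell_ge[of a "val e1 s"] by (auto simp: m3_def m2_def)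
  ultimately show ?case by blast
next
  case (Seq c1 c2)
  let ?q = "p + length (compile p d c1)"
  have code: "code_at P p (compile p d c1)" "code_at P ?q (compile ?q d c2)"
    using Seq.prems(1) by (simp_all add: code_at_append Let_def)
  obtain m1 where m1: "reaches P (kappa (size_bound W)) (time k c1) p m ?q m1"
    "represents m1 (exec c1 s)" "\<forall>x<d. m1 x = m x"
    using Seq.IH(1)[OF code(1) Seq.prems(2)] Seq.prems by auto
  obtain m2 where m2: "reaches P (kappa (size_bound W)) (time k c2) ?q m1 (?q + length (compile ?q d c2)) m2"
    "represents m2 (exec c2 (exec c1 s))" "\<forall>x<d. m2 x = m1 x"
    using Seq.IH(2)[OF code(2) m1(2)] Seq.prems by auto
  show ?case
    using reaches_trans[OF m1(1) m2(1)] m1 m2 by (intro exI[of _ m2]) (simp add: Let_def add_ac)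
next
  case (If e1 e2 c1 c2)
  let ?q = "p + exp_length e1 + exp_length e2"
  let ?ys = "compile (Suc ?q) d c2"
  let ?p1 = "Suc (Suc ?q + length ?ys)"
  let ?zs = "compile ?p1 d c1"
  have "compile p d (If e1 e2 c1 c2) = (compile_exp d e1 @ compile_exp (Suc d) e2) @
      IfLess (At (Cell d)) (At (Cell (Suc d))) ?p1 # ?ys @ jump (?p1 + length ?zs) # ?zs"
    by (simp add: Let_def add_ac)
  note comp_eq = this
  have code: "code_at P p (compile_exp d e1 @ compile_exp (Suc d) e2)"
    "?q < length P" "P ! ?q = IfLess (At (Cell d)) (At (Cell (Suc d))) ?p1"
    "code_at P (Suc ?q) ?ys"
    "Suc ?q + length ?ys < length P" "P ! (Suc ?q + length ?ys) = jump (?p1 + length ?zs)"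
    "code_at P ?p1 ?zs"
    using If.prems(1) unfolding comp_eq
    by (simp_all only: code_at_append code_at_Cons length_append length_compile_exp add.assoc simp_thms add_Suc)
  obtain m1 where m1: "reaches P (kappa (size_bound W)) (exp_length e1 + exp_length e2) p m ?q m1"
    "m1 d = val e1 s" "m1 (Suc d) = val e2 s" "represents m1 s" "\<forall>x<d. m1 x = m x"
    and d: "Suc d < base" and le: "val e1 s \<le> W" "val e2 s \<le> W"
    using compile_two_exps[OF code(1) If.prems(2)] If.prems by auto
  have test: "reaches P (kappa (size_bound W)) 1 ?q m1 (if val e1 s < val e2 s then ?p1 else Suc ?q) m1"
    using reaches_IfLess[OF code(2,3), of "size_bound W" m1] m1 d le size_bound[of W] by simp
  have len: "p + length (compile p d (If e1 e2 c1 c2)) = ?p1 + length ?zs"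
    unfolding comp_eq by simp
  show ?case
  proof (cases "val e1 s < val e2 s")
    case True
    obtain m2 where m2: "reaches P (kappa (size_bound W)) (time k c1) ?p1 m1 (?p1 + length ?zs) m2"
      "represents m2 (exec c1 s)" "\<forall>x<d. m2 x = m1 x"
      using If.IH(1)[OF code(7) m1(4)] If.prems True by auto
    have "reaches P (kappa (size_bound W)) (exp_length e1 + exp_length e2 + 1 + time k c1) p m (?p1 + length ?zs) m2"
      using test True by (intro reaches_trans[OF _ m2(1)] reaches_trans[OF m1(1)]) simp
    then have "reaches P (kappa (size_bound W)) (time k (If e1 e2 c1 c2)) p m (?p1 + length ?zs) m2"
      by (rule reaches_mono) simp
    then show ?thesis
      unfolding len using m1 m2 True by (intro exI[of _ m2]) simp
  next
    case False
    obtain m2 where m2: "reaches P (kappa (size_bound W)) (time k c2) (Suc ?q) m1 (Suc ?q + length ?ys) m2"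
      "represents m2 (exec c2 s)" "\<forall>x<d. m2 x = m1 x"
      using If.IH(2)[OF code(4) m1(4)] If.prems False by auto
    have skip: "reaches P (kappa (size_bound W)) 1 (Suc ?q + length ?ys) m2 (?p1 + length ?zs) m2"
      by (rule reaches_jump[OF code(5,6)]) (simp add: size_bound_def)
    have "reaches P (kappa (size_bound W)) (exp_length e1 + exp_length e2 + 1 + time k c2 + 1) p m (?p1 + length ?zs) m2"
      using test False by (intro reaches_trans[OF _ skip] reaches_trans[OF _ m2(1)] reaches_trans[OF m1(1)]) simp
    then have "reaches P (kappa (size_bound W)) (time k (If e1 e2 c1 c2)) p m (?p1 + length ?zs) m2"
      by (rule reaches_mono) simp
    then show ?thesis
      unfolding len using m1 m2 False by (intro exI[of _ m2]) simp
  qed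
next
  case (For x e c)
  let ?q = "p + exp_length e"
  let ?h = "Suc ?q"
  let ?ys = "compile (?h + 4) (Suc (Suc d)) c"
  let ?end = "?h + 4 + length ?ys + 1"
  let ?K = "kappa (size_bound W)"
  let ?S = "\<lambda>i. fold (\<lambda>i s. exec c (upd s 0 x i)) [0..<i] s"
  have comp_eq: "compile p d (For x e c) = compile_exp d e @
      Arith Plus (Cell (Suc d)) (Const 0) (Const 0) #
      IfLess (At (Cell (Suc d))) (At (Cell d)) (?h + 2) # jump ?end #
      Arith Plus (Cell (cell 0 x)) (At (Cell (Suc d))) (Const 0) #
      Arith Plus (Cell (Suc d)) (At (Cell (Suc d))) (Const 1) # ?ys @ [jump ?h]"
    by (simp add: Let_def)
  have code: "code_at P p (compile_exp d e)"
    "?q < length P" "P ! ?q = Arith Plus (Cell (Suc d)) (Const 0) (Const 0)"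
    "?h < length P" "P ! ?h = IfLess (At (Cell (Suc d))) (At (Cell d)) (?h + 2)"
    "?h + 1 < length P" "P ! (?h + 1) = jump ?end"
    "?h + 2 < length P" "P ! (?h + 2) = Arith Plus (Cell (cell 0 x)) (At (Cell (Suc d))) (Const 0)"
    "?h + 3 < length P" "P ! (?h + 3) = Arith Plus (Cell (Suc d)) (At (Cell (Suc d))) (Const 1)"
    "code_at P (?h + 4) ?ys"
    "?h + 4 + length ?ys < length P" "P ! (?h + 4 + length ?ys) = jump ?h"
    using For.prems(1) unfolding comp_eq code_at_append code_at_Cons
    by (simp_all add: eval_nat_numeral)
  have d: "Suc d < base" using For.prems by simp
  have N: "val e s \<le> W" "val e s \<le> k" using For.prems bounded_exp_le by auto
  have x: "cell 0 x \<le> size_bound W" using For.prems by (simp add: cell_def size_bound_def)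
  obtain m0 where m0: "reaches P ?K (exp_length e) p m ?q m0"
    "m0 d = val e s" "represents m0 s" "\<forall>x<d. m0 x = m x"
    using compile_exp_correct[OF code(1) For.prems(2), of W] For.prems(3-) by auto
  define m1 where "m1 = m0(Suc d := 0)"
  have m1: "reaches P ?K 1 ?q m0 ?h m1"
    using reaches_Arith[OF code(2,3), of "size_bound W" m0] d size_bound[of W] by (simp add: m1_def)
  have loop: "\<exists>m2. reaches P ?K (i * (time k c + 4)) ?h m1 ?h m2 \<and> represents m2 (?S i) \<and>
      m2 d = val e s \<and> m2 (Suc d) = i \<and> (\<forall>x<d. m2 x = m x)" if "i \<le> val e s" for i
    using that
  proof (induction i)
    case 0
    show ?case
      using m0 reaches_refl[of P ?K 0 ?h m1] represents_temp[OF m0(3) d, of 0]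
      by (intro exI[of _ m1]) (auto simp: m1_def fun_upd_def)
  next
    case (Suc i)
    then obtain m2 where m2: "reaches P ?K (i * (time k c + 4)) ?h m1 ?h m2" "represents m2 (?S i)"
      "m2 d = val e s" "m2 (Suc d) = i" "\<forall>x<d. m2 x = m x" by auto
    have a1: "reaches P ?K 1 ?h m2 (?h + 2) m2"
      using reaches_IfLess[OF code(4,5), of "size_bound W" m2] m2 d N Suc.prems size_bound[of W] by simp
    define m3 where "m3 = m2(cell 0 x := i)"
    have a2: "reaches P ?K 1 (?h + 2) m2 (?h + 3) m3"
      using reaches_Arith[OF code(8,9), of "size_bound W" m2] m2 d N Suc.prems size_bound[of W] x
      by (simp add: m3_def eval_nat_numeral)
    have m3: "represents m3 (upd (?S i) 0 x i)"
      unfolding m3_def by (rule represents_store[OF m2(2)]) simp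
    define m4 where "m4 = m3(Suc d := Suc i)"
    have low: "m3 y = m2 y" if "y < base" for y
      using that cell_ge[of 0 x] by (auto simp: m3_def)
    have a3: "reaches P ?K 1 (?h + 3) m3 (?h + 4) m4"
      using reaches_Arith[OF code(10,11), of "size_bound W" m3] m2 d N Suc.prems size_bound[of W] low[OF d]
      by (simp add: m4_def eval_nat_numeral)
    have m4: "represents m4 (upd (?S i) 0 x i)"
      unfolding m4_def by (rule represents_temp[OF m3 d])
    obtain m5 where m5: "reaches P ?K (time k c) (?h + 4) m4 (?h + 4 + length ?ys) m5"
      "represents m5 (exec c (upd (?S i) 0 x i))" "\<forall>x<Suc (Suc d). m5 x = m4 x"
      using For.IH[OF code(12) m4] For.prems Suc.prems by auto
    have a4: "reaches P ?K 1 (?h + 4 + length ?ys) m5 ?h m5"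
      by (rule reaches_jump[OF code(13,14)]) (simp add: size_bound_def)
    have "reaches P ?K (i * (time k c + 4) + 1 + 1 + 1 + time k c + 1) ?h m1 ?h m5"
      by (intro reaches_trans[OF _ a4] reaches_trans[OF _ m5(1)] reaches_trans[OF _ a3]
          reaches_trans[OF _ a2] reaches_trans[OF _ a1] m2(1))
    then have "reaches P ?K (Suc i * (time k c + 4)) ?h m1 ?h m5"
      by (rule reaches_mono) simp
    then show ?case
      using m5 m2 low d by (intro exI[of _ m5]) (auto simp: m4_def)
  qed
  from loop[of "val e s"] obtain m2 where m2: "reaches P ?K (val e s * (time k c + 4)) ?h m1 ?h m2"
    "represents m2 (?S (val e s))" "m2 d = val e s" "m2 (Suc d) = val e s" "\<forall>x<d. m2 x = m x" by auto
  have a1: "reaches P ?K 1 ?h m2 (?h + 1) m2"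
    using reaches_IfLess[OF code(4,5), of "size_bound W" m2] m2 d N size_bound[of W] by simp
  have a2: "reaches P ?K 1 (?h + 1) m2 ?end m2"
    by (rule reaches_jump[OF code(6,7)]) (simp add: size_bound_def)
  have "reaches P ?K (exp_length e + 1 + val e s * (time k c + 4) + 1 + 1) p m ?end m2"
    by (intro reaches_trans[OF _ a2] reaches_trans[OF _ a1] reaches_trans[OF _ m2(1)]
        reaches_trans[OF _ m1] m0(1))
  moreover have "val e s * (time k c + 4) \<le> k * (time k c + 4)" using N by simp
  ultimately have "reaches P ?K (time k (For x e c)) p m ?end m2"
    by (elim reaches_mono) simp
  moreover have len: "p + length (compile p d (For x e c)) = ?end"
    unfolding comp_eq by simp
  ultimately show ?case unfolding len using m2 by (intro exI[of _ m2]) simp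
qed


section \<open>The greedy program\<close>

lemma upd_same [simp]: "upd s a i v a i = v"
  and upd_other [simp]: "b \<noteq> a \<or> j \<noteq> i \<Longrightarrow> upd s a i v b j = s b j"
  and upd_array [simp]: "b \<noteq> a \<Longrightarrow> upd s a i v b = s b"
  by (auto simp: upd_def)

section \<open>Preconditions that include the word bounds, and frames\<close>

definition wp :: "nat \<Rightarrow> nat \<Rightarrow> com \<Rightarrow> (state \<Rightarrow> bool) \<Rightarrow> state \<Rightarrow> bool" where
  "wp W k c Q s \<longleftrightarrow> bounded W k c s \<and> Q (exec c s)"

text \<open>A syntactic over-approximation of the written cells: a store at a literal index touches
  one cell, any other store its whole array. Scalars are always addressed by literals, so they are
  tracked one by one.\<close>

fun touches :: "com \<Rightarrow> nat \<Rightarrow> nat \<Rightarrow> bool" where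
  "touches (Store a' e1 e2) a i \<longleftrightarrow> a = a' \<and> (case e1 of Lit j \<Rightarrow> i = j | _ \<Rightarrow> True)"
| "touches (Seq c1 c2) a i \<longleftrightarrow> touches c1 a i \<or> touches c2 a i"
| "touches (If e1 e2 c1 c2) a i \<longleftrightarrow> touches c1 a i \<or> touches c2 a i"
| "touches (For x e c) a i \<longleftrightarrow> a = 0 \<and> i = x \<or> touches c a i"

definition agree :: "com \<Rightarrow> state \<Rightarrow> state \<Rightarrow> bool" where
  "agree c s s' \<longleftrightarrow> (\<forall>a i. \<not> touches c a i \<longrightarrow> s' a i = s a i)"

lemma agreeD: "agree c s s' \<Longrightarrow> \<not> touches c a i \<Longrightarrow> s' a i = s a i"
  by (simp add: agree_def)

lemma agree_array: "agree c s s' \<Longrightarrow> (\<And>i. \<not> touches c a i) \<Longrightarrow> s' a = s a"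
  by (auto simp: agree_def)

lemma agree_exec: "agree c s (exec c s)"
proof (induction c arbitrary: s)
  case (Store a e1 e2)
  then show ?case by (cases e1) (auto simp: agree_def)
next
  case (For x e c)
  let ?f = "\<lambda>i s. exec c (upd s 0 x i)"
  have "agree (For x e c) s (fold ?f xs s)" for xs
  proof (induction xs rule: rev_induct)
    case (snoc i xs)
    have "agree c (upd (fold ?f xs s) 0 x i) (exec c (upd (fold ?f xs s) 0 x i))" by (rule For.IH)
    then show ?case using snoc by (simp add: agree_def)
  qed (simp add: agree_def)
  then show ?case by simp
qed (auto simp: agree_def)

lemma wp_Store: "wp W k (Store a e1 e2) Q s \<longleftrightarrow>
    bounded_exp W e1 s \<and> bounded_exp W e2 s \<and> Q (upd s a (val e1 s) (val e2 s))"
  by (auto simp: wp_def)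

lemma wp_Seq: "wp W k (Seq c1 c2) Q s \<longleftrightarrow> wp W k c1 (wp W k c2 Q) s"
  by (auto simp: wp_def)

lemma wp_If: "wp W k (If e1 e2 c1 c2) Q s \<longleftrightarrow> bounded_exp W e1 s \<and> bounded_exp W e2 s \<and>
    (if val e1 s < val e2 s then wp W k c1 Q s else wp W k c2 Q s)"
  by (auto simp: wp_def)

lemmas wp_simps = wp_Store wp_Seq wp_If

text \<open>With the frame available in the postcondition, loop invariants need to mention only what
  changes.\<close>

lemma wp_frame: "wp W k c (\<lambda>s'. agree c s s' \<longrightarrow> Q s') s \<Longrightarrow> wp W k c Q s"
  by (auto simp: wp_def agree_exec)

lemma wp_For:
  assumes e: "bounded_exp W e s" "val e s \<le> k"
    and init: "I 0 s"
    and step: "\<And>i s'. i < val e s \<Longrightarrow> agree (For x e c) s s' \<Longrightarrow> I i s' \<Longrightarrow>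
      wp W k c (I (Suc i)) (upd s' 0 x i)"
    and final: "\<And>s'. agree (For x e c) s s' \<Longrightarrow> I (val e s) s' \<Longrightarrow> Q s'"
  shows "wp W k (For x e c) Q s"
proof -
  let ?S = "\<lambda>i. fold (\<lambda>i s. exec c (upd s 0 x i)) [0..<i] s"
  have agree: "agree (For x e c) s (?S i)" for i
  proof (induction i)
    case (Suc i)
    have "agree c (upd (?S i) 0 x i) (exec c (upd (?S i) 0 x i))" by (rule agree_exec)
    then show ?case using Suc by (simp add: agree_def)
  qed (simp add: agree_def)
  have I: "i \<le> val e s \<Longrightarrow> I i (?S i)" for i
  proof (induction i)
    case (Suc i)
    then show ?case using step[OF _ agree, of i] by (simp add: wp_def)
  qed (simp add: init)
  have "bounded W k c (upd (?S i) 0 x i)" if "i < val e s" for i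
    using step[OF that agree I] that by (simp add: wp_def)
  then show ?thesis using e final[OF agree I] by (simp add: wp_def)
qed

abbreviation V :: "nat \<Rightarrow> exp" where "V x \<equiv> Arr 0 (Lit x)"
abbreviation Set :: "nat \<Rightarrow> exp \<Rightarrow> com" where "Set x e \<equiv> Store 0 (Lit x) e"
text \<open>The empty command is a write to scalar 63, which is never read.\<close>

abbreviation Skip :: com where "Skip \<equiv> Set 63 (Lit 0)"

abbreviation add (infixl "[+]" 65) where "add \<equiv> Bin Plus"
abbreviation sub (infixl "[-]" 65) where "sub \<equiv> Bin Minus"
abbreviation mul (infixl "[*]" 70) where "mul \<equiv> Bin Times"

abbreviation dist :: "exp \<Rightarrow> exp \<Rightarrow> exp" where
  "dist a b \<equiv> (a [-] b) [+] (b [-] a)"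

text \<open>A sum of naturals is below 1 iff every term vanishes; with truncated subtraction this
  puts an equality and an inequality into one test.\<close>

lemma dist_test: "(a - b) + (b - a) + (c - d) = 0 \<longleftrightarrow> a = b \<and> c \<le> (d :: nat)"
  "(a - b) + (b - a) = 0 \<longleftrightarrow> a = (b :: nat)"
  by auto

lemma less_test: "1 - (f + 1 - e) = (of_bool (f < e) :: nat)" "Suc 0 - (Suc f - e) = (of_bool (f < e) :: nat)"
  by auto

text \<open>The scalars \<open>0, 1, 2, 3, 18, 19\<close> hold \<open>n\<close>, \<open>m\<close>, \<open>\<mu>\<close>, the common denominator of the budgets,
  \<open>2 n\<close> and \<open>2 m\<close>. The arrays \<open>1, \<dots>, 9\<close> hold the input, the coins, the sides of the vertices,
  and, in the doubled instance, the scaled budgets, left ends and right ends of the edges, the gaps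
  between budgets, the offers and the prices; array \<open>13\<close> holds the output.\<close>

definition weight_prog :: com where
  "weight_prog = Seq (Set 10 (Lit 1)) (For 8 (V 19)
     (If (dist (Arr 6 (V 8)) (Arr 6 (V 6)) [+] (Arr 4 (V 7) [-] Arr 8 (V 8))) (Lit 1)
       (Set 10 (V 10 [*] (Lit 2 [*] V 2 [-] Lit 1)))
       (Set 10 (V 10 [*] (Lit 2 [*] V 2)))))"

text \<open>In the greedy part, scalar 4 is the visited vertex, 5 the candidate, 6 an edge, 7 a
  threshold and 8 an inner loop variable. Scalars 9 to 12 return gain, weight, total and rank; 13
  and 14 keep the best total and its candidate. Arrays 10 and 11 hold the gains and the indicator of
  the chosen edges.\<close>

definition gain_prog :: com where
  "gain_prog = Seq (Set 9 (Lit 0))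
    (If (dist (Arr 5 (V 6)) (Arr 5 (V 5)) [+] (Arr 4 (V 5) [-] Arr 4 (V 6))) (Lit 1)
      (For 7 (V 1) (If (Arr 4 (V 5)) (Arr 4 (V 7)) Skip
        (Seq weight_prog (Set 9 (V 9 [+] Arr 7 (V 7) [*] V 10)))))
      Skip)"

definition gains_prog :: com where
  "gains_prog = For 6 (V 19) (Seq gain_prog (Store 10 (V 6) (V 9)))"

definition rank_prog :: com where
  "rank_prog = Seq (Set 12 (Lit 0)) (For 8 (V 19)
     (If (Arr 10 (V 6)) (Arr 10 (V 8) [+] (Lit 1 [-] (V 8 [+] Lit 1 [-] V 6)))
       (Set 12 (V 12 [+] Lit 1)) Skip))"

definition choose_prog :: com where
  "choose_prog = Seq (Set 11 (Lit 0)) (For 6 (V 19)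
     (Seq rank_prog (Seq (Store 11 (V 6) (Lit 0))
       (If (V 12) (V 2)
         (If (Lit 0) (Arr 10 (V 6))
           (Seq (Store 11 (V 6) (Lit 1)) (Set 11 (V 11 [+] Arr 10 (V 6)))) Skip) Skip))))"

definition eval_prog :: com where
  "eval_prog = Seq gains_prog choose_prog"

definition search_prog :: com where
  "search_prog = Seq (Set 13 (Lit 0)) (For 5 (V 19)
     (If (dist (Arr 5 (V 5)) (V 4)) (Lit 1)
       (Seq eval_prog (If (V 13) (V 11) (Seq (Set 13 (V 11)) (Set 14 (V 5))) Skip)) Skip))"

definition pick_prog :: com where
  "pick_prog = Seq (Set 5 (V 14)) (Seq eval_prog (Seq (Store 9 (V 4) (Arr 4 (V 5)))
     (For 6 (V 19) (If (Lit 0) (Arr 11 (V 6)) (Store 8 (V 6) (Arr 4 (V 5))) Skip))))"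

definition greedy_prog :: com where
  "greedy_prog = For 4 (V 18) (Seq search_prog (If (Lit 0) (V 13) pick_prog Skip))"

lemma touches_progs [simp]:
  "touches weight_prog a i \<longleftrightarrow> a = 0 \<and> i \<in> {8, 10}"
  "touches gain_prog a i \<longleftrightarrow> a = 0 \<and> i \<in> {7, 8, 9, 10, 63}"
  "touches gains_prog a i \<longleftrightarrow> a = 0 \<and> i \<in> {6, 7, 8, 9, 10, 63} \<or> a = 10"
  "touches rank_prog a i \<longleftrightarrow> a = 0 \<and> i \<in> {8, 12, 63}"
  "touches choose_prog a i \<longleftrightarrow> a = 0 \<and> i \<in> {6, 8, 11, 12, 63} \<or> a = 11"
  "touches eval_prog a i \<longleftrightarrow> a = 0 \<and> i \<in> {6, 7, 8, 9, 10, 11, 12, 63} \<or> a \<in> {10, 11}"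
  "touches search_prog a i \<longleftrightarrow> a = 0 \<and> i \<in> {5, 6, 7, 8, 9, 10, 11, 12, 13, 14, 63} \<or> a \<in> {10, 11}"
  "touches pick_prog a i \<longleftrightarrow> a = 0 \<and> i \<in> {5, 6, 7, 8, 9, 10, 11, 12, 63} \<or> a \<in> {8, 9, 10, 11}"
  "touches greedy_prog a i \<longleftrightarrow> a = 0 \<and> i \<in> {4, 5, 6, 7, 8, 9, 10, 11, 12, 13, 14, 63} \<or> a \<in> {8, 9, 10, 11}"
  by (auto simp: weight_prog_def gain_prog_def gains_prog_def rank_prog_def choose_prog_def
      eval_prog_def search_prog_def pick_prog_def greedy_prog_def)

section \<open>Correctness of the greedy program\<close>

locale bounded_market = market +
  fixes W k C :: nat
  assumes B_le: "e < 2*m \<Longrightarrow> B e \<le> C" and r_le: "e < 2*m \<Longrightarrow> r e \<le> n"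
    and W_ge: "(2*m*(m*C) + 1) * (2*\<mu>)^(2*m) + 8*(C + n + m + \<mu>) + 100 \<le> W"
    and k_ge: "2*m \<le> k" "2*n \<le> k"
begin

definition ready :: "state \<Rightarrow> bool" where
  "ready s \<longleftrightarrow> s 0 1 = m \<and> s 0 2 = \<mu> \<and> s 0 18 = 2*n \<and> s 0 19 = 2*m \<and>
     s 4 = B \<and> s 5 = l \<and> s 6 = r \<and> s 7 = d \<and> (\<forall>e<2*m. s 8 e \<le> C)"

lemma W_linear: "8*(C + n + m + \<mu>) + 100 \<le> W"
  using W_ge by linarith

lemma d_le: assumes "i < m" shows "d i \<le> C"
proof -
  have "d i \<le> (\<Sum>h | h < m \<and> B h \<le> B i. d h)" by (rule member_le_sum) (use assms in auto)
  then show ?thesis using gap[OF assms] B_le[of i] assms by simp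
qed

lemma prod_weight_le:
  assumes "j \<le> 2*m"
  shows "(\<Prod>f<j. if Q f then 2*\<mu> - 1 else 2*\<mu>) \<le> (2*\<mu>)^(2*m)"
proof -
  have "(\<Prod>f<j. if Q f then 2*\<mu> - 1 else 2*\<mu>) \<le> (\<Prod>f<j. 2*\<mu>)" by (rule prod_mono) auto
  also have "\<dots> = (2*\<mu>)^j" by simp
  also have "\<dots> \<le> (2*\<mu>)^(2*m)" by (rule power_increasing) (use assms mu_pos in auto)
  finally show ?thesis .
qed

lemma weight_le: "weight A x i \<le> (2*\<mu>)^(2*m)"
  unfolding weight_def by (rule prod_weight_le) simp

lemma power_le_W: "(2*\<mu>)^(2*m) \<le> W"
  using W_ge by (simp add: algebra_simps)

lemma wp_weight:
  assumes "ready s" "s 0 6 < 2*m" "s 0 7 < m"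
    and Q: "\<And>s'. agree weight_prog s s' \<Longrightarrow> s' 0 10 = weight (s 8) (r (s 0 6)) (s 0 7) \<Longrightarrow> Q s'"
  shows "wp W k weight_prog Q s"
proof (rule wp_frame)
  let ?h = "\<lambda>f. if r f = r (s 0 6) \<and> B (s 0 7) \<le> s 8 f then 2*\<mu> - 1 else 2*\<mu>"
  note bounds = W_linear B_le[of "s 0 7"] r_le[of "s 0 6"] assms(2,3)
  show "wp W k weight_prog (\<lambda>s'. agree weight_prog s s' \<longrightarrow> Q s') s"
    unfolding weight_prog_def wp_simps
  proof (intro conjI wp_For[where I = "\<lambda>j s'. s' 0 10 = (\<Prod>f<j. ?h f)"], goal_cases)
    case (6 j s')
    then have j: "j < 2*m" using assms by (simp add: ready_def)
    have s': "s' 4 = B" "s' 6 = r" "s' 8 = s 8" "s' 0 6 = s 0 6" "s' 0 7 = s 0 7" "s' 0 2 = \<mu>"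
      using assms agree_array[OF 6(2)] agreeD[OF 6(2)] by (simp_all add: ready_def)
    have "(\<Prod>f<Suc j. ?h f) \<le> (2*\<mu>)^(2*m)" by (rule prod_weight_le) (use j in simp)
    then have le: "(\<Prod>f<j. ?h f) * ?h j \<le> W" using power_le_W by simp
    have le': "(\<Prod>f<j. ?h f) \<le> W" using prod_weight_le[of j] power_le_W j by (meson less_imp_le order_trans)
    show ?case
      using 6(3) s' le le' bounds j assms(1) r_le[of j] B_le[of j]
      by (auto simp: wp_simps ready_def dist_test less_Suc_eq_0_disj lessThan_Suc mult_ac)
  next
    case (7 s')
    then show ?case
      using assms by (intro impI Q) (simp_all add: weight_def ready_def weight_prog_def)
  qed (use assms bounds k_ge in \<open>auto simp: ready_def\<close>)
qed

lemma weight_sum_le: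
  assumes "X \<subseteq> {..<m}"
  shows "(\<Sum>i\<in>X. d i * weight A x i) \<le> m * C * (2*\<mu>)^(2*m)"
proof -
  have "(\<Sum>i\<in>X. d i * weight A x i) \<le> (\<Sum>i\<in>X. C * (2*\<mu>)^(2*m))"
    by (intro sum_mono mult_le_mono weight_le d_le) (use assms in auto)
  also have "\<dots> \<le> m * (C * (2*\<mu>)^(2*m))"
    using card_mono[of "{..<m}" X] assms by simp
  finally show ?thesis by (simp add: mult_ac)
qed

text \<open>A gain has at most \<open>m\<close> terms \<open>d i * weight\<close> with
  \<open>d i \<le> C\<close>, and a total has at most \<open>2 * m\<close> gains: this is the
  leading term in the bound on \<open>W\<close>.\<close>

lemma gain_le: "gain A s e \<le> m * C * (2*\<mu>)^(2*m)"
  using weight_sum_le[of "{i. i < m \<and> B i \<le> B s}" A "r e"] by (auto simp: gain_def)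

lemma W_gain: assumes "0 < m" shows "m * C * (2*\<mu>)^(2*m) + 8*(C + n + m + \<mu>) + 100 \<le> W"
proof -
  have "m * C * (2*\<mu>)^(2*m) \<le> (2*m*(m*C) + 1) * (2*\<mu>)^(2*m)"
  proof (rule mult_right_mono)
    have "m * C \<le> m * (m * C)" using assms by simp
    then show "m * C \<le> 2*m*(m*C) + 1" unfolding mult.assoc by linarith
  qed simp
  then show ?thesis using W_ge by linarith
qed

lemma wp_gain:
  assumes "ready s" "s 0 5 < 2*m" "s 0 6 < 2*m"
    and Q: "\<And>s'. agree gain_prog s s' \<Longrightarrow> s' 0 9 = gain (s 8) (s 0 5) (s 0 6) \<Longrightarrow> Q s'"
  shows "wp W k gain_prog Q s"
proof (rule wp_frame)
  let ?s = "s 0 5" and ?e = "s 0 6"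
  have m: "0 < m" using assms by simp
  note bounds = W_gain[OF m] B_le[OF assms(2)] B_le[OF assms(3)] l_less2[OF assms(2)] l_less2[OF assms(3)] assms(2,3)
  note s = assms(1)[unfolded ready_def]
  show "wp W k gain_prog (\<lambda>s'. agree gain_prog s s' \<longrightarrow> Q s') s"
  proof (cases "l ?e = l ?s \<and> B ?s \<le> B ?e")
    case False
    then have "gain (s 8) ?s ?e = 0" by (auto simp: gain_def)
    then show ?thesis
      unfolding gain_prog_def wp_simps
      using False s bounds by (auto simp: dist_test gain_prog_def intro!: Q)
  next
    case True
    let ?I = "\<lambda>j s'. s' 0 9 = (\<Sum>i | i < j \<and> B i \<le> B ?s. d i * weight (s 8) (r ?e) i)"
    have loop: "wp W k (For 7 (V 1) (If (Arr 4 (V 5)) (Arr 4 (V 7)) Skip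
        (Seq weight_prog (Set 9 (V 9 [+] Arr 7 (V 7) [*] V 10)))))
        (\<lambda>s'. agree gain_prog s s' \<longrightarrow> Q s') (upd s 0 9 0)" (is "wp _ _ (For 7 _ ?c) _ _")
    proof (rule wp_For[where I = ?I], goal_cases)
      case (4 j s')
      then have j: "j < m" using s by simp
      have s': "s' 4 = B" "s' 5 = l" "s' 6 = r" "s' 7 = d" "s' 8 = s 8" "s' 0 6 = ?e" "s' 0 5 = ?s"
         "s' 0 2 = \<mu>" "s' 0 1 = m" "s' 0 18 = 2*n" "s' 0 19 = 2*m"
        using s agree_array[OF 4(2)] agreeD[OF 4(2)] by simp_all
      then have ready: "ready (upd s' 0 7 j)" using s by (simp add: ready_def)
      show ?case
      proof (cases "B j \<le> B ?s")
        case False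
        then have "{i. i < Suc j \<and> B i \<le> B ?s} = {i. i < j \<and> B i \<le> B ?s}" by (auto simp: less_Suc_eq)
        then show ?thesis using False 4 s' bounds j B_le[of j] by (simp add: wp_simps)
      next
        case True
        then have "{i. i < Suc j \<and> B i \<le> B ?s} = insert j {i. i < j \<and> B i \<le> B ?s}"
          by (auto simp: less_Suc_eq)
        then have Suc: "(\<Sum>i | i < Suc j \<and> B i \<le> B ?s. d i * weight (s 8) (r ?e) i) =
          (\<Sum>i | i < j \<and> B i \<le> B ?s. d i * weight (s 8) (r ?e) i) + d j * weight (s 8) (r ?e) j" by simp
        have le: "(\<Sum>i | i < Suc j \<and> B i \<le> B ?s. d i * weight (s 8) (r ?e) i) \<le> m * C * (2*\<mu>)^(2*m)"
          by (rule weight_sum_le) (use j in auto)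
        have "wp W k weight_prog (wp W k (Set 9 (V 9 [+] Arr 7 (V 7) [*] V 10)) (?I (Suc j))) (upd s' 0 7 j)"
        proof (rule wp_weight[OF ready], goal_cases)
          case (3 t)
          have t: "t 0 9 = s' 0 9" "t 7 = d" "t 0 7 = j" "t 0 10 = weight (s 8) (r ?e) j"
            using agree_array[OF 3(1)] agreeD[OF 3(1)] s' 3(2) by simp_all
          show ?case
            using t 4(3) le weight_le[of "s 8" "r ?e" j] power_le_W d_le[OF j] bounds j
            unfolding Suc by (simp add: wp_simps)
        qed (use s' assms j in auto)
        then show ?thesis using True 4 s' bounds j B_le[of j] by (simp add: wp_simps)
      qed
    next
      case (5 s')
      then show ?case
        using s True by (intro impI Q) (simp_all add: gain_def)
    qed (use s bounds k_ge in auto)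
    then show ?thesis
      unfolding gain_prog_def wp_simps using True s bounds by (simp add: dist_test)
  qed
qed

lemma ready_agree:
  assumes "agree c s s'" "ready s" "\<And>a i. a \<in> {4, 5, 6, 7} \<Longrightarrow> \<not> touches c a i"
    "\<And>i. i \<in> {1, 2, 18, 19} \<Longrightarrow> \<not> touches c 0 i" "\<And>e. e < 2*m \<Longrightarrow> s' 8 e \<le> C"
  shows "ready s'"
proof -
  have "s' a = s a" if "a \<in> {4, 5, 6, 7}" for a
    by (rule agree_array[OF assms(1)]) (use assms(3) that in auto)
  moreover have "s' 0 i = s 0 i" if "i \<in> {1, 2, 18, 19}" for i
    by (rule agreeD[OF assms(1)]) (use assms(4) that in auto)
  ultimately show ?thesis using assms(2,5) by (simp add: ready_def)
qed

lemma wp_gains: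
  assumes "ready s" "s 0 5 < 2*m"
    and Q: "\<And>s'. agree gains_prog s s' \<Longrightarrow> (\<forall>e<2*m. s' 10 e = gain (s 8) (s 0 5) e) \<Longrightarrow> Q s'"
  shows "wp W k gains_prog Q s"
proof (rule wp_frame)
  note s = assms(1)[unfolded ready_def]
  have m: "0 < m" using assms by simp
  note bounds = W_gain[OF m]
  show "wp W k gains_prog (\<lambda>s'. agree gains_prog s s' \<longrightarrow> Q s') s"
    unfolding gains_prog_def
  proof (rule wp_For[where I = "\<lambda>j s'. \<forall>e<j. s' 10 e = gain (s 8) (s 0 5) e"], goal_cases)
    case (4 j s')
    then have j: "j < 2*m" using s by simp
    have s': "s' 8 = s 8" "s' 0 5 = s 0 5"
      using agree_array[OF 4(2)] agreeD[OF 4(2)] by simp_all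
    have "ready s'" by (rule ready_agree[OF 4(2) assms(1)]) (use s s' in auto)
    then have ready: "ready (upd s' 0 6 j)" by (simp add: ready_def)
    show ?case unfolding wp_simps
    proof (rule wp_gain[OF ready], goal_cases)
      case (3 t)
      have t: "t 0 6 = j" "t 10 = s' 10" "t 0 9 = gain (s 8) (s 0 5) j"
        using agree_array[OF 3(1)] agreeD[OF 3(1)] s' 3(2) by simp_all
      show ?case using t 4(3) bounds j gain_le[of "s 8" "s 0 5" j] by (auto simp: less_Suc_eq upd_apply)
    qed (use s' assms j in auto)
  next
    case (5 s')
    then show ?case using s by (auto simp: gains_prog_def intro!: Q)
  qed (use s bounds k_ge in auto)
qed

lemma wp_rank:
  assumes "ready s" "s 0 6 < 2*m" "\<forall>e<2*m. s 10 e \<le> m * C * (2*\<mu>)^(2*m)"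
    and Q: "\<And>s'. agree rank_prog s s' \<Longrightarrow> s' 0 12 = rank {..<2*m} (s 10) (s 0 6) \<Longrightarrow> Q s'"
  shows "wp W k rank_prog Q s"
proof (rule wp_frame)
  let ?e = "s 0 6"
  note s = assms(1)[unfolded ready_def]
  have m: "0 < m" using assms by simp
  note bounds = W_gain[OF m] assms(2)
  define rk where "rk j = card {f \<in> {..<j}. beats (s 10) f ?e}" for j
  have rk_Suc: "rk (Suc j) = rk j + of_bool (beats (s 10) j ?e)" for j
  proof -
    have "{f \<in> {..<Suc j}. beats (s 10) f ?e} = (if beats (s 10) j ?e
        then insert j {f \<in> {..<j}. beats (s 10) f ?e} else {f \<in> {..<j}. beats (s 10) f ?e})"
      by (auto simp: less_Suc_eq)
    then show ?thesis by (simp add: rk_def)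
  qed
  have rk_le: "rk j \<le> j" for j
    unfolding rk_def using card_mono[of "{..<j}" "{f \<in> {..<j}. beats (s 10) f ?e}"] by auto
  show "wp W k rank_prog (\<lambda>s'. agree rank_prog s s' \<longrightarrow> Q s') s"
    unfolding rank_prog_def wp_simps
  proof (intro conjI wp_For[where I = "\<lambda>j s'. s' 0 12 = rk j"], goal_cases)
    case (6 j s')
    then have j: "j < 2*m" using s by simp
    have s': "s' 0 6 = ?e" "s' 10 = s 10"
      using agree_array[OF 6(2)] agreeD[OF 6(2)] by simp_all
    have le: "s 10 j \<le> m * C * (2*\<mu>)^(2*m)" "s 10 ?e \<le> m * C * (2*\<mu>)^(2*m)"
      using assms(2,3) j by auto
    show ?case
      using 6(3) s' le rk_le[of j] bounds j
      by (auto simp: wp_simps less_test rk_Suc beats_def of_bool_def split: if_splits)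
  next
    case (7 s')
    then show ?case using s by (intro impI Q) (simp_all add: rank_def rk_def rank_prog_def)
  qed (use s bounds k_ge in \<open>auto simp: rk_def\<close>)
qed

text \<open>All gains are stored before the ranking starts, since each rank compares with all of
  them. The word bound on the total is exported because the search copies it to another
  scalar.\<close>

lemma wp_eval:
  assumes "ready s" "s 0 5 < 2*m"
    and Q: "\<And>s'. agree eval_prog s s' \<Longrightarrow> s' 0 11 = total (s 8) (s 0 5) \<Longrightarrow>
      (\<forall>e<2*m. s' 11 e = of_bool (e \<in> chosen (s 8) (s 0 5))) \<Longrightarrow> total (s 8) (s 0 5) \<le> W \<Longrightarrow> Q s'"
  shows "wp W k eval_prog Q s"
proof (rule wp_frame)
  let ?G = "gain (s 8) (s 0 5)" and ?T = "chosen (s 8) (s 0 5)"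
  note s = assms(1)[unfolded ready_def]
  have m: "0 < m" using assms by simp
  note bounds = W_gain[OF m]
  have sum_le: "sum ?G X \<le> W" if "X \<subseteq> {..<2*m}" for X
  proof -
    have "sum ?G X \<le> (\<Sum>e\<in>X. m * C * (2*\<mu>)^(2*m))" by (rule sum_mono) (rule gain_le)
    also have "\<dots> = card X * (m * C * (2*\<mu>)^(2*m))" by simp
    also have "\<dots> \<le> 2*m * (m * C * (2*\<mu>)^(2*m))"
      using card_mono[of "{..<2*m}" X] that by (intro mult_right_mono) auto
    also have "\<dots> \<le> W" using W_ge by (simp add: algebra_simps)
    finally show ?thesis .
  qed
  show "wp W k eval_prog (\<lambda>s'. agree eval_prog s s' \<longrightarrow> Q s') s"
    unfolding eval_prog_def wp_simps
  proof (rule wp_gains[OF assms(1,2)], goal_cases)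
    case (1 t)
    have t: "t 8 = s 8" "t 0 5 = s 0 5"
      using agree_array[OF 1(1)] agreeD[OF 1(1)] by simp_all
    have "ready t" by (rule ready_agree[OF 1(1) assms(1)]) (use s t in auto)
    note t = t this[unfolded ready_def] 1(2)
    have chosen: "e \<in> ?T \<longleftrightarrow> rank {..<2*m} (t 10) e < \<mu> \<and> 0 < ?G e" if "e < 2*m" for e
    proof -
      have "{f \<in> {..<2*m}. beats (t 10) f e} = {f \<in> {..<2*m}. beats ?G f e}"
        using 1(2) that by (auto simp: beats_def)
      then show ?thesis using that by (auto simp: chosen_def top_set_def rank_def)
    qed
    let ?I = "\<lambda>j s'. s' 0 11 = sum ?G (?T \<inter> {..<j}) \<and> (\<forall>e<j. s' 11 e = of_bool (e \<in> ?T))"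
    show ?case
      unfolding choose_prog_def wp_simps
    proof (intro conjI wp_For[where I = ?I], goal_cases)
      case (7 j s')
      then have j: "j < 2*m" using t by simp
      have s': "s' 8 = s 8" "s' 10 = t 10" "s' 0 5 = s 0 5"
        using agree_array[OF 7(2)] agreeD[OF 7(2)] t by simp_all
      have rt: "ready (upd t 0 (val (Lit 11) t) (val (Lit 0) t))" using \<open>ready t\<close> by (simp add: ready_def)
      have "ready s'" by (rule ready_agree[OF 7(2) rt]) (use s s' in auto)
      then have ready: "ready (upd s' 0 6 j)" by (simp add: ready_def)
      show ?case unfolding wp_Seq
      proof (rule wp_rank[OF ready], goal_cases)
        case (3 z)
        have z: "z 0 12 = rank {..<2*m} (t 10) j" "z 10 = t 10" "z 0 6 = j" "z 0 2 = \<mu>" "z 0 11 = s' 0 11" "z 11 = s' 11"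
          using agree_array[OF 3(1)] agreeD[OF 3(1)] s' 3(2) ready by (simp_all add: ready_def)
        have G: "t 10 j = ?G j" using t j by simp
        have "card {f \<in> {..<2*m}. beats (t 10) f j} \<le> card {..<2*m}" by (rule card_mono) auto
        then have rank: "rank {..<2*m} (t 10) j \<le> 2*m" by (simp add: rank_def)
        have Int: "?T \<inter> {..<Suc j} = (if j \<in> ?T then insert j (?T \<inter> {..<j}) else ?T \<inter> {..<j})"
          by (auto simp: less_Suc_eq)
        have le: "sum ?G (?T \<inter> {..<Suc j}) \<le> W" "sum ?G (?T \<inter> {..<j}) \<le> W"
          by (rule sum_le, use j in auto)+
        show ?case
        proof (cases "j \<in> ?T")
          case True
          then show ?thesis
            using z G rank 7(3) bounds j gain_le[of "s 8" "s 0 5" j] le chosen[OF j]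
            by (auto simp: wp_simps Int less_Suc_eq upd_apply)
        next
          case False
          then show ?thesis
            using z G rank 7(3) bounds j gain_le[of "s 8" "s 0 5" j] le chosen[OF j]
            by (auto simp: wp_simps Int less_Suc_eq upd_apply)
        qed
      qed (use s' t j gain_le in auto)
    next
      case (8 s')
      moreover have "?T \<inter> {..<2*m} = ?T" by (auto dest: chosenD)
      ultimately show ?case
        using t sum_le[of "?T"] by (intro impI Q) (auto simp: total_def eval_prog_def choose_prog_def dest: chosenD)
    qed (use t bounds k_ge in auto)
  qed
qed

text \<open>The best total starts at 0 and changes only on strict improvement, so it ends at 0
  exactly when every candidate has total 0; this separates \<open>reach_skip\<close> from
  \<open>reach_pick\<close>.\<close>

lemma wp_search:
  assumes "ready s" "s 0 4 < 2*n"
    and Q: "\<And>s'. agree search_prog s s' \<Longrightarrow>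
      (\<forall>c<2*m. l c = s 0 4 \<longrightarrow> total (s 8) c \<le> s' 0 13) \<Longrightarrow>
      s' 0 13 = 0 \<or> s' 0 14 < 2*m \<and> l (s' 0 14) = s 0 4 \<and> s' 0 13 = total (s 8) (s' 0 14) \<Longrightarrow>
      s' 0 13 \<le> W \<Longrightarrow> Q s'"
  shows "wp W k search_prog Q s"
proof (rule wp_frame)
  let ?U = "s 0 4"
  note s = assms(1)[unfolded ready_def]
  note bounds = W_linear assms(2)
  let ?I = "\<lambda>j s'. ((\<forall>c<j. l c = ?U \<longrightarrow> total (s 8) c \<le> s' 0 13) \<and>
      (s' 0 13 = 0 \<or> s' 0 14 < 2*m \<and> l (s' 0 14) = ?U \<and> s' 0 13 = total (s 8) (s' 0 14)) \<and>
      s' 0 13 \<le> W)"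
  show "wp W k search_prog (\<lambda>s'. agree search_prog s s' \<longrightarrow> Q s') s"
    unfolding search_prog_def wp_Seq
  proof (subst wp_Store, intro conjI, goal_cases)
    case 3
    show ?case
    proof (rule wp_For[where I = ?I], goal_cases)
      case (4 j s')
      then have j: "j < 2*m" using s by simp
      have s': "s' 8 = s 8" "s' 0 4 = ?U" "s' 5 = l"
        using agree_array[OF 4(2)] agreeD[OF 4(2)] s by simp_all
      have rt: "ready (upd s 0 (val (Lit 13) s) (val (Lit 0) s))" using assms(1) by (simp add: ready_def)
      have "ready s'" by (rule ready_agree[OF 4(2) rt]) (use s s' in auto)
      then have ready: "ready (upd s' 0 5 j)" by (simp add: ready_def)
      show ?case
      proof (cases "l j = ?U")
        case False
        have "?I (Suc j) (upd (upd s' 0 5 j) 0 63 0)" using 4(3) False by (auto simp: less_Suc_eq)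
        then show ?thesis using False s' bounds l_less2[OF j] j by (auto simp: wp_simps dist_test)
      next
        case True
        have "wp W k eval_prog (wp W k (If (V 13) (V 11) (Seq (Set 13 (V 11)) (Set 14 (V 5))) Skip) (?I (Suc j)))
          (upd s' 0 5 j)"
        proof (rule wp_eval[OF ready], goal_cases)
          case (2 z)
          have z: "z 0 13 = s' 0 13" "z 0 14 = s' 0 14" "z 0 5 = j" "z 0 11 = total (s 8) j"
            using agreeD[OF 2(1)] 2(2) s' by simp_all
          show ?case
          proof (cases "s' 0 13 < total (s 8) j")
            case True
            have "?I (Suc j) (upd (upd z 0 13 (total (s 8) j)) 0 14 j)"
              using 4(3) True \<open>l j = ?U\<close> j 2(4) s' by (auto simp: less_Suc_eq)
            then show ?thesis using True z 4(3) 2(4) bounds j s' by (simp add: wp_simps)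
          next
            case False
            have "?I (Suc j) (upd z 0 63 0)"
              using 4(3) False z by (auto simp: less_Suc_eq)
            then show ?thesis using False z 4(3) 2(4) bounds j s' by (simp add: wp_simps)
          qed
        qed (use j in simp)
        then show ?thesis using True s' bounds j by (simp add: wp_simps dist_test)
      qed
    next
      case (5 s')
      then show ?case using s by (intro impI Q) (simp_all add: search_prog_def)
    qed (use s bounds k_ge in simp_all)
  qed (use bounds in simp_all)
qed

text \<open>The winner is evaluated a second time, since later candidates may have overwritten the
  array of chosen edges during the search.\<close>

lemma wp_pick:
  assumes "ready s" "s 0 4 < 2*n" "s 0 14 < 2*m"
    and Q: "\<And>s'. agree pick_prog s s' \<Longrightarrow>
      s' 8 = (\<lambda>e. if e \<in> chosen (s 8) (s 0 14) then B (s 0 14) else s 8 e) \<Longrightarrow>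
      s' 9 = (s 9)(s 0 4 := B (s 0 14)) \<Longrightarrow> Q s'"
  shows "wp W k pick_prog Q s"
proof (rule wp_frame)
  let ?c = "s 0 14" and ?U = "s 0 4"
  let ?T = "chosen (s 8) ?c"
  note s = assms(1)[unfolded ready_def]
  note bounds = W_linear assms(2,3) B_le[OF assms(3)]
  have ready: "ready (upd s 0 5 ?c)" using assms(1) by (simp add: ready_def)
  have main: "wp W k eval_prog (wp W k (Store 9 (V 4) (Arr 4 (V 5))) (wp W k
     (For 6 (V 19) (If (Lit 0) (Arr 11 (V 6)) (Store 8 (V 6) (Arr 4 (V 5))) Skip))
     (\<lambda>s'. agree pick_prog s s' \<longrightarrow> Q s'))) (upd s 0 5 ?c)"
  proof (rule wp_eval[OF ready], goal_cases)
    case (2 z)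
    have z: "z 0 4 = ?U" "z 0 5 = ?c" "z 4 = B" "z 8 = s 8" "z 9 = s 9" "z 0 19 = 2*m"
      using agreeD[OF 2(1)] agree_array[OF 2(1)] s by simp_all
    have sel: "z 11 e = of_bool (e \<in> ?T)" if "e < 2*m" for e using 2(3) that by simp
    let ?z = "upd z 9 ?U (B ?c)"
    have "wp W k (For 6 (V 19) (If (Lit 0) (Arr 11 (V 6)) (Store 8 (V 6) (Arr 4 (V 5))) Skip))
       (\<lambda>s'. agree pick_prog s s' \<longrightarrow> Q s') ?z"
    proof (rule wp_For[where I = "\<lambda>j s'. s' 8 = (\<lambda>e. if e \<in> ?T \<and> e < j then B ?c else s 8 e)"], goal_cases)
      case (4 j s')
      then have j: "j < 2*m" using z by simp
      have s': "s' 0 5 = ?c" "s' 4 = B" "s' 11 = z 11"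
        using agree_array[OF 4(2)] agreeD[OF 4(2)] z by simp_all
      show ?case
        using s' sel[OF j] 4(3) j bounds
        by (auto simp: wp_simps less_Suc_eq fun_eq_iff upd_apply)
    next
      case (5 s')
      have "(\<lambda>e. if e \<in> ?T \<and> e < 2*m then B ?c else s 8 e) = (\<lambda>e. if e \<in> ?T then B ?c else s 8 e)"
        by (intro ext) (auto dest: chosenD)
      moreover have "s' 9 = (s 9)(?U := B ?c)"
        using agree_array[OF 5(1), of 9] z by (simp add: upd_def)
      ultimately show ?case using 5 z by (intro impI Q) simp_all
    qed (use z bounds k_ge in simp_all)
    then show ?case using z bounds by (simp add: wp_Store)
  qed (use assms in simp)
  show "wp W k pick_prog (\<lambda>s'. agree pick_prog s s' \<longrightarrow> Q s') s"
    using main bounds unfolding pick_prog_def wp_Seq wp_Store[of W k 0 "Lit 5"] by simp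
qed

lemma wp_greedy:
  assumes "ready s" "\<forall>e<2*m. s 8 e = 0" "\<forall>u<2*n. s 9 u = 0"
    and Q: "\<And>s'. agree greedy_prog s s' \<Longrightarrow> reach (2*n) (s' 8) (s' 9) \<Longrightarrow> Q s'"
  shows "wp W k greedy_prog Q s"
proof (rule wp_frame)
  note s = assms(1)[unfolded ready_def]
  note bounds = W_linear
  have init: "reach 0 (s 8) (s 9)" by (rule reach_0) (use assms in auto)
  show "wp W k greedy_prog (\<lambda>s'. agree greedy_prog s s' \<longrightarrow> Q s') s"
    unfolding greedy_prog_def
  proof (rule wp_For[where I = "\<lambda>j s'. reach j (s' 8) (s' 9)"], goal_cases)
    case (4 j s')
    then have j: "j < 2*n" using s by simp
    have le: "s' 8 e \<le> C" if "e < 2*m" for e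
      using reach_facts[OF 4(3)] that B_le[OF that] by fastforce
    have "ready s'" by (rule ready_agree[OF 4(2) assms(1)]) (use le in auto)
    then have ready: "ready (upd s' 0 4 j)" by (simp add: ready_def)
    have "wp W k search_prog (wp W k (If (Lit 0) (V 13) pick_prog Skip) (\<lambda>s'. reach (Suc j) (s' 8) (s' 9)))
       (upd s' 0 4 j)"
    proof (rule wp_search[OF ready], goal_cases)
      case (2 z)
      have z: "z 0 4 = j" "z 8 = s' 8" "z 9 = s' 9"
        using agreeD[OF 2(1)] agree_array[OF 2(1)] by simp_all
      have ready_z: "ready z" by (rule ready_agree[OF 2(1) ready]) (use le z in auto)
      show ?case
      proof (cases "z 0 13 = 0")
        case True
        have "reach (Suc j) (s' 8) (s' 9)"
          by (rule reach_skip[OF 4(3)]) (use 2(2) True in auto)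
        then show ?thesis using True z bounds by (simp add: wp_If wp_Store)
      next
        case False
        have c: "z 0 14 < 2*m" "l (z 0 14) = j" "total (s' 8) (z 0 14) = z 0 13" using 2(3) False by auto
        have "wp W k pick_prog (\<lambda>s'. reach (Suc j) (s' 8) (s' 9)) z"
        proof (rule wp_pick[OF ready_z], goal_cases)
          case (3 t)
          have "reach (Suc j) (\<lambda>e. if e \<in> chosen (s' 8) (z 0 14) then B (z 0 14) else s' 8 e)
              ((s' 9)(j := B (z 0 14)))"
            by (rule reach_pick[OF 4(3) c(1,2)]) (use 2(2) c False in auto)
          then show ?case using 3(2,3) unfolding z by simp
        qed (use z c j in auto)
        then show ?thesis using False 2(4) bounds by (simp add: wp_If)
      qed
    qed (use j in simp)
    then show ?case by (simp add: wp_Seq)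
  next
    case (5 s')
    then show ?case using s by (intro impI Q) (simp_all add: greedy_prog_def)
  qed (use s bounds k_ge init in simp_all)
qed

end

section \<open>Rounding, sales and output\<close>

definition offers_prog :: com where
  "offers_prog = For 6 (V 1) (If (Lit 0) (Arr 2 (Arr 5 (V 6)))
     (Store 12 (V 6) (Arr 8 (V 6 [+] V 1))) (Store 12 (V 6) (Arr 8 (V 6))))"

definition rival_prog :: com where
  "rival_prog = Seq (Set 12 (Lit 0)) (For 8 (V 1)
     (If (dist (Arr 6 (V 8)) (Arr 6 (V 6))) (Lit 1)
       (If (Arr 12 (V 6)) (Arr 12 (V 8) [+] (Lit 1 [-] (V 8 [+] Lit 1 [-] V 6)))
         (Set 12 (V 12 [+] Lit 1)) Skip) Skip))"

definition sell_prog :: com where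
  "sell_prog = For 6 (V 1) (Seq rival_prog (Seq (Store 13 (V 18 [+] V 6) (Lit 0))
     (If (V 12) (V 2) (If (Lit 0) (Arr 12 (V 6)) (Store 13 (V 18 [+] V 6) (Lit 1)) Skip) Skip)))"

definition prices_prog :: com where
  "prices_prog = For 16 (V 0) (Seq
     (If (Lit 0) (Arr 2 (V 16)) (Store 13 (Lit 2 [*] V 16) (Arr 9 (V 16 [+] V 0)))
        (Store 13 (Lit 2 [*] V 16) (Arr 9 (V 16))))
     (Store 13 (Lit 2 [*] V 16 [+] Lit 1) (V 3)))"

text \<open>The last three cells repeat the outputs \<open>0\<close>, \<open>2\<close> and \<open>1\<close>: the cells \<open>0\<close>, \<open>1\<close>, \<open>2\<close> hold
  the pointers of the loop that moves the output to the beginning of the memory.\<close>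

definition repeat_prog :: com where
  "repeat_prog = Seq (Set 25 (V 18 [+] V 1))
     (Seq (Store 13 (V 25) (Arr 13 (Lit 0)))
     (Seq (Store 13 (V 25 [+] Lit 1) (Arr 13 (Lit 2)))
          (Store 13 (V 25 [+] Lit 2) (Arr 13 (Lit 1)))))"

definition final_prog :: com where
  "final_prog = Seq offers_prog (Seq sell_prog (Seq prices_prog repeat_prog))"

lemma touches_final [simp]:
  "touches offers_prog a i \<longleftrightarrow> a = 0 \<and> i = 6 \<or> a = 12"
  "touches rival_prog a i \<longleftrightarrow> a = 0 \<and> i \<in> {8, 12, 63}"
  "touches sell_prog a i \<longleftrightarrow> a = 0 \<and> i \<in> {6, 8, 12, 63} \<or> a = 13"
  "touches prices_prog a i \<longleftrightarrow> a = 0 \<and> i = 16 \<or> a = 13"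
  "touches repeat_prog a i \<longleftrightarrow> a = 0 \<and> i = 25 \<or> a = 13"
  "touches final_prog a i \<longleftrightarrow> a = 0 \<and> i \<in> {6, 8, 12, 16, 25, 63} \<or> a = 12 \<or> a = 13"
  by (auto simp: offers_prog_def rival_prog_def sell_prog_def prices_prog_def repeat_prog_def final_prog_def)

text \<open>Of offers and prices only bounds are required, so the last part can also follow a
  skipped greedy program. By \<open>2 \<le> n\<close> the output cells 0, 1 and 2 belong to
  prices.\<close>

definition finals :: "nat \<Rightarrow> nat \<Rightarrow> nat \<Rightarrow> nat \<Rightarrow> nat \<Rightarrow> nat \<Rightarrow> nat \<Rightarrow> state \<Rightarrow> bool" where
  "finals n m \<mu> C W k D s \<longleftrightarrow> s 0 0 = n \<and> s 0 1 = m \<and> s 0 2 = \<mu> \<and> s 0 18 = 2*n \<and> s 0 3 = D \<and>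
     (\<forall>e<2*m. s 8 e \<le> C) \<and> (\<forall>u<2*n. s 9 u \<le> C) \<and> (\<forall>e<m. s 5 e < n \<and> s 6 e \<le> n) \<and>
     (\<forall>v<n. s 2 v \<le> 1) \<and> 2 \<le> n \<and> D \<le> W \<and> 8*(C + n + m + \<mu>) + 100 \<le> W \<and> 2*n \<le> k \<and> 2*m \<le> k"

definition final_offer :: "nat \<Rightarrow> state \<Rightarrow> nat \<Rightarrow> nat" where
  "final_offer m s j = s 8 (if 0 < s 2 (s 5 j) then j + m else j)"

lemma finals_agree:
  assumes "finals n m \<mu> C W k D s" "agree c s s'"
   "\<And>a i. a \<in> {2, 5, 6, 8, 9} \<Longrightarrow> \<not> touches c a i" "\<And>i. i \<in> {0, 1, 2, 3, 18} \<Longrightarrow> \<not> touches c 0 i"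
  shows "finals n m \<mu> C W k D s'" "s' 2 = s 2" "s' 5 = s 5" "s' 6 = s 6" "s' 8 = s 8" "s' 9 = s 9"
proof -
  have arr: "s' a = s a" if "a \<in> {2, 5, 6, 8, 9}" for a
    by (rule agree_array[OF assms(2)]) (use assms(3) that in auto)
  have var: "s' 0 i = s 0 i" if "i \<in> {0, 1, 2, 3, 18}" for i
    by (rule agreeD[OF assms(2)]) (use assms(4) that in auto)
  show "s' 2 = s 2" "s' 5 = s 5" "s' 6 = s 6" "s' 8 = s 8" "s' 9 = s 9" using arr by simp_all
  show "finals n m \<mu> C W k D s'" using assms(1) arr var by (simp add: finals_def)
qed

lemma finals_bound: "finals n m \<mu> C W k D s \<Longrightarrow> 8*(C + n + m + \<mu>) + 100 \<le> W"
  by (simp add: finals_def)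

lemma wp_offers:
  assumes "finals n m \<mu> C W k D s"
    and Q: "\<And>s'. agree offers_prog s s' \<Longrightarrow> (\<forall>j<m. s' 12 j = final_offer m s j) \<Longrightarrow> Q s'"
  shows "wp W k offers_prog Q s"
proof (rule wp_frame)
  note s = assms(1)[unfolded finals_def]
  show "wp W k offers_prog (\<lambda>s'. agree offers_prog s s' \<longrightarrow> Q s') s"
    unfolding offers_prog_def
  proof (rule wp_For[where I = "\<lambda>j s'. \<forall>f<j. s' 12 f = final_offer m s f"], goal_cases)
    case (4 j s')
    then have j: "j < m" using s by simp
    note s' = finals_agree[OF assms(1) 4(2)]
    have f': "finals n m \<mu> C W k D s'" by (rule s'(1)) auto
    have eq: "s' 2 = s 2" "s' 5 = s 5" "s' 8 = s 8" by (rule s', auto)+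
    have "s 8 j \<le> C" "s 8 (j + m) \<le> C" "s 5 j < n" "s 2 (s 5 j) \<le> 1" using s j by auto
    then have le: "s 8 j \<le> W" "s 8 (j + m) \<le> W" "s 5 j \<le> W" "s 2 (s 5 j) \<le> W" using finals_bound[OF assms(1)] by simp_all
    show ?case
      using f'[unfolded finals_def] eq le 4(3) j
      by (auto simp: wp_simps final_offer_def less_Suc_eq upd_apply)
  next
    case (5 s')
    then show ?case using s by (intro impI Q) (simp_all add: offers_prog_def)
  qed (use s in auto)
qed

lemma rank_cong: "(\<And>f. f \<in> S \<Longrightarrow> g f = h f) \<Longrightarrow> e \<in> S \<Longrightarrow> rank S g e = rank S h e"
  unfolding rank_def beats_def by (intro arg_cong[of _ _ card]) auto

lemma wp_rival:
  assumes "finals n m \<mu> C W k D s" "s 0 6 < m" "\<forall>j<m. s 12 j \<le> C"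
    and Q: "\<And>s'. agree rival_prog s s' \<Longrightarrow>
      s' 0 12 = rank {f. f < m \<and> s 6 f = s 6 (s 0 6)} (s 12) (s 0 6) \<Longrightarrow> Q s'"
  shows "wp W k rival_prog Q s"
proof (rule wp_frame)
  let ?e = "s 0 6"
  note s = assms(1)[unfolded finals_def]
  define rk where "rk j = card {f. f < j \<and> s 6 f = s 6 ?e \<and> beats (s 12) f ?e}" for j
  have rk_Suc: "rk (Suc j) = rk j + of_bool (s 6 j = s 6 ?e \<and> beats (s 12) j ?e)" for j
  proof -
    have "{f. f < Suc j \<and> s 6 f = s 6 ?e \<and> beats (s 12) f ?e} = (if s 6 j = s 6 ?e \<and> beats (s 12) j ?e
        then insert j {f. f < j \<and> s 6 f = s 6 ?e \<and> beats (s 12) f ?e}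
        else {f. f < j \<and> s 6 f = s 6 ?e \<and> beats (s 12) f ?e})"
      by (auto simp: less_Suc_eq)
    then show ?thesis by (simp add: rk_def)
  qed
  have rk_le: "rk j \<le> j" for j
    unfolding rk_def using card_mono[of "{..<j}" "{f. f < j \<and> s 6 f = s 6 ?e \<and> beats (s 12) f ?e}"] by auto
  show "wp W k rival_prog (\<lambda>s'. agree rival_prog s s' \<longrightarrow> Q s') s"
    unfolding rival_prog_def wp_simps
  proof (intro conjI wp_For[where I = "\<lambda>j s'. s' 0 12 = rk j"], goal_cases)
    case (6 j s')
    then have j: "j < m" using s by simp
    have s': "s' 0 6 = ?e" "s' 6 = s 6" "s' 12 = s 12"
      using agree_array[OF 6(2)] agreeD[OF 6(2)] by simp_all
    have "s 6 j \<le> n" "s 6 ?e \<le> n" and le': "s 12 j \<le> C" "s 12 ?e \<le> C" using s j assms(2,3) by auto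
    then have le: "s 6 j \<le> W" "s 6 ?e \<le> W" "(s 6 j - s 6 ?e) + (s 6 ?e - s 6 j) \<le> W" using finals_bound[OF assms(1)] by simp_all
    show ?case
      using 6(3) s' le le' rk_le[of j] j s assms(2)
      by (auto simp: wp_simps less_test dist_test rk_Suc beats_def of_bool_def split: if_splits)
  next
    case (7 s')
    then show ?case
      using s by (intro impI Q) (simp_all add: rank_def rk_def rival_prog_def conj_assoc)
  qed (use s in \<open>auto simp: rk_def\<close>)
qed

lemma wp_sell:
  assumes "finals n m \<mu> C W k D s" "\<forall>j<m. s 12 j \<le> C"
    and Q: "\<And>s'. agree sell_prog s s' \<Longrightarrow> (\<forall>j<m. s' 13 (2*n + j) =
      of_bool (0 < s 12 j \<and> rank {f. f < m \<and> s 6 f = s 6 j} (s 12) j < \<mu>)) \<Longrightarrow> Q s'"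
  shows "wp W k sell_prog Q s"
proof (rule wp_frame)
  note s = assms(1)[unfolded finals_def]
  let ?I = "\<lambda>i s'. \<forall>j<i. s' 13 (2*n + j) =
      of_bool (0 < s 12 j \<and> rank {f. f < m \<and> s 6 f = s 6 j} (s 12) j < \<mu>)"
  show "wp W k sell_prog (\<lambda>s'. agree sell_prog s s' \<longrightarrow> Q s') s"
    unfolding sell_prog_def
  proof (rule wp_For[where I = ?I], goal_cases)
    case (4 j s')
    then have j: "j < m" using s by simp
    have "finals n m \<mu> C W k D s'" by (rule finals_agree[OF assms(1) 4(2)]) auto
    then have f': "finals n m \<mu> C W k D (upd s' 0 6 j)" by (simp add: finals_def)
    have s': "s' 12 = s 12" "s' 6 = s 6" using agree_array[OF 4(2)] by simp_all
    show ?case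
      unfolding wp_Seq
    proof (rule wp_rival[OF f'], goal_cases)
      case (3 z)
      have z: "z 12 = s 12" "z 13 = s' 13" "z 0 6 = j" "z 0 2 = \<mu>" "z 0 18 = 2*n"
        using agree_array[OF 3(1)] agreeD[OF 3(1)] s' f' by (simp_all add: finals_def)
      have z12: "z 0 12 = rank {f. f < m \<and> s 6 f = s 6 j} (s 12) j" using 3(2) s' by simp
      have "rank {f. f < m \<and> s 6 f = s 6 j} (s 12) j \<le> card {..<m}"
        unfolding rank_def by (rule card_mono) auto
      then show ?case
        using z z12 4(3) s assms(2) j by (auto simp: wp_simps less_Suc_eq upd_apply)
    qed (use j s' assms in auto)
  next
    case (5 s')
    then show ?case using s by (intro impI Q) (simp_all add: sell_prog_def)
  qed (use s in auto)
qed

lemma wp_prices: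
  assumes "finals n m \<mu> C W k D s"
    and Q: "\<And>s'. agree prices_prog s s' \<Longrightarrow> (\<forall>v<n. s' 13 (2 * v) = s 9 (if 0 < s 2 v then v + n else v) \<and>
      s' 13 (2 * v + 1) = D) \<Longrightarrow> (\<forall>i\<ge>2*n. s' 13 i = s 13 i) \<Longrightarrow> Q s'"
  shows "wp W k prices_prog Q s"
proof (rule wp_frame)
  note s = assms(1)[unfolded finals_def]
  let ?I = "\<lambda>i s'. (\<forall>v<i. s' 13 (2 * v) = s 9 (if 0 < s 2 v then v + n else v) \<and>
      s' 13 (2 * v + 1) = D) \<and> (\<forall>i\<ge>2*n. s' 13 i = s 13 i)"
  show "wp W k prices_prog (\<lambda>s'. agree prices_prog s s' \<longrightarrow> Q s') s"
    unfolding prices_prog_def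
  proof (rule wp_For[where I = ?I], goal_cases)
    case (4 v s')
    then have v: "v < n" using s by simp
    have f': "finals n m \<mu> C W k D s'" "s' 2 = s 2" "s' 9 = s 9" by (rule finals_agree[OF assms(1) 4(2)], auto)+
    have "s 9 v \<le> C" "s 9 (v + n) \<le> C" "s 2 v \<le> 1" using s v by auto
    then have le: "s 9 v \<le> W" "s 9 (v + n) \<le> W" "s 2 v \<le> W" using finals_bound[OF assms(1)] by simp_all
    have old: "s' 13 (2*u) = s 9 (if 0 < s 2 u then u + n else u)" "s' 13 (2*u + 1) = D" if "u < v" for u
      using 4(3) that by auto
    have old': "s' 13 i = s 13 i" if "2*n \<le> i" for i using 4(3) that by auto
    have "?I (Suc v) (upd (upd (upd s' 0 16 v) 13 (2 * v) (s 9 (if 0 < s 2 v then v + n else v))) 13 (2 * v + 1) D)"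
      using old old' v by (auto simp: less_Suc_eq upd_apply)
    then show ?case
      using f' le v by (auto simp: finals_def wp_simps)
  next
    case (5 s')
    then show ?case using s by (intro impI Q) (simp_all add: prices_prog_def)
  qed (use s in auto)
qed

lemma wp_final:
  assumes "finals n m \<mu> C W k D s"
    and Q: "\<And>s'. (\<forall>v<n. s' 13 (2 * v) = s 9 (if 0 < s 2 v then v + n else v) \<and> s' 13 (2 * v + 1) = D) \<Longrightarrow>
      (\<forall>j<m. s' 13 (2*n + j) = of_bool (0 < final_offer m s j \<and>
         rank {f. f < m \<and> s 6 f = s 6 j} (final_offer m s) j < \<mu>)) \<Longrightarrow>
      s' 0 25 = 2*n + m \<Longrightarrow> s' 13 (2*n + m) = s' 13 0 \<Longrightarrow> s' 13 (2*n + m + 1) = s' 13 2 \<Longrightarrow>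
      s' 13 (2*n + m + 2) = s' 13 1 \<Longrightarrow> Q s'"
  shows "wp W k final_prog Q s"
  unfolding final_prog_def wp_Seq
proof (rule wp_offers[OF assms(1)], goal_cases)
  case (1 s1)
  note f1 = finals_agree[OF assms(1) 1(1)]
  have f1': "finals n m \<mu> C W k D s1" and eq1: "s1 2 = s 2" "s1 6 = s 6" "s1 9 = s 9" by (rule f1, auto)+
  note s = assms(1)[unfolded finals_def]
  have le: "s1 12 j \<le> C" if "j < m" for j using 1(2) that s by (auto simp: final_offer_def)
  have rank: "rank {f. f < m \<and> s 6 f = s 6 j} (s1 12) j = rank {f. f < m \<and> s 6 f = s 6 j} (final_offer m s) j"
    if "j < m" for j by (rule rank_cong) (use 1(2) that in auto)
  show ?case
  proof (rule wp_sell[OF f1'], goal_cases)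
    case (2 s2)
    note f2 = finals_agree[OF f1' 2(1)]
    have f2': "finals n m \<mu> C W k D s2" and eq2: "s2 2 = s1 2" "s2 9 = s1 9" by (rule f2, auto)+
    show ?case
    proof (rule wp_prices[OF f2'], goal_cases)
      case (1 s3)
      note f3 = finals_agree[OF f2' 1(1)]
      have f3': "finals n m \<mu> C W k D s3" by (rule f3, auto)
      note s3 = f3'[unfolded finals_def]
      have p: "s3 13 (2 * v) = s 9 (if 0 < s 2 v then v + n else v)" "s3 13 (Suc (2 * v)) = D" if "v < n" for v
        using 1(2) that eq1 eq2 by simp_all
      have F: "s3 13 (2*n + j) = of_bool (0 < final_offer m s j \<and>
         rank {f. f < m \<and> s 6 f = s 6 j} (final_offer m s) j < \<mu>)" if "j < m" for j
        using 1(3) 2(2) that eq1 rank[OF that] \<open>\<forall>j<m. s1 12 j = final_offer m s j\<close> by simp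
      have b: "s3 13 0 \<le> C" "s3 13 1 \<le> W" "s3 13 2 \<le> C"
        using p[of 0] p[of 1] s by (auto simp: numeral_2_eq_2)
      let ?s = "upd (upd (upd (upd s3 0 25 (2*n + m)) 13 (2*n + m) (s3 13 0)) 13 (2*n + m + 1) (s3 13 2))
        13 (2*n + m + 2) (s3 13 1)"
      have "Q ?s"
      proof (rule Q)
        show "\<forall>v<n. ?s 13 (2 * v) = s 9 (if 0 < s 2 v then v + n else v) \<and> ?s 13 (2 * v + 1) = D"
          using p by (auto simp: upd_apply)
        show "\<forall>j<m. ?s 13 (2*n + j) = of_bool (0 < final_offer m s j \<and>
         rank {f. f < m \<and> s 6 f = s 6 j} (final_offer m s) j < \<mu>)"
          using F by simp
      qed (use s in \<open>simp_all add: upd_apply\<close>)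
      then show ?case
        using b s3 by (simp add: repeat_prog_def wp_simps)
    qed
  qed (use le in auto)
qed


section \<open>Reading the instance\<close>

text \<open>Input positions count from 1, and \<open>n\<close>, \<open>m\<close> and the
  \<open>n\<close> capacities precede the customers; the record of customer \<open>j\<close> starts
  at \<open>3 + n + 4 * j\<close>.\<close>

abbreviation field :: "nat \<Rightarrow> exp" where
  "field c \<equiv> Arr 1 (Lit (3 + c) [+] V 0 [+] Lit 4 [*] V 6)"

text \<open>The capacity is taken from input position 4, that of vertex 1: position 3 serves as a
  pointer while the input is copied, and capacities are uniform. Code 0 means infinite capacity.
  Cutting \<open>\<mu>\<close> down to \<open>m\<close> keeps the length of
  \<open>(2 \<mu>) ^ (2 * m)\<close> polynomial.\<close>

definition load_prog :: com where
  "load_prog = Seq (Set 0 (Arr 1 (Lit 1))) (Seq (Set 1 (Arr 1 (Lit 2)))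
     (Seq (Set 18 (Lit 2 [*] V 0)) (Seq (Set 19 (Lit 2 [*] V 1))
     (Seq (If (Lit 0) (Arr 1 (Lit 4)) (Set 2 (Arr 1 (Lit 4) [-] Lit 1)) (Set 2 (V 1)))
          (If (V 1) (V 2) (Set 2 (V 1)) Skip)))))"

definition denom_prog :: com where
  "denom_prog = Seq (Set 3 (Lit 1)) (For 6 (V 1) (Set 3 (V 3 [*] field 3)))"

text \<open>The expression \<open>e\<close> is all that distinguishes the two problems: it reads the
  side of a vertex from the input or from a coin.\<close>

definition sides_prog :: "exp \<Rightarrow> com" where
  "sides_prog e = For 16 (V 0) (Store 3 (V 16) e)"

text \<open>The flagged end becomes the left end. A customer with both ends on one side gets budget
  0 instead of being removed, which keeps the numbering and excludes it from all positive
  offers.\<close>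

definition edge_prog :: com where
  "edge_prog = Seq (Set 16 (field 0)) (Seq (Set 17 (field 1)) (Seq (Set 24 (field 2 [*] Bin Div (V 3) (field 3)))
     (If (Arr 3 (V 16)) (Arr 3 (V 17)) (Seq (Set 22 (V 17)) (Set 23 (V 16)))
       (Seq (Set 22 (V 16)) (Seq (Set 23 (V 17)) (If (Arr 3 (V 17)) (Arr 3 (V 16)) Skip (Set 24 (Lit 0))))))))"

definition edges_prog :: com where
  "edges_prog = For 6 (V 1) (Seq edge_prog
     (Seq (Store 4 (V 6) (V 24)) (Seq (Store 4 (V 6 [+] V 1) (V 24))
     (Seq (Store 5 (V 6) (V 22)) (Seq (Store 5 (V 6 [+] V 1) (V 22 [+] V 0))
     (Seq (Store 6 (V 6) (V 23)) (Seq (Store 6 (V 6 [+] V 1) (V 23))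
     (Seq (Store 8 (V 6) (Lit 0)) (Store 8 (V 6 [+] V 1) (Lit 0))))))))))"

definition gap_prog :: com where
  "gap_prog = Seq (Set 20 (Arr 4 (V 7))) (For 8 (V 1)
     (If (Arr 4 (V 8)) (Arr 4 (V 7) [+] (Lit 1 [-] (V 7 [+] Lit 1 [-] V 8)))
       (If (Arr 4 (V 7) [-] Arr 4 (V 8)) (V 20) (Set 20 (Arr 4 (V 7) [-] Arr 4 (V 8))) Skip) Skip))"

definition gaps_prog :: com where
  "gaps_prog = For 7 (V 1) (Seq gap_prog (Store 7 (V 7) (V 20)))"

text \<open>The arrays are not empty at the start, as their cells overlap those of the raw input.
  Prices have to be cleared because the greedy program writes only those of vertices with a positive
  gain.\<close>

definition clear_prog :: com where
  "clear_prog = For 16 (V 18) (Store 9 (V 16) (Lit 0))"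

lemma touches_setup [simp]:
  "touches load_prog a i \<longleftrightarrow> a = 0 \<and> i \<in> {0, 1, 2, 18, 19, 63}"
  "touches denom_prog a i \<longleftrightarrow> a = 0 \<and> i \<in> {3, 6}"
  "touches (sides_prog e) a i \<longleftrightarrow> a = 0 \<and> i = 16 \<or> a = 3"
  "touches edge_prog a i \<longleftrightarrow> a = 0 \<and> i \<in> {16, 17, 22, 23, 24, 63}"
  "touches edges_prog a i \<longleftrightarrow> a = 0 \<and> i \<in> {6, 16, 17, 22, 23, 24, 63} \<or> a \<in> {4, 5, 6, 8}"
  "touches gap_prog a i \<longleftrightarrow> a = 0 \<and> i \<in> {8, 20, 63}"
  "touches gaps_prog a i \<longleftrightarrow> a = 0 \<and> i \<in> {7, 8, 20, 63} \<or> a = 7"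
  "touches clear_prog a i \<longleftrightarrow> a = 0 \<and> i = 16 \<or> a = 9"
  by (auto simp: load_prog_def denom_prog_def sides_prog_def edge_prog_def edges_prog_def
      gap_prog_def gaps_prog_def clear_prog_def)

lemma gap_0: "gap 0 B i = B i"
  by (simp add: gap_def)

text \<open>The recursion that the loop of \<open>gap_prog\<close> follows.\<close>

lemma gap_Suc: "gap (Suc j) B i = (if beats B i j then min (B i - B j) (gap j B i) else gap j B i)"
proof (cases "beats B i j")
  case True
  then have "insert (B i) {B i - B h | h. h < Suc j \<and> beats B i h} =
    insert (B i - B j) (insert (B i) {B i - B h | h. h < j \<and> beats B i h})"
    by (auto simp: less_Suc_eq)
  then show ?thesis using True by (simp add: gap_def)
next
  case False
  then have "{B i - B h | h. h < Suc j \<and> beats B i h} = {B i - B h | h. h < j \<and> beats B i h}"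
    by (auto simp: less_Suc_eq)
  then show ?thesis using False by (simp add: gap_def)
qed

text \<open>The instance as the programs see it: \<open>cap\<close> is the encoded capacity,
  \<open>flag\<close> the side of a vertex, and \<open>C\<close> bounds the budgets after scaling by
  the product of all denominators. For the general problem each outcome of the side coins gives one
  interpretation.\<close>

locale input =
  fixes n m cap C W k :: nat and us vs nums dens flag :: "nat \<Rightarrow> nat"
  assumes ends: "j < m \<Longrightarrow> us j < n \<and> vs j < n"
    and dens: "j < m \<Longrightarrow> 0 < dens j"
    and nums_le: "j < m \<Longrightarrow> nums j * (\<Prod>j<m. dens j) \<le> C"
    and fields_le: "j < m \<Longrightarrow> nums j \<le> W \<and> dens j \<le> W"
    and D_le: "(\<Prod>j<m. dens j) \<le> W" and cap_le: "cap \<le> W"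
    and linear_le: "8*(C + n + m) + 200 \<le> W" and k_ge: "2*n \<le> k" "2*m \<le> k"
    and flag_le: "v < n \<Longrightarrow> flag v \<le> 1"
begin

definition D :: nat where "D = (\<Prod>j<m. dens j)"
definition mu :: nat where "mu = (if cap = 0 then m else min (cap - 1) m)"
definition lft :: "nat \<Rightarrow> nat" where "lft j = (if flag (us j) < flag (vs j) then vs j else us j)"
definition rgt :: "nat \<Rightarrow> nat" where "rgt j = (if flag (us j) < flag (vs j) then us j else vs j)"
definition bud :: "nat \<Rightarrow> nat" where
  "bud j = (if flag (us j) = flag (vs j) then 0 else nums j * (D div dens j))"

definition raw :: "state \<Rightarrow> bool" where
  "raw s \<longleftrightarrow> s 1 1 = n \<and> s 1 2 = m \<and> s 1 4 = cap \<and>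
     (\<forall>j<m. s 1 (3 + n + 4*j) = us j \<and> s 1 (4 + n + 4*j) = vs j \<and>
        s 1 (5 + n + 4*j) = nums j \<and> s 1 (6 + n + 4*j) = dens j)"

definition loaded :: "state \<Rightarrow> bool" where
  "loaded s \<longleftrightarrow> raw s \<and> s 0 0 = n \<and> s 0 1 = m \<and> s 0 2 = mu \<and> s 0 18 = 2*n \<and> s 0 19 = 2*m"

lemma loaded_agree:
  assumes "agree c s s'" "loaded s" "\<And>i. \<not> touches c 1 i" "\<And>i. i \<in> {0, 1, 2, 18, 19} \<Longrightarrow> \<not> touches c 0 i"
  shows "loaded s'"
proof -
  have "s' 1 = s 1" by (rule agree_array[OF assms(1,3)])
  moreover have "s' 0 i = s 0 i" if "i \<in> {0, 1, 2, 18, 19}" for i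
    by (rule agreeD[OF assms(1)]) (use assms(4) that in auto)
  ultimately show ?thesis using assms(2) by (simp add: loaded_def raw_def)
qed

lemma loaded_upd: "loaded s \<Longrightarrow> i \<notin> {0, 1, 2, 18, 19} \<Longrightarrow> loaded (upd s 0 i x)"
  by (simp add: loaded_def raw_def)

lemma wp_load:
  assumes "raw s" and Q: "\<And>s'. agree load_prog s s' \<Longrightarrow> loaded s' \<Longrightarrow> Q s'"
  shows "wp W k load_prog Q s"
proof (rule wp_frame)
  note s = assms(1)[unfolded raw_def]
  have mu_eq: "cap = 0 \<Longrightarrow> mu = m" "m < cap - 1 \<Longrightarrow> mu = m" "0 < cap \<Longrightarrow> \<not> m < cap - 1 \<Longrightarrow> mu = cap - 1"
    unfolding mu_def by auto
  have fin: "Q u" if "agree load_prog s u" "u 1 = s 1" "u 0 0 = n" "u 0 1 = m" "u 0 18 = 2*n" "u 0 19 = 2*m"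
    "u 0 2 = mu" for u
    by (rule Q[OF that(1)]) (use s that in \<open>simp add: loaded_def raw_def\<close>)
  define t where "t = upd (upd (upd (upd s 0 0 n) 0 1 m) 0 18 (2*n)) 0 19 (2*m)"
  have t: "t 1 = s 1" "t 0 0 = n" "t 0 1 = m" "t 0 18 = 2*n" "t 0 19 = 2*m" by (simp_all add: t_def)
  have "wp W k (Seq (If (Lit 0) (Arr 1 (Lit 4)) (Set 2 (Arr 1 (Lit 4) [-] Lit 1)) (Set 2 (V 1)))
          (If (V 1) (V 2) (Set 2 (V 1)) Skip)) (\<lambda>s'. agree load_prog s s' \<longrightarrow> Q s') t"
    using s t cap_le linear_le mu_eq order_trans[OF diff_le_self[of cap 1] cap_le] by (simp add: wp_simps fin)
  then show "wp W k load_prog (\<lambda>s'. agree load_prog s s' \<longrightarrow> Q s') s"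
    using s linear_le unfolding load_prog_def t_def by (simp add: wp_Seq wp_Store)
qed

lemma prod_dens_le:
  assumes "j \<le> m" shows "(\<Prod>f<j. dens f) \<le> D"
  unfolding D_def
proof (rule dvd_imp_le)
  show "(\<Prod>f<j. dens f) dvd (\<Prod>f<m. dens f)" by (rule prod_dvd_prod_subset) (use assms in auto)
qed (use dens in \<open>auto intro: prod_pos\<close>)

lemma wp_denom:
  assumes "loaded s" and Q: "\<And>s'. agree denom_prog s s' \<Longrightarrow> s' 0 3 = D \<Longrightarrow> Q s'"
  shows "wp W k denom_prog Q s"
proof (rule wp_frame)
  note s = assms(1)[unfolded loaded_def raw_def]
  show "wp W k denom_prog (\<lambda>s'. agree denom_prog s s' \<longrightarrow> Q s') s"
    unfolding denom_prog_def wp_Seq wp_Store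
  proof (intro conjI wp_For[where I = "\<lambda>j s'. s' 0 3 = (\<Prod>f<j. dens f)"], goal_cases)
    case (6 j s')
    then have j: "j < m" using s by simp
    have l: "loaded (upd s 0 (val (Lit 3) s) (val (Lit 1) s))" using assms(1) by (simp add: loaded_upd)
    have "loaded s'" by (rule loaded_agree[OF 6(2) l]) auto
    note s' = this[unfolded loaded_def raw_def]
    have "s' 1 (6 + n + 4*j) = dens j" using s' j by simp
    moreover have "(\<Prod>f<j. dens f) \<le> W" "(\<Prod>f<j. dens f) * dens j \<le> W"
      using prod_dens_le[of j] prod_dens_le[of "Suc j"] D_le j by (auto simp: D_def)
    ultimately show ?case
      using s' 6(3) j linear_le fields_le[OF j] by (simp add: wp_simps mult.commute)
  next
    case (7 s')
    then show ?case using s by (intro impI Q) (simp_all add: D_def denom_prog_def)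
  qed (use s linear_le k_ge in auto)
qed

lemma wp_sides:
  assumes "loaded s"
    and src: "\<And>v s'. v < n \<Longrightarrow> loaded s' \<Longrightarrow> s' 0 16 = v \<Longrightarrow> s' 1 = s 1 \<Longrightarrow> s' 2 = s 2 \<Longrightarrow>
       bounded_exp W e s' \<and> val e s' = flag v"
    and Q: "\<And>s'. agree (sides_prog e) s s' \<Longrightarrow> (\<forall>v<n. s' 3 v = flag v) \<Longrightarrow> Q s'"
  shows "wp W k (sides_prog e) Q s"
proof (rule wp_frame)
  note s = assms(1)[unfolded loaded_def raw_def]
  show "wp W k (sides_prog e) (\<lambda>s'. agree (sides_prog e) s s' \<longrightarrow> Q s') s"
    unfolding sides_prog_def
  proof (rule wp_For[where I = "\<lambda>j s'. \<forall>v<j. s' 3 v = flag v"], goal_cases)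
    case (4 v s')
    then have v: "v < n" using s by simp
    have "loaded s'" by (rule loaded_agree[OF 4(2) assms(1)]) auto
    then have "loaded (upd s' 0 16 v)" by (simp add: loaded_upd)
    from src[OF v this] have "bounded_exp W e (upd s' 0 16 v)" "val e (upd s' 0 16 v) = flag v"
      using agree_array[OF 4(2)] by simp_all
    then show ?case using 4(3) v linear_le by (auto simp: wp_simps less_Suc_eq upd_apply)
  next
    case (5 s')
    then show ?case using s by (intro impI Q) (simp_all add: sides_prog_def)
  qed (use s linear_le k_ge in auto)
qed

lemma wp_edge:
  assumes "loaded s" "s 0 3 = D" "\<forall>v<n. s 3 v = flag v" "s 0 6 < m"
    and Q: "\<And>s'. agree edge_prog s s' \<Longrightarrow> s' 0 22 = lft (s 0 6) \<Longrightarrow> s' 0 23 = rgt (s 0 6) \<Longrightarrow>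
      s' 0 24 = bud (s 0 6) \<Longrightarrow> Q s'"
  shows "wp W k edge_prog Q s"
proof (rule wp_frame)
  let ?j = "s 0 6"
  note s = assms(1)[unfolded loaded_def raw_def]
  have fields: "s 1 (3 + n + 4*?j) = us ?j" "s 1 (4 + n + 4*?j) = vs ?j"
        "s 1 (5 + n + 4*?j) = nums ?j" "s 1 (6 + n + 4*?j) = dens ?j" using s assms(4) by auto
  have ends': "us ?j < n" "vs ?j < n" using ends[OF assms(4)] by auto
  have flags: "s 3 (us ?j) = flag (us ?j)" "s 3 (vs ?j) = flag (vs ?j)" using assms(3) ends' by auto
  have "nums ?j * (D div dens ?j) \<le> nums ?j * D" by (intro mult_le_mono) auto
  also have "\<dots> \<le> C" using nums_le[OF assms(4)] by (simp add: D_def)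
  finally have "nums ?j * (D div dens ?j) \<le> C" .
  moreover have D: "D \<le> W" using D_le by (simp add: D_def)
  moreover have "D div dens ?j \<le> W" by (rule order_trans[OF div_le_dividend D])
  ultimately have b: "nums ?j * (D div dens ?j) \<le> W" "D div dens ?j \<le> W" "D \<le> W"
    using linear_le by simp_all
  define t where "t = upd (upd (upd s 0 16 (us ?j)) 0 17 (vs ?j)) 0 24 (nums ?j * (D div dens ?j))"
  have t: "t 3 = s 3" "t 0 16 = us ?j" "t 0 17 = vs ?j" "t 0 24 = nums ?j * (D div dens ?j)"
    by (simp_all add: t_def)
  have "wp W k (If (Arr 3 (V 16)) (Arr 3 (V 17)) (Seq (Set 22 (V 17)) (Set 23 (V 16)))
       (Seq (Set 22 (V 16)) (Seq (Set 23 (V 17)) (If (Arr 3 (V 17)) (Arr 3 (V 16)) Skip (Set 24 (Lit 0))))))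
     (\<lambda>s'. agree edge_prog s s' \<longrightarrow> Q s') t"
    using t flags ends' flag_le[of "us ?j"] flag_le[of "vs ?j"] linear_le
    by (auto simp: wp_simps lft_def rgt_def bud_def intro!: Q)
  then show "wp W k edge_prog (\<lambda>s'. agree edge_prog s s' \<longrightarrow> Q s') s"
    using s fields assms(2,4) b ends' linear_le fields_le[OF assms(4)] unfolding edge_prog_def t_def
    by (simp add: wp_Seq wp_Store)
qed

lemma bud_le: assumes "j < m" shows "bud j \<le> C"
proof -
  have "nums j * (D div dens j) \<le> nums j * D" by (intro mult_le_mono) auto
  also have "\<dots> \<le> C" using nums_le[OF assms] by (simp add: D_def)
  finally show ?thesis by (simp add: bud_def)
qed

lemma lft_rgt: "j < m \<Longrightarrow> lft j < n \<and> rgt j < n"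
  using ends by (auto simp: lft_def rgt_def)

definition copied :: "nat \<Rightarrow> state \<Rightarrow> bool" where
  "copied i s \<longleftrightarrow> (\<forall>j<i. s 4 j = bud j \<and> s 4 (j + m) = bud j \<and> s 5 j = lft j \<and> s 5 (j + m) = lft j + n \<and>
     s 6 j = rgt j \<and> s 6 (j + m) = rgt j \<and> s 8 j = 0 \<and> s 8 (j + m) = 0)"

lemma wp_edges:
  assumes "loaded s" "s 0 3 = D" "\<forall>v<n. s 3 v = flag v"
    and Q: "\<And>s'. agree edges_prog s s' \<Longrightarrow> copied m s' \<Longrightarrow> Q s'"
  shows "wp W k edges_prog Q s"
proof (rule wp_frame)
  note s = assms(1)[unfolded loaded_def raw_def]
  show "wp W k edges_prog (\<lambda>s'. agree edges_prog s s' \<longrightarrow> Q s') s"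
    unfolding edges_prog_def
  proof (rule wp_For[where I = copied], goal_cases)
    case (4 j s')
    then have j: "j < m" using s by simp
    have "loaded s'" by (rule loaded_agree[OF 4(2) assms(1)]) auto
    then have l: "loaded (upd s' 0 6 j)" by (simp add: loaded_upd)
    have s': "s' 3 = s 3" "s' 0 3 = D"
      using agree_array[OF 4(2)] agreeD[OF 4(2)] assms(2) by simp_all
    show ?case
      unfolding wp_Seq[of W k edge_prog]
    proof (rule wp_edge[OF l], goal_cases)
      case (4 z)
      have "loaded z" by (rule loaded_agree[OF 4(1) l]) auto
      note z = this[unfolded loaded_def]
      have z': "z 0 6 = j" "z 4 = s' 4" "z 5 = s' 5" "z 6 = s' 6" "z 8 = s' 8"
        using agreeD[OF 4(1)] agree_array[OF 4(1)] by simp_all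
      have v: "z 0 22 = lft j" "z 0 23 = rgt j" "z 0 24 = bud j" using 4 by simp_all
      let ?z = "upd (upd (upd (upd (upd (upd (upd (upd z 4 j (bud j)) 4 (j + m) (bud j)) 5 j (lft j)) 5 (j + m) (lft j + n))
        6 j (rgt j)) 6 (j + m) (rgt j)) 8 j 0) 8 (j + m) 0"
      have "copied (Suc j) ?z"
        using \<open>copied j s'\<close> z' j by (auto simp: copied_def less_Suc_eq upd_apply)
      then show ?case
        using z z' v linear_le bud_le[OF j] lft_rgt[OF j] j by (simp add: wp_simps)
    qed (use s' j assms(3) in auto)
  next
    case (5 s')
    then show ?case using s by (intro impI Q) (simp_all add: edges_prog_def)
  qed (use s linear_le k_ge in \<open>auto simp: copied_def\<close>)
qed

lemma wp_gap:
  assumes "loaded s" "s 0 7 < m" "\<forall>j<m. s 4 j \<le> C"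
    and Q: "\<And>s'. agree gap_prog s s' \<Longrightarrow> s' 0 20 = gap m (s 4) (s 0 7) \<Longrightarrow> Q s'"
  shows "wp W k gap_prog Q s"
proof (rule wp_frame)
  let ?i = "s 0 7"
  note s = assms(1)[unfolded loaded_def raw_def]
  show "wp W k gap_prog (\<lambda>s'. agree gap_prog s s' \<longrightarrow> Q s') s"
    unfolding gap_prog_def wp_Seq wp_Store
  proof (intro conjI wp_For[where I = "\<lambda>j s'. s' 0 20 = gap j (s 4) ?i"], goal_cases)
    case (6 j s')
    then have j: "j < m" using s by simp
    have s': "s' 0 7 = ?i" "s' 4 = s 4"
      using agree_array[OF 6(2)] agreeD[OF 6(2)] by simp_all
    have "s 4 j \<le> C" "s 4 ?i \<le> C" using assms(2,3) j by auto
    moreover have "gap j (s 4) ?i \<le> s 4 ?i" by (rule gap_le)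
    ultimately show ?case
      using 6(3) s' j assms(2) linear_le
      by (auto simp: wp_simps less_test gap_Suc beats_def)
  next
    case (7 s')
    then show ?case using s by (intro impI Q) (simp_all add: gap_prog_def)
  next
    case 5
    then show ?case by (simp add: gap_0)
  next
    case 2
    then show ?case using assms(2,3) linear_le by force
  qed (use s linear_le k_ge in auto)
qed

lemma wp_gaps:
  assumes "loaded s" "\<forall>j<m. s 4 j \<le> C"
    and Q: "\<And>s'. agree gaps_prog s s' \<Longrightarrow> (\<forall>i<m. s' 7 i = gap m (s 4) i) \<Longrightarrow> Q s'"
  shows "wp W k gaps_prog Q s"
proof (rule wp_frame)
  note s = assms(1)[unfolded loaded_def raw_def]
  show "wp W k gaps_prog (\<lambda>s'. agree gaps_prog s s' \<longrightarrow> Q s') s"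
    unfolding gaps_prog_def
  proof (rule wp_For[where I = "\<lambda>j s'. \<forall>i<j. s' 7 i = gap m (s 4) i"], goal_cases)
    case (4 j s')
    then have j: "j < m" using s by simp
    have "loaded s'" by (rule loaded_agree[OF 4(2) assms(1)]) auto
    then have l: "loaded (upd s' 0 7 j)" by (simp add: loaded_upd)
    have s': "s' 4 = s 4" using agree_array[OF 4(2)] by simp
    show ?case unfolding wp_Seq
    proof (rule wp_gap[OF l], goal_cases)
      case (3 z)
      have "z 0 7 = j" "z 7 = s' 7" "z 0 20 = gap m (s 4) j"
        using agreeD[OF 3(1)] agree_array[OF 3(1)] 3(2) s' by simp_all
      moreover have "gap m (s 4) j \<le> C" using gap_le[of m "s 4" j] assms(2) j by (meson order_trans)
      ultimately show ?case using 4(3) j linear_le by (auto simp: wp_simps less_Suc_eq upd_apply)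
    qed (use j s' assms(2) in auto)
  next
    case (5 s')
    then show ?case using s by (intro impI Q) (simp_all add: gaps_prog_def)
  qed (use s linear_le k_ge in auto)
qed

lemma wp_clear:
  assumes "loaded s" and Q: "\<And>s'. agree clear_prog s s' \<Longrightarrow> (\<forall>u<2*n. s' 9 u = 0) \<Longrightarrow> Q s'"
  shows "wp W k clear_prog Q s"
proof (rule wp_frame)
  note s = assms(1)[unfolded loaded_def raw_def]
  show "wp W k clear_prog (\<lambda>s'. agree clear_prog s s' \<longrightarrow> Q s') s"
    unfolding clear_prog_def
  proof (rule wp_For[where I = "\<lambda>j s'. \<forall>u<j. s' 9 u = 0"], goal_cases)
    case (4 j s')
    then show ?case using s linear_le by (auto simp: wp_simps less_Suc_eq upd_apply)
  next
    case (5 s')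
    then show ?case using s by (intro impI Q) (simp_all add: clear_prog_def)
  qed (use s linear_le k_ge in auto)
qed

end

definition setup_prog :: com where
  "setup_prog = Seq edges_prog (Seq gaps_prog (Seq clear_prog (If (Lit 0) (V 2) greedy_prog Skip)))"

definition main_prog :: "exp \<Rightarrow> com" where
  "main_prog e = Seq load_prog (Seq denom_prog (Seq (sides_prog e) (Seq setup_prog final_prog)))"

fun reads_exp :: "exp \<Rightarrow> nat \<Rightarrow> bool" where
  "reads_exp (Lit c) b \<longleftrightarrow> False"
| "reads_exp (Arr a e) b \<longleftrightarrow> a = b \<or> reads_exp e b"
| "reads_exp (Bin f e1 e2) b \<longleftrightarrow> reads_exp e1 b \<or> reads_exp e2 b"

text \<open>Unlike \<open>touches\<close> this also counts reads: a command that does not use array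
  \<open>b\<close> commutes with replacing the contents of \<open>b\<close>.\<close>

primrec uses :: "com \<Rightarrow> nat \<Rightarrow> bool" where
  "uses (Store a e1 e2) b \<longleftrightarrow> a = b \<or> reads_exp e1 b \<or> reads_exp e2 b"
| "uses (Seq c1 c2) b \<longleftrightarrow> uses c1 b \<or> uses c2 b"
| "uses (If e1 e2 c1 c2) b \<longleftrightarrow> reads_exp e1 b \<or> reads_exp e2 b \<or> uses c1 b \<or> uses c2 b"
| "uses (For x e c) b \<longleftrightarrow> b = 0 \<or> reads_exp e b \<or> uses c b"

lemma val_unused: "\<not> reads_exp e b \<Longrightarrow> val e (s(b := g)) = val e s"
  by (induction e) auto

lemma upd_unused: "a \<noteq> b \<Longrightarrow> upd (s(b := g)) a i v = (upd s a i v)(b := g)"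
  by (auto simp: upd_def fun_upd_twist)

lemma exec_unused: "\<not> uses c b \<Longrightarrow> exec c (s(b := g)) = (exec c s)(b := g)"
proof (induction c arbitrary: s)
  case (For x e c)
  have b: "0 \<noteq> b" "\<not> reads_exp e b" "\<not> uses c b" using For.prems by auto
  have "fold (\<lambda>i s. exec c (upd s 0 x i)) xs (t(b := g)) = (fold (\<lambda>i s. exec c (upd s 0 x i)) xs t)(b := g)" for xs t
  proof (induction xs arbitrary: t)
    case (Cons i xs)
    show ?case by (simp only: fold_simps upd_unused[OF b(1)] For.IH[OF b(3)] Cons.IH)
  qed simp
  then show ?case by (simp only: exec.simps val_unused[OF b(2)])
qed (simp_all add: val_unused upd_unused)

text \<open>This allows averaging over the coins of the final rounding with the half-offers fixed.\<close>

lemma exec_main_independent: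
  assumes e: "\<And>t. t 2 = s 2 \<Longrightarrow> t 0 0 = s 1 1 \<Longrightarrow> t 0 16 < t 0 0 \<Longrightarrow> val e (t(2 := g)) = val e t"
    and a: "a \<in> {4, 5, 6, 7, 8, 9}"
  shows "exec (main_prog e) (s(2 := g)) a = exec (main_prog e) s a"
proof -
  define s2 where "s2 = exec denom_prog (exec load_prog s)"
  have "\<not> uses load_prog 2" "\<not> uses denom_prog 2" by (simp_all add: load_prog_def denom_prog_def)
  then have s2: "exec denom_prog (exec load_prog (s(2 := g))) = s2(2 := g)"
    by (simp add: exec_unused s2_def)
  have "exec load_prog s 0 0 = s 1 1" "exec load_prog s 2 = s 2"
    using agree_array[OF agree_exec[of load_prog s], of 2] by (simp_all add: load_prog_def)
  then have n: "s2 0 0 = s 1 1" "s2 2 = s 2"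
    using agreeD[OF agree_exec[of denom_prog "exec load_prog s"], of 0 0]
      agree_array[OF agree_exec[of denom_prog "exec load_prog s"], of 2] by (simp_all add: s2_def)
  let ?f = "\<lambda>i s. exec (Store 3 (V 16) e) (upd s 0 16 i)"
  have loop: "fold ?f [0..<j] (s2(2 := g)) = (fold ?f [0..<j] s2)(2 := g) \<and>
      fold ?f [0..<j] s2 2 = s 2 \<and> fold ?f [0..<j] s2 0 0 = s 1 1" if "j \<le> s 1 1" for j
    using that
  proof (induction j)
    case (Suc j)
    let ?t = "fold ?f [0..<j] s2"
    note IH = conjunct1[OF Suc.IH[OF Suc_leD[OF Suc.prems]]]
      and rest = conjunct2[OF Suc.IH[OF Suc_leD[OF Suc.prems]]]
    have v: "val e ((upd ?t 0 16 j)(2 := g)) = val e (upd ?t 0 16 j)"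
      by (rule e) (use rest Suc.prems in simp_all)
    have "upd (t(2 := g)) 0 i y = (upd t 0 i y)(2 := g)" "upd (t(2 := g)) 3 i y = (upd t 3 i y)(2 := g)" for t i y
      by (simp_all add: upd_unused)
    then have "?f j (?t(2 := g)) = (?f j ?t)(2 := g)"
      using v by (simp only: exec.simps val.simps fun_upd_other upd_same)
    then show ?case using rest unfolding fold_upt_Suc IH by simp
  qed (use n in simp)
  have "exec (sides_prog e) (s2(2 := g)) = (exec (sides_prog e) s2)(2 := g)"
    using loop[of "s 1 1"] n by (simp add: sides_prog_def)
  \<comment> \<open>Between the sides and the final part nothing reads the coins, and the final part
    leaves arrays 4 to 9 alone.\<close>
  moreover have "\<not> uses setup_prog 2"
    by (simp add: setup_prog_def edges_prog_def edge_prog_def gaps_prog_def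
    gap_prog_def clear_prog_def greedy_prog_def search_prog_def pick_prog_def eval_prog_def gains_prog_def gain_prog_def
    weight_prog_def choose_prog_def rank_prog_def)
  ultimately have "exec setup_prog (exec (sides_prog e) (s2(2 := g))) = (exec setup_prog (exec (sides_prog e) s2))(2 := g)"
    by (simp add: exec_unused)
  moreover have "exec final_prog t a = t a" for t
    by (rule agree_array[OF agree_exec]) (use a in auto)
  ultimately show ?thesis using a by (auto simp: main_prog_def s2 s2_def[symmetric])
qed

context input
begin

text \<open>The postcondition of the whole program, with \<open>\<omega>\<close> as the rounding
  coins. The case \<open>mu = 0\<close> is separate because \<open>market\<close> requires a
  positive capacity.\<close>

definition outcome :: "(nat \<Rightarrow> bool) \<Rightarrow> state \<Rightarrow> bool" where
  "outcome \<omega> s \<longleftrightarrow>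
     (\<forall>j<m. s 5 j = lft j \<and> s 6 j = rgt j \<and> s 4 j = bud j) \<and>
     (if mu = 0 then \<forall>u<2*n. s 9 u = 0
      else market m n mu (s 5) (s 6) (s 4) (s 7) \<and> market.reach m n mu (s 5) (s 6) (s 4) (s 7) (2*n) (s 8) (s 9)) \<and>
     (\<forall>u<2*n. s 9 u \<le> C) \<and>
     (\<forall>v<n. s 13 (2 * v) = s 9 (if \<omega> v then v + n else v) \<and> s 13 (2 * v + 1) = D) \<and>
     (\<forall>j<m. s 13 (2*n + j) = of_bool (0 < s 8 (if \<omega> (s 5 j) then j + m else j) \<and>
         rank {f. f < m \<and> s 6 f = s 6 j} (\<lambda>j. s 8 (if \<omega> (s 5 j) then j + m else j)) j < mu))"

text \<open>The parts in sequence. The word bound has \<open>m\<close> in place of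
  \<open>mu\<close>, which is legitimate by \<open>mu \<le> m\<close>.\<close>

lemma wp_main:
  assumes "raw s" and two: "2 \<le> n" and coin: "\<forall>v<n. s 2 v = of_bool (\<omega> v)"
    and simple: "\<And>i j. i < m \<Longrightarrow> j < m \<Longrightarrow> {us i, vs i} = {us j, vs j} \<Longrightarrow> i = j"
    and W_ge: "(2*m*(m*C) + 1) * (2*m)^(2*m) + 16*(C + n + m) + 200 \<le> W"
    and src: "\<And>v s'. v < n \<Longrightarrow> loaded s' \<Longrightarrow> s' 0 16 = v \<Longrightarrow> s' 1 = s 1 \<Longrightarrow> s' 2 = s 2 \<Longrightarrow>
       bounded_exp W e s' \<and> val e s' = flag v"
    and Q: "\<And>s'. outcome \<omega> s' \<Longrightarrow> s' 0 25 = 2*n + m \<Longrightarrow> s' 13 (2*n + m) = s' 13 0 \<Longrightarrow>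
      s' 13 (2*n + m + 1) = s' 13 2 \<Longrightarrow> s' 13 (2*n + m + 2) = s' 13 1 \<Longrightarrow> Q s'"
  shows "wp W k (main_prog e) Q s"
  unfolding main_prog_def setup_prog_def wp_Seq
proof (rule wp_load[OF assms(1)], goal_cases)
  case (1 s1)
  note l1 = 1(2)
  have e1: "s1 1 = s 1" "s1 2 = s 2" using agree_array[OF 1(1)] by simp_all
  show ?case
  proof (rule wp_denom[OF l1], goal_cases)
    case (1 s2)
    have l2: "loaded s2" by (rule loaded_agree[OF 1(1) l1]) auto
    have e2: "s2 1 = s 1" "s2 2 = s 2" "s2 0 3 = D" using agree_array[OF 1(1)] e1 1(2) by simp_all
    show ?case
    proof (rule wp_sides[OF l2], goal_cases)
      case (1 v s')
      then show ?case using src[of v s'] e2 by simp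
    next
      case (2 s3)
      have l3: "loaded s3" by (rule loaded_agree[OF 2(1) l2]) auto
      have e3: "s3 2 = s 2" "s3 0 3 = D" using agree_array[OF 2(1)] agreeD[OF 2(1)] e2 by simp_all
      show ?case
      proof (rule wp_edges[OF l3 e3(2) 2(2)], goal_cases)
        case (1 s4)
        have l4: "loaded s4" by (rule loaded_agree[OF 1(1) l3]) auto
        have e4: "s4 2 = s 2" "s4 0 3 = D" using agree_array[OF 1(1)] agreeD[OF 1(1)] e3 by simp_all
        note c4 = 1(2)[unfolded copied_def]
        show ?case
        proof (rule wp_gaps[OF l4], goal_cases)
          case 1
          then show ?case using c4 bud_le by auto
        next
          case (2 s5)
          have l5: "loaded s5" by (rule loaded_agree[OF 2(1) l4]) auto
          have e5: "s5 2 = s 2" "s5 0 3 = D" "s5 4 = s4 4" "s5 5 = s4 5" "s5 6 = s4 6" "s5 8 = s4 8"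
            using agree_array[OF 2(1)] agreeD[OF 2(1)] e4 by simp_all
          note gap5 = 2(2)
          show ?case
          proof (rule wp_clear[OF l5], goal_cases)
            case (1 s6)
            have l6: "loaded s6" by (rule loaded_agree[OF 1(1) l5]) auto
            have e6: "s6 2 = s 2" "s6 0 3 = D" "s6 4 = s4 4" "s6 5 = s4 5" "s6 6 = s4 6" "s6 8 = s4 8" "s6 7 = s5 7"
              using agree_array[OF 1(1)] agreeD[OF 1(1)] e5 by simp_all
            note p6 = 1(2)
            have c6: "copied m s6" using c4 e6 by (simp add: copied_def)
            have lo: "s6 4 j = bud j" "s6 5 j = lft j" "s6 6 j = rgt j" "s6 8 j = 0"
              and hi: "s6 4 (j + m) = bud j" "s6 5 (j + m) = lft j + n" "s6 6 (j + m) = rgt j" "s6 8 (j + m) = 0"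
              if "j < m" for j using c6 that by (simp_all add: copied_def)
            have split: "\<exists>j<m. e = j \<or> e = j + m" if "e < 2*m" for e
              using that by (cases "e < m") (auto intro!: exI[of _ "e - m"])
            have mu_le: "mu \<le> m" by (simp add: mu_def)
            have zero8: "\<forall>e<2*m. s6 8 e = 0" using split lo hi by metis
            \<comment> \<open>Common to both cases below: \<open>t\<close> is the state after the
              greedy program, or after its omission when \<open>mu = 0\<close>.\<close>
            have finish: "wp W k final_prog Q t"
              if t: "loaded t" "t 2 = s 2" "t 0 3 = D" "t 4 = s6 4" "t 5 = s6 5" "t 6 = s6 6"
                and A: "\<forall>e<2*m. t 8 e \<le> C" "\<forall>u<2*n. t 9 u \<le> C"
                and "if mu = 0 then \<forall>u<2*n. t 9 u = 0 else market m n mu (t 5) (t 6) (t 4) (t 7) \<and>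
                  market.reach m n mu (t 5) (t 6) (t 4) (t 7) (2*n) (t 8) (t 9)" for t
            proof (rule wp_frame, rule wp_final)
              show "finals n m mu C W k D t"
                using t A coin lo lft_rgt two D_le linear_le mu_le k_ge W_ge
                by (auto simp: finals_def loaded_def D_def less_imp_le)
            next
              fix s' :: state
              assume out: "\<forall>v<n. s' 13 (2 * v) = t 9 (if 0 < t 2 v then v + n else v) \<and> s' 13 (2 * v + 1) = D"
                "\<forall>j<m. s' 13 (2*n + j) = of_bool (0 < final_offer m t j \<and>
                   rank {f. f < m \<and> t 6 f = t 6 j} (final_offer m t) j < mu)"
                "s' 0 25 = 2*n + m" "s' 13 (2*n + m) = s' 13 0" "s' 13 (2*n + m + 1) = s' 13 2"
                "s' 13 (2*n + m + 2) = s' 13 1"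
              have offer: "final_offer m t j = t 8 (if \<omega> (t 5 j) then j + m else j)" if "j < m" for j
                using that coin t lo lft_rgt by (simp add: final_offer_def)
              have ranks: "rank {f. f < m \<and> t 6 f = t 6 j} (final_offer m t) j =
                rank {f. f < m \<and> t 6 f = t 6 j} (\<lambda>j. t 8 (if \<omega> (t 5 j) then j + m else j)) j" if "j < m" for j
                by (rule rank_cong) (use offer that in auto)
              show "agree final_prog t s' \<longrightarrow> Q s'"
              proof
                assume agree: "agree final_prog t s'"
                have same: "s' 4 = t 4" "s' 5 = t 5" "s' 6 = t 6" "s' 7 = t 7" "s' 8 = t 8" "s' 9 = t 9"
                  using agree_array[OF agree] by simp_all
                have "outcome \<omega> s'"
                  unfolding outcome_def same
                proof (intro conjI)
                  show "\<forall>j<m. t 5 j = lft j \<and> t 6 j = rgt j \<and> t 4 j = bud j" using t lo by simp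
                  show "\<forall>v<n. s' 13 (2 * v) = t 9 (if \<omega> v then v + n else v) \<and> s' 13 (2 * v + 1) = D"
                    using out(1) t coin by simp
                  show "\<forall>j<m. s' 13 (2*n + j) = of_bool (0 < t 8 (if \<omega> (t 5 j) then j + m else j) \<and>
                     rank {f. f < m \<and> t 6 f = t 6 j} (\<lambda>j. t 8 (if \<omega> (t 5 j) then j + m else j)) j < mu)"
                    using out(2) offer ranks by simp
                qed (rule that(9), rule A(2))
                then show "Q s'" by (rule Q) (use out in auto)
              qed
            qed
            show ?case
            proof (cases "mu = 0")
              case True
              let ?t = "upd s6 0 63 0"
              have "wp W k final_prog Q ?t"
                by (rule finish) (use l6 loaded_upd True p6 zero8 e6 in simp_all)
              then show ?thesis using l6 True linear_le by (simp add: wp_Seq wp_If wp_Store loaded_def)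
            next
              case False
              have mkt: "market m n mu (s6 5) (s6 6) (s6 4) (s6 7)"
              proof
                show "0 < mu" using False by simp
                have inj0: "i = j" if "i < m" "j < m" "lft i = lft j" "rgt i = rgt j" for i j
                proof (rule simple[OF that(1,2)])
                  have "{us i, vs i} = {lft i, rgt i}" "{us j, vs j} = {lft j, rgt j}" by (auto simp: lft_def rgt_def)
                  then show "{us i, vs i} = {us j, vs j}" using that by simp
                qed
                fix e f assume ef: "e < 2*m" "f < 2*m" "s6 5 e = s6 5 f" "s6 6 e = s6 6 f"
                obtain i j where ij: "i < m" "e = i \<or> e = i + m" "j < m" "f = j \<or> f = j + m"
                  using split ef by blast
                \<comment> \<open>Originals have left ends below \<open>n\<close> and copies from
                  \<open>n\<close> on, so equal left ends mean that both edges are originals or both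
                  are copies.\<close>
                have "lft i < n" "lft j < n" using lft_rgt ij by auto
                then have "i = j \<and> (e = i \<longleftrightarrow> f = j)"
                  using ij ef(3,4) lo[OF ij(1)] lo[OF ij(3)] hi[OF ij(1)] hi[OF ij(3)] inj0[OF ij(1,3)] by auto
                then show "e = f" using ij by auto
              next
                fix i assume i: "i < m"
                have "s6 7 j = gap m (s6 4) j" if "j < m" for j using gap5 e6 e5 that by simp
                then have "(\<Sum>h | h < m \<and> s6 4 h \<le> s6 4 i. s6 7 h) = (\<Sum>h | h < m \<and> s6 4 h \<le> s6 4 i. gap m (s6 4) h)"
                  by (intro sum.cong) auto
                then show "(\<Sum>h | h < m \<and> s6 4 h \<le> s6 4 i. s6 7 h) = s6 4 i" using sum_gap[OF i] by simp
              qed (use lo hi lft_rgt in auto)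
              have bounded: "bounded_market m n mu (s6 5) (s6 6) (s6 4) (s6 7) W k C"
              proof (intro bounded_market.intro mkt bounded_market_axioms.intro)
                show "s6 4 e \<le> C" if "e < 2*m" for e using split[OF that] lo hi bud_le by auto
                show "s6 6 e \<le> n" if "e < 2*m" for e using split[OF that] lo hi lft_rgt by (auto simp: less_imp_le)
                have "(2*m*(m*C) + 1) * (2*mu)^(2*m) \<le> (2*m*(m*C) + 1) * (2*m)^(2*m)"
                  using mu_le by (intro mult_le_mono power_mono) auto
                then show "(2*m*(m*C) + 1) * (2*mu)^(2*m) + 8*(C + n + m + mu) + 100 \<le> W"
                  using W_ge mu_le by simp
              qed (use k_ge in auto)
              have "wp W k greedy_prog (wp W k final_prog Q) s6"
              proof (rule bounded_market.wp_greedy[OF bounded], goal_cases)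
                case 1
                then show ?case
                  using l6 zero8 unfolding bounded_market.ready_def[OF bounded] loaded_def by simp
              next
                case (4 t)
                have lt: "loaded t" by (rule loaded_agree[OF 4(1) l6]) auto
                have et: "t 2 = s 2" "t 0 3 = D" "t 4 = s6 4" "t 5 = s6 5" "t 6 = s6 6" "t 7 = s6 7"
                  using agree_array[OF 4(1)] agreeD[OF 4(1)] e6 by simp_all
                note facts = market.reach_facts[OF mkt 4(2)]
                have "t 8 e \<le> C" if "e < 2*m" for e
                  using facts that bounded_market.B_le[OF bounded that] by fastforce
                moreover have "t 9 u \<le> C" if "u < 2*n" for u
                  using facts that bounded_market.B_le[OF bounded] by (cases "t 9 u = 0") auto
                ultimately show ?case
                  using mkt 4(2) False by (intro finish lt et) (simp_all add: et)
              qed (use zero8 p6 in auto)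
              then show ?thesis using l6 False linear_le mu_le by (simp add: wp_Seq wp_If wp_Store loaded_def)
            qed
          qed
        qed
      qed
    qed
  qed
qed

end

lemma wf_main: "wf_exp e \<Longrightarrow> wf_com (main_prog e)"
  by (simp add: main_prog_def setup_prog_def load_prog_def denom_prog_def sides_prog_def edges_prog_def edge_prog_def gaps_prog_def
    gap_prog_def clear_prog_def greedy_prog_def search_prog_def pick_prog_def eval_prog_def gains_prog_def gain_prog_def
    weight_prog_def choose_prog_def rank_prog_def final_prog_def offers_prog_def sell_prog_def rival_prog_def
    prices_prog_def repeat_prog_def)

lemma temps_main: "temps_exp e \<le> 10 \<Longrightarrow> temps (main_prog e) \<le> base"
  by (simp add: main_prog_def setup_prog_def load_prog_def denom_prog_def sides_prog_def edges_prog_def edge_prog_def gaps_prog_def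
    gap_prog_def clear_prog_def greedy_prog_def search_prog_def pick_prog_def eval_prog_def gains_prog_def gain_prog_def
    weight_prog_def choose_prog_def rank_prog_def final_prog_def offers_prog_def sell_prog_def rival_prog_def
    prices_prog_def repeat_prog_def)


section \<open>The complete machine\<close>

text \<open>With fewer than two vertices the only possible price, in cell 0, is set to 0 and the
  machine stops. Otherwise the input is copied from its last cell downward, to addresses above all
  cells still to be read. Cell 3 is the pointer of this loop, so input 3 is lost. Then
  \<open>2 * n\<close> coins fill array 2.\<close>

definition entry_code :: "nat \<Rightarrow> instr list" where
  "entry_code stop =
     [IfLess (Const 1) (At (Cell 1)) 3,
      Arith Plus (Cell 0) (Const 0) (Const 0),
      jump stop,
      Arith Times (Cell 3) (Const stride) (At (Cell 0)),
      Arith Plus (Cell 3) (At (Cell 3)) (Const (cell 1 0)),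
      Arith Plus (Ptr 3) (At (Ptr 0)) (Const 0),
      Arith Minus (Cell 0) (At (Cell 0)) (Const 1),
      IfLess (Const 0) (At (Cell 0)) 3,
      Arith Times (Cell 0) (Const 2) (At (Cell (cell 1 1))),
      Arith Plus (Cell 1) (Const (cell 2 0)) (Const 0),
      Coin (Ptr 1),
      Arith Plus (Cell 1) (At (Cell 1)) (Const stride),
      Arith Minus (Cell 0) (At (Cell 0)) (Const 1),
      IfLess (Const 0) (At (Cell 0)) 10]"

text \<open>The output moves to smaller addresses in increasing order, so every cell is read before
  it can be overwritten. The cells 0, 1, 2 are set last; cell 1 is the read pointer and must be the
  very last, whence the order 0, 2, 1 of the repeated outputs.\<close>

definition exit_code :: "nat \<Rightarrow> instr list" where
  "exit_code x =
     [Arith Plus (Cell 2) (At (Cell (cell 0 25))) (Const 0),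
      Arith Plus (Cell 0) (Const 3) (Const 0),
      Arith Plus (Cell 1) (Const (cell 13 3)) (Const 0),
      Arith Plus (Ptr 0) (At (Ptr 1)) (Const 0),
      Arith Plus (Cell 0) (At (Cell 0)) (Const 1),
      Arith Plus (Cell 1) (At (Cell 1)) (Const stride),
      IfLess (At (Cell 0)) (At (Cell 2)) (x + 3),
      Arith Plus (Cell 0) (At (Ptr 1)) (Const 0),
      Arith Plus (Cell 1) (At (Cell 1)) (Const stride),
      Arith Plus (Cell 2) (At (Ptr 1)) (Const 0),
      Arith Plus (Cell 1) (At (Cell 1)) (Const stride),
      Arith Plus (Cell 1) (At (Ptr 1)) (Const 0)]"

definition machine :: "exp \<Rightarrow> instr list" where
  "machine e = (let xs = compile 14 0 (main_prog e); x = 14 + length xs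
     in entry_code (x + 12) @ xs @ exit_code x)"

lemma cell_Suc: "cell a (Suc i) = cell a i + stride"
  by (simp add: cell_def)

lemma cell_gt: "i + 32 \<le> cell a i"
  by (simp add: cell_def)

lemma cell_mono: "i \<le> j \<Longrightarrow> cell a i \<le> cell a j"
  by (simp add: cell_def)

lemma exit_correct:
  assumes code: "code_at P x (exit_code x)" and rep: "represents m s"
    and sz: "s 0 25 = sz" "4 \<le> sz"
    and saved: "s 13 sz = s 13 0" "s 13 (sz + 1) = s 13 2" "s 13 (sz + 2) = s 13 1"
    and small: "\<And>i. i < sz \<Longrightarrow> s 13 i \<le> Z" "cell 13 (sz + 2) \<le> Z" "500 \<le> Z"
  shows "\<exists>m'. reaches P (kappa Z) (4 * sz + 8) x m (x + 12) m' \<and> (\<forall>i<sz. m' i = s 13 i)"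
proof -
  have c: "x < length P" "x+1 < length P" "x+2 < length P" "x+3 < length P" "x+4 < length P" "x+5 < length P"
    "x+6 < length P" "x+7 < length P" "x+8 < length P" "x+9 < length P" "x+10 < length P" "x+11 < length P"
    "P ! x = Arith Plus (Cell 2) (At (Cell (cell 0 25))) (Const 0)"
    "P ! (x+1) = Arith Plus (Cell 0) (Const 3) (Const 0)"
    "P ! (x+2) = Arith Plus (Cell 1) (Const (cell 13 3)) (Const 0)"
    "P ! (x+3) = Arith Plus (Ptr 0) (At (Ptr 1)) (Const 0)"
    "P ! (x+4) = Arith Plus (Cell 0) (At (Cell 0)) (Const 1)"
    "P ! (x+5) = Arith Plus (Cell 1) (At (Cell 1)) (Const stride)"
    "P ! (x+6) = IfLess (At (Cell 0)) (At (Cell 2)) (x + 3)"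
    "P ! (x+7) = Arith Plus (Cell 0) (At (Ptr 1)) (Const 0)"
    "P ! (x+8) = Arith Plus (Cell 1) (At (Cell 1)) (Const stride)"
    "P ! (x+9) = Arith Plus (Cell 2) (At (Ptr 1)) (Const 0)"
    "P ! (x+10) = Arith Plus (Cell 1) (At (Cell 1)) (Const stride)"
    "P ! (x+11) = Arith Plus (Cell 1) (At (Ptr 1)) (Const 0)"
    using code by (simp_all add: exit_code_def code_at_Cons eval_nat_numeral)
  have m: "m (cell 13 i) = s 13 i" "m (cell 0 25) = sz" for i
    using rep sz by (simp_all add: represents_def)
  have Z: "sz + 2 \<le> Z" "cell 13 sz \<le> Z" "cell 13 (sz + 1) \<le> Z" "cell 13 i \<le> Z" if "i \<le> sz" for i
    using small(2) cell_gt[of "sz + 2" 13] cell_mono[of sz "sz + 2" 13] cell_mono[of "sz + 1" "sz + 2" 13]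
      cell_mono[of i "sz + 2" 13] that by auto
  have const_le: "cell 0 25 \<le> Z" "cell 13 3 \<le> Z" "31 < cell 0 25" using small(3) by (simp_all add: cell_def)
  define m1 where "m1 = m(2 := sz, 0 := 3, 1 := cell 13 3)"
  have start: "reaches P (kappa Z) 3 x m (x + 3) m1"
  proof -
    have "reaches P (kappa Z) 1 x m (x + 1) (m(2 := sz))"
      using reaches_Arith[OF c(1) c(13), of Z m] const_le Z(1)[of 0] m small by simp
    moreover have "reaches P (kappa Z) 1 (x + 1) (m(2 := sz)) (x + 2) (m(2 := sz, 0 := 3))"
      using reaches_Arith[OF c(2) c(14), of Z "m(2 := sz)"] small by simp
    moreover have "reaches P (kappa Z) 1 (x + 2) (m(2 := sz, 0 := 3)) (x + 3) m1"
      using reaches_Arith[OF c(3) c(15), of Z "m(2 := sz, 0 := 3)"] const_le small by (simp add: m1_def eval_nat_numeral)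
    ultimately have "reaches P (kappa Z) (1 + 1 + 1) x m (x + 3) m1"
      by (blast intro: reaches_trans)
    then show ?thesis by (simp add: eval_nat_numeral)
  qed
  define inv where "inv i t \<longleftrightarrow> t 0 = i \<and> t 1 = cell 13 i \<and> t 2 = sz \<and>
    (\<forall>y. 3 \<le> y \<longrightarrow> t y = (if y < i then s 13 y else m y))" for i and t :: mem
  have iter: "\<exists>t'. reaches P (kappa Z) 4 (x + 3) t (if Suc i < sz then x + 3 else x + 7) t' \<and> inv (Suc i) t'"
    if inv: "inv i t" and i: "3 \<le> i" "i < sz" for i t
  proof -
    have t: "t 0 = i" "t (Suc 0) = cell 13 i" "t 2 = sz" "t (cell 13 i) = s 13 i"
      using inv i cell_gt[of i 13] m unfolding inv_def by auto
    let ?t1 = "t(i := s 13 i)" let ?t2 = "?t1(0 := Suc i)" let ?t3 = "?t2(1 := cell 13 (Suc i))"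
    have zi: "cell 13 i \<le> Z" "i \<le> Z" "s 13 i \<le> Z" "Suc i \<le> Z" "cell 13 (Suc i) \<le> Z" "sz \<le> Z"
      using Z(1)[of 0] Z(4)[of i] Z(4)[of "Suc i"] small(1)[of i] i by auto
    have "reaches P (kappa Z) 1 (x + 3) t (x + 4) ?t1"
      using reaches_Arith[OF c(4) c(16), of Z t] t zi by (simp add: eval_nat_numeral)
    moreover have "reaches P (kappa Z) 1 (x + 4) ?t1 (x + 5) ?t2"
      using reaches_Arith[OF c(5) c(17), of Z ?t1] t zi i by (simp add: eval_nat_numeral)
    moreover have "reaches P (kappa Z) 1 (x + 5) ?t2 (x + 6) ?t3"
      using reaches_Arith[OF c(6) c(18), of Z ?t2] t zi i small by (simp add: cell_Suc eval_nat_numeral)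
    moreover have "reaches P (kappa Z) 1 (x + 6) ?t3 (if Suc i < sz then x + 3 else x + 7) ?t3"
      using reaches_IfLess[OF c(7) c(19), of Z ?t3] t zi i small by (simp add: eval_nat_numeral split: if_splits)
    ultimately have "reaches P (kappa Z) (1 + 1 + 1 + 1) (x + 3) t (if Suc i < sz then x + 3 else x + 7) ?t3"
      by (blast intro: reaches_trans)
    moreover have "inv (Suc i) ?t3"
      using inv i unfolding inv_def by (auto simp: less_Suc_eq)
    ultimately show ?thesis by (intro exI[of _ ?t3]) (simp add: eval_nat_numeral)
  qed
  have loop: "\<exists>t. reaches P (kappa Z) (4 * (i - 3)) (x + 3) m1 (if i < sz then x + 3 else x + 7) t \<and> inv i t"
    if "3 \<le> i" "i \<le> sz" for i
    using that
  proof (induction i rule: dec_induct)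
    case base
    have "inv 3 m1" by (auto simp: inv_def m1_def)
    then show ?case using sz reaches_refl[of P "kappa Z" 0 "x + 3" m1] by auto
  next
    case (step i)
    then obtain t where "reaches P (kappa Z) (4 * (i - 3)) (x + 3) m1 (x + 3) t" "inv i t" by auto
    moreover obtain t' where "reaches P (kappa Z) 4 (x + 3) t (if Suc i < sz then x + 3 else x + 7) t'" "inv (Suc i) t'"
      using iter[OF \<open>inv i t\<close>] step by auto
    ultimately have "reaches P (kappa Z) (4 * (i - 3) + 4) (x + 3) m1 (if Suc i < sz then x + 3 else x + 7) t'"
      by (blast intro: reaches_trans)
    moreover have "4 * (i - 3) + 4 = 4 * (Suc i - 3)" using step by simp
    ultimately show ?case using \<open>inv (Suc i) t'\<close> by (intro exI[of _ t']) simp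
  qed
  from loop[of sz] sz obtain t where t: "reaches P (kappa Z) (4 * (sz - 3)) (x + 3) m1 (x + 7) t" "inv sz t" by auto
  have "t (cell 13 i) = s 13 i" if "sz \<le> i" for i
    using t(2) cell_gt[of i 13] m(1)[of i] that unfolding inv_def by auto
  moreover have "cell 13 sz + 16 = cell 13 (sz + 1)" "cell 13 sz + 32 = cell 13 (sz + 2)"
    by (simp_all add: cell_def)
  moreover have "t 0 = sz" "t (Suc 0) = cell 13 sz" "t 2 = sz" using t(2) by (simp_all add: inv_def)
  ultimately have t': "t 0 = sz" "t (Suc 0) = cell 13 sz" "t 2 = sz" "t (cell 13 sz) = s 13 0"
    "t (cell 13 sz + 16) = s 13 2" "t (cell 13 sz + 32) = s 13 1"
    using saved by simp_all
  have far: "2 < cell 13 sz" by (simp add: cell_def)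
  have zl: "s 13 0 \<le> Z" "s 13 1 \<le> Z" "s 13 2 \<le> Z" "cell 13 sz + 32 \<le> Z"
    using small sz by (auto simp: cell_def)
  let ?t1 = "t(0 := s 13 0)" let ?t2 = "?t1(1 := cell 13 sz + 16)" let ?t3 = "?t2(2 := s 13 2)"
  let ?t4 = "?t3(1 := cell 13 sz + 32)" let ?t5 = "?t4(1 := s 13 1)"
  have "reaches P (kappa Z) 1 (x + 7) t (x + 8) ?t1"
    using reaches_Arith[OF c(8) c(20), of Z t] t' zl by (simp add: eval_nat_numeral)
  moreover have "reaches P (kappa Z) 1 (x + 8) ?t1 (x + 9) ?t2"
    using reaches_Arith[OF c(9) c(21), of Z ?t1] t' zl small by (simp add: eval_nat_numeral)
  moreover have "reaches P (kappa Z) 1 (x + 9) ?t2 (x + 10) ?t3"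
    using reaches_Arith[OF c(10) c(22), of Z ?t2] t' zl small by (simp add: eval_nat_numeral)
  moreover have "reaches P (kappa Z) 1 (x + 10) ?t3 (x + 11) ?t4"
    using reaches_Arith[OF c(11) c(23), of Z ?t3] t' zl small by (simp add: eval_nat_numeral)
  moreover have "reaches P (kappa Z) 1 (x + 11) ?t4 (x + 12) ?t5"
    using reaches_Arith[OF c(12) c(24), of Z ?t4] t' zl small far by (simp add: eval_nat_numeral)
  ultimately have "reaches P (kappa Z) (1 + 1 + 1 + 1 + 1) (x + 7) t (x + 12) ?t5"
    by (blast intro: reaches_trans)
  from reaches_trans[OF start reaches_trans[OF t(1) this]]
  have "reaches P (kappa Z) (4 * sz + 8) x m (x + 12) ?t5"
    by (rule reaches_mono) (use sz in simp)
  moreover have "?t5 i = s 13 i" if "i < sz" for i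
  proof -
    consider "i = 0" | "i = 1" | "i = 2" | "3 \<le> i" by linarith
    then show ?thesis using t(2) that by cases (auto simp: inv_def)
  qed
  ultimately show ?thesis by blast
qed

lemma entry_correct:
  assumes code: "code_at P 0 (entry_code stop)"
    and m: "m 0 = len" "m 1 = n" "2 \<le> n" "4 \<le> len"
    and small: "\<And>i. i \<le> len \<Longrightarrow> m i \<le> Z" "cell 1 len \<le> Z" "2 * n \<le> Z" "500 \<le> Z"
  shows "\<exists>m'. reaches P (kappa Z) (5 * len + 3) 0 m 10 m' \<and> m' 0 = 2 * n \<and> m' 1 = cell 2 0 \<and>
    (\<forall>i. 1 \<le> i \<longrightarrow> i \<le> len \<longrightarrow> i \<noteq> 3 \<longrightarrow> m' (cell 1 i) = m i)"
proof -
  have c: "0 < length P" "3 < length P" "4 < length P" "5 < length P"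
    "6 < length P" "7 < length P" "8 < length P" "9 < length P"
    "P ! 0 = IfLess (Const 1) (At (Cell 1)) 3"
    "P ! 3 = Arith Times (Cell 3) (Const stride) (At (Cell 0))"
    "P ! 4 = Arith Plus (Cell 3) (At (Cell 3)) (Const (cell 1 0))"
    "P ! 5 = Arith Plus (Ptr 3) (At (Ptr 0)) (Const 0)"
    "P ! 6 = Arith Minus (Cell 0) (At (Cell 0)) (Const 1)"
    "P ! 7 = IfLess (Const 0) (At (Cell 0)) 3"
    "P ! 8 = Arith Times (Cell 0) (Const 2) (At (Cell (cell 1 1)))"
    "P ! 9 = Arith Plus (Cell 1) (Const (cell 2 0)) (Const 0)"
    using code by (simp_all add: entry_code_def code_at_Cons eval_nat_numeral)
  have const_le: "cell 1 0 \<le> Z" "cell 1 1 \<le> Z" "cell 2 0 \<le> Z" "len \<le> Z"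
    using small cell_gt[of len 1] by (simp_all add: cell_def)
  have start: "reaches P (kappa Z) 1 0 m 3 m"
    using reaches_IfLess[OF c(1) c(9), of Z m] m small by (simp add: eval_nat_numeral)
  define inv where "inv i t \<longleftrightarrow> t 0 = i \<and> (\<forall>y. 1 \<le> y \<longrightarrow> y \<le> i \<longrightarrow> y \<noteq> 3 \<longrightarrow> t y = m y) \<and>
    t 3 \<le> Z \<and> (\<forall>y. i < y \<longrightarrow> y \<le> len \<longrightarrow> y \<noteq> 3 \<longrightarrow> t (cell 1 y) = m y)" for i and t :: mem
  have iter: "\<exists>t'. reaches P (kappa Z) 5 3 t (if 0 < i then 3 else 8) t' \<and> inv i t'"
    if inv: "inv (Suc i) t" and i: "Suc i \<le> len" for i t
  proof -
    let ?i = "Suc i"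
    have t: "t 0 = ?i" "?i \<noteq> 3 \<Longrightarrow> t ?i = m ?i" using inv by (auto simp: inv_def)
    let ?t1 = "t(3 := stride * ?i)" let ?t2 = "?t1(3 := cell 1 ?i)"
    let ?t3 = "?t2(cell 1 ?i := ?t2 ?i)" let ?t4 = "?t3(0 := i)"
    have far: "3 < cell 1 ?i" "cell 1 ?i \<noteq> 0" by (simp_all add: cell_def)
    have zi: "cell 1 ?i \<le> Z" "?i \<le> Z" "stride * ?i \<le> Z" "?t2 ?i \<le> Z"
      using cell_mono[of ?i len 1] small(1)[of ?i] small(2) const_le i t by (auto simp: cell_def)
    have "reaches P (kappa Z) 1 3 t 4 ?t1"
      using reaches_Arith[OF c(2) c(10), of Z t] t zi small by (simp add: eval_nat_numeral)
    moreover have "reaches P (kappa Z) 1 4 ?t1 5 ?t2"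
      using reaches_Arith[OF c(3) c(11), of Z ?t1] t zi small const_le by (simp add: cell_def eval_nat_numeral)
    moreover have "reaches P (kappa Z) 1 5 ?t2 6 ?t3"
      using reaches_Arith[OF c(4) c(12), of Z ?t2] t zi small by (simp add: eval_nat_numeral)
    moreover have "reaches P (kappa Z) 1 6 ?t3 7 ?t4"
      using reaches_Arith[OF c(5) c(13), of Z ?t3] t zi small far by (simp add: eval_nat_numeral)
    moreover have "reaches P (kappa Z) 1 7 ?t4 (if 0 < i then 3 else 8) ?t4"
      using reaches_IfLess[OF c(6) c(14), of Z ?t4] t zi small far by (simp add: eval_nat_numeral split: if_splits)
    ultimately have "reaches P (kappa Z) (1 + 1 + 1 + 1 + 1) 3 t (if 0 < i then 3 else 8) ?t4"
      by (blast intro: reaches_trans)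
    moreover have "inv i ?t4"
      unfolding inv_def
    proof (intro conjI allI impI)
      fix y assume y: "1 \<le> y" "y \<le> i" "y \<noteq> 3"
      then have "y \<noteq> cell 1 ?i" using cell_gt[of ?i 1] by auto
      then show "?t4 y = m y" using inv y by (simp add: inv_def)
    next
      fix y assume y: "i < y" "y \<le> len" "y \<noteq> 3"
      have "3 < cell 1 y" by (simp add: cell_def)
      then show "?t4 (cell 1 y) = m y"
        using inv y t by (cases "y = ?i") (simp_all add: inv_def cell_eq_iff)
    qed (use zi far in simp_all)
    ultimately show ?thesis by (intro exI[of _ ?t4]) (simp add: eval_nat_numeral)
  qed
  have loop: "\<exists>t. reaches P (kappa Z) (5 * j) 3 m (if j < len then 3 else 8) t \<and> inv (len - j) t" if "j \<le> len" for j
    using that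
  proof (induction j)
    case 0
    have "inv len m" using m small(1)[of 3] by (auto simp: inv_def)
    then show ?case using m reaches_refl[of P "kappa Z" 0 3 m] by auto
  next
    case (Suc j)
    then obtain t where t: "reaches P (kappa Z) (5 * j) 3 m 3 t" "inv (len - j) t" by auto
    have "inv (Suc (len - Suc j)) t" using t(2) Suc.prems by (simp add: Suc_diff_Suc)
    then obtain t' where "reaches P (kappa Z) 5 3 t (if 0 < len - Suc j then 3 else 8) t'" "inv (len - Suc j) t'"
      using iter[of "len - Suc j" t] Suc.prems by (auto simp: Suc_diff_Suc)
    with t(1) have "reaches P (kappa Z) (5 * j + 5) 3 m (if 0 < len - Suc j then 3 else 8) t'"
      by (blast intro: reaches_trans)
    then show ?case using \<open>inv (len - Suc j) t'\<close> by (intro exI[of _ t']) (simp add: add.commute)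
  qed
  from loop[of len] obtain t where t: "reaches P (kappa Z) (5 * len) 3 m 8 t" "inv 0 t" by auto
  have t1: "t (cell 1 1) = n" using t(2) m by (simp add: inv_def)
  let ?t1 = "t(0 := 2 * n)" let ?t2 = "?t1(1 := cell 2 0)"
  have far: "3 < cell 1 i" for i by (simp add: cell_def)
  have "reaches P (kappa Z) 1 8 t 9 ?t1"
    using reaches_Arith[OF c(7) c(15), of Z t] t1 small const_le by (simp add: eval_nat_numeral)
  moreover have "reaches P (kappa Z) 1 9 ?t1 10 ?t2"
    using reaches_Arith[OF c(8) c(16), of Z ?t1] small const_le by (simp add: eval_nat_numeral)
  ultimately have "reaches P (kappa Z) (1 + 1) 8 t 10 ?t2" by (blast intro: reaches_trans)
  from reaches_trans[OF start reaches_trans[OF t(1) this]]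
  have "reaches P (kappa Z) (5 * len + 3) 0 m 10 ?t2" by (rule reaches_mono) simp
  moreover have "?t2 (cell 1 i) = m i" if "1 \<le> i" "i \<le> len" "i \<noteq> 3" for i
    using t(2) that far[of i] by (simp add: inv_def)
  ultimately show ?thesis by (intro exI[of _ ?t2]) simp
qed

section \<open>The coins and the distribution of final configurations\<close>

lemma run_add: "run P (a + b) c = bind_pmf (run P a c) (run P b)"
proof (induction a arbitrary: c)
  case (Suc a)
  then have "run P (a + b) = (\<lambda>c. bind_pmf (run P a c) (run P b))" by (intro ext)
  then show ?case by (simp add: bind_assoc_pmf)
qed (simp add: bind_return_pmf)

lemma run_halted: "halted P c \<Longrightarrow> run P t c = return_pmf c"
  by (induction t) (simp_all add: step_def bind_return_pmf)

lemma step_dstep: "dstep P c c' \<Longrightarrow> step P c = return_pmf c'"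
  by (simp add: dstep_def step_def halted_def)

lemma run_relpowp: "(dstep P ^^ j) c c' \<Longrightarrow> run P j c = return_pmf c'"
proof (induction j arbitrary: c)
  case (Suc j)
  then obtain d where "dstep P c d" "(dstep P ^^ j) d c'" by (meson relpowp_Suc_D2)
  then show ?case using Suc.IH by (simp add: step_dstep bind_return_pmf)
qed simp

text \<open>The memory after \<open>j\<close> of \<open>N\<close> tosses with outcomes
  \<open>\<xi>\<close>: cell 0 counts down, cell 1 points to the next coin, and the division
  recovers the number of a coin from its address.\<close>

definition tossed :: "mem \<Rightarrow> nat \<Rightarrow> nat \<Rightarrow> (nat \<Rightarrow> bool) \<Rightarrow> mem" where
  "tossed m N j \<xi> = (\<lambda>y. if y = 0 then N - j else if y = 1 then cell 2 j
     else if \<exists>i<j. y = cell 2 i then of_bool (\<xi> ((y - cell 2 0) div stride)) else m y)"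

lemma tossed_coin: "i < j \<Longrightarrow> tossed m N j \<xi> (cell 2 i) = of_bool (\<xi> i)"
proof -
  have "(cell 2 i - cell 2 0) div stride = i" "cell 2 i \<noteq> 0" "cell 2 i \<noteq> 1" by (simp_all add: cell_def)
  then show "i < j \<Longrightarrow> tossed m N j \<xi> (cell 2 i) = of_bool (\<xi> i)" by (auto simp: tossed_def)
qed

lemma tossed_Suc:
  "(tossed m N j \<xi>)(cell 2 j := of_bool b, 1 := cell 2 (Suc j), 0 := N - Suc j) = tossed m N (Suc j) (\<xi>(j := b))"
proof
  fix y
  have div: "(cell 2 i - cell 2 0) div stride = i" "cell 2 i \<noteq> 0" "cell 2 i \<noteq> 1" for i by (simp_all add: cell_def)
  show "((tossed m N j \<xi>)(cell 2 j := of_bool b, 1 := cell 2 (Suc j), 0 := N - Suc j)) y = tossed m N (Suc j) (\<xi>(j := b)) y"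
  proof (cases "\<exists>i<Suc j. y = cell 2 i")
    case True
    then obtain i where i: "i < Suc j" "y = cell 2 i" by auto
    then show ?thesis
      using tossed_coin[OF i(1), of m N "\<xi>(j := b)"] tossed_coin[of i j m N \<xi>] div[of i]
      by (cases "i = j") (auto simp: cell_eq_iff)
  next
    case False
    then show ?thesis by (auto simp: tossed_def less_Suc_eq)
  qed
qed

text \<open>A toss is charged for its address only, so the cost of a round is the same for both
  outcomes and the main program starts at one common cost.\<close>

definition toss_cost :: "nat \<Rightarrow> nat \<Rightarrow> nat" where
  "toss_cost N j = (nbits 1 + nbits (cell 2 j)) + (nbits 1 + (nbits 1 + nbits (cell 2 j)) + nbits stride) +
     (nbits 0 + (nbits 0 + nbits (N - j)) + nbits 1) + (nbits 0 + (nbits 0 + nbits (N - Suc j)))"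

lemma toss_step:
  assumes code: "code_at P 0 (entry_code stop)" and j: "j < N"
  shows "run P 4 \<lparr>pc = 10, mem = tossed m N j \<xi>, cost = w\<rparr> =
    map_pmf (\<lambda>b. \<lparr>pc = if Suc j < N then 10 else 14, mem = tossed m N (Suc j) (\<xi>(j := b)), cost = w + toss_cost N j\<rparr>)
      (bernoulli_pmf (1/2))"
proof -
  have c: "10 < length P" "11 < length P" "12 < length P" "13 < length P"
    "P ! 10 = Coin (Ptr 1)"
    "P ! 11 = Arith Plus (Cell 1) (At (Cell 1)) (Const stride)"
    "P ! 12 = Arith Minus (Cell 0) (At (Cell 0)) (Const 1)"
    "P ! 13 = IfLess (Const 0) (At (Cell 0)) 10"
    using code by (simp_all add: entry_code_def code_at_Cons eval_nat_numeral)
  have t: "tossed m N j \<xi> 0 = N - j" "tossed m N j \<xi> (Suc 0) = cell 2 j" by (simp_all add: tossed_def)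
  have far: "cell 2 j \<noteq> 0" "cell 2 j \<noteq> Suc 0" by (simp_all add: cell_def)
  have rest: "run P 3 \<lparr>pc = 11, mem = (tossed m N j \<xi>)(cell 2 j := of_bool b), cost = w'\<rparr> =
    return_pmf \<lparr>pc = if Suc j < N then 10 else 14, mem = tossed m N (Suc j) (\<xi>(j := b)),
      cost = w' + (nbits 1 + (nbits 1 + nbits (cell 2 j)) + nbits stride) +
     (nbits 0 + (nbits 0 + nbits (N - j)) + nbits 1) + (nbits 0 + (nbits 0 + nbits (N - Suc j)))\<rparr>" for b w'
    using c t far j
    by (simp add: numeral_3_eq_3 step_def halted_def bind_return_pmf tossed_Suc[symmetric] cell_Suc)
  have "run P 4 c = bind_pmf (step P c) (run P 3)" for c by (simp add: eval_nat_numeral)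
  then show ?thesis
    using c t rest by (simp add: step_def halted_def map_pmf_def bind_assoc_pmf bind_return_pmf toss_cost_def add.assoc)
qed

text \<open>Each round adds one independent coordinate to the product distribution; all the rest of
  the configuration is a function of the outcomes.\<close>

lemma toss_run:
  assumes code: "code_at P 0 (entry_code stop)" and "j \<le> N" "0 < N"
  shows "run P (4 * j) \<lparr>pc = 10, mem = tossed m N 0 (\<lambda>_. False), cost = w\<rparr> =
    map_pmf (\<lambda>\<xi>. \<lparr>pc = if j < N then 10 else 14, mem = tossed m N j \<xi>, cost = w + (\<Sum>i<j. toss_cost N i)\<rparr>)
      (coins {..<j})"
  using assms(2)
proof (induction j)
  case 0
  then show ?case using assms(3) by simp
next
  case (Suc j)
  let ?c = "\<lambda>j \<xi>. \<lparr>pc = if j < N then 10 else 14, mem = tossed m N j \<xi>, cost = w + (\<Sum>i<j. toss_cost N i)\<rparr>"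
  let ?start = "\<lparr>pc = 10, mem = tossed m N 0 (\<lambda>_. False), cost = w\<rparr>"
  have "4 * Suc j = 4 * j + 4" by simp
  then have "run P (4 * Suc j) ?start = bind_pmf (run P (4 * j) ?start) (run P 4)"
    by (simp only: run_add)
  also have "run P (4 * j) ?start = map_pmf (?c j) (coins {..<j})"
    by (rule Suc.IH) (use Suc.prems in simp)
  also have "bind_pmf (map_pmf (?c j) (coins {..<j})) (run P 4) =
    bind_pmf (coins {..<j}) (\<lambda>\<xi>. run P 4 (?c j \<xi>))"
    by (rule bind_map_pmf)
  also have "(\<lambda>\<xi>. run P 4 (?c j \<xi>)) = (\<lambda>\<xi>. map_pmf (\<lambda>b. ?c (Suc j) (\<xi>(j := b))) (bernoulli_pmf (1/2)))"
  proof
    fix \<xi>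
    show "run P 4 (?c j \<xi>) = map_pmf (\<lambda>b. ?c (Suc j) (\<xi>(j := b))) (bernoulli_pmf (1/2))"
      using toss_step[OF code, of j N m \<xi> "w + (\<Sum>i<j. toss_cost N i)"] Suc.prems by (simp add: add.assoc)
  qed
  also have "bind_pmf (coins {..<j}) (\<lambda>\<xi>. map_pmf (\<lambda>b. ?c (Suc j) (\<xi>(j := b))) (bernoulli_pmf (1/2))) =
    bind_pmf (coins {..<j}) (\<lambda>\<xi>. bind_pmf (bernoulli_pmf (1/2)) (\<lambda>b. return_pmf (?c (Suc j) (\<xi>(j := b)))))"
    by (simp only: map_pmf_def)
  also have "\<dots> = bind_pmf (bernoulli_pmf (1/2)) (\<lambda>b. bind_pmf (coins {..<j}) (\<lambda>\<xi>. return_pmf (?c (Suc j) (\<xi>(j := b)))))"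
    by (rule bind_commute_pmf)
  also have "\<dots> = map_pmf (?c (Suc j)) (coins {..<Suc j})"
  proof -
    have "coins {..<Suc j} = do {b \<leftarrow> bernoulli_pmf (1/2); \<xi> \<leftarrow> coins {..<j}; return_pmf (\<xi>(j := b))}"
      unfolding lessThan_Suc by (rule Pi_pmf_insert') simp_all
    then show ?thesis by (simp only: map_bind_pmf map_return_pmf)
  qed
  finally show ?case .
qed

lemma kappa_pos: "1 \<le> kappa Z"
  by (simp add: kappa_def nbits_def)

lemma toss_cost_le:
  assumes "cell 2 j \<le> Z" "N \<le> Z" "16 \<le> Z"
  shows "toss_cost N j \<le> 2 * kappa Z"
proof -
  have "nbits 1 \<le> nbits Z" "nbits (cell 2 j) \<le> nbits Z" "nbits stride \<le> nbits Z" "nbits 0 \<le> nbits Z"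
    "nbits (N - j) \<le> nbits Z" "nbits (N - Suc j) \<le> nbits Z"
    using assms by (auto intro!: nbits_mono)
  then show ?thesis unfolding toss_cost_def kappa_def by linarith
qed

definition time_bound :: "exp \<Rightarrow> nat \<Rightarrow> nat \<Rightarrow> nat \<Rightarrow> nat \<Rightarrow> nat \<Rightarrow> nat" where
  "time_bound e W k len n m =
     kappa (size_bound W) * ((5 * len + 3) + 8 * n + (time k (main_prog e) + (4 * (2 * n + m) + 8)))"

lemma length_entry_code: "length (entry_code x) = 14" and length_exit_code: "length (exit_code x) = 12"
  by (simp_all add: entry_code_def exit_code_def)

text \<open>After the tosses the machine is deterministic, so the final configuration is a function
  \<open>F\<close> of the coins, and the run is the image of the product distribution.
  \<open>S\<close> is the program state behind \<open>F\<close>. The last clause says that the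
  half-offers depend only on the coins from \<open>n\<close> on, which may decide the sides.\<close>

lemma machine_correct:
  fixes flag :: "(nat \<Rightarrow> bool) \<Rightarrow> nat \<Rightarrow> nat"
  assumes e: "wf_exp e" "temps_exp e \<le> 10"
    and xs: "2 + n + 4*m \<le> length xs" "xs ! 0 = n" "xs ! 1 = m" "xs ! 3 = cap" "2 \<le> n"
    and edges: "\<And>j. j < m \<Longrightarrow> xs ! (2 + n + 4*j) = us j \<and> xs ! (3 + n + 4*j) = vs j \<and>
        xs ! (4 + n + 4*j) = nums j \<and> xs ! (5 + n + 4*j) = dens j"
    and input: "\<And>\<xi>. input n m cap C W k us vs nums dens (flag \<xi>)"
    and simple: "\<And>i j. i < m \<Longrightarrow> j < m \<Longrightarrow> {us i, vs i} = {us j, vs j} \<Longrightarrow> i = j"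
    and W_ge: "(2*m*(m*C) + 1) * (2*m)^(2*m) + 16*(C + n + m) + 200 \<le> W"
    and small: "\<And>x. x \<in> set xs \<Longrightarrow> x \<le> W" "length xs \<le> W"
    and src: "\<And>\<xi> v s. v < n \<Longrightarrow> s 0 16 = v \<Longrightarrow> s 0 0 = n \<Longrightarrow> s 0 1 = m \<Longrightarrow>
       (\<And>i. 4 \<le> i \<Longrightarrow> i \<le> length xs \<Longrightarrow> s 1 i = xs ! (i - 1)) \<Longrightarrow>
       (\<And>i. i < 2 * n \<Longrightarrow> s 2 i = of_bool (\<xi> i)) \<Longrightarrow>
       bounded_exp W e s \<and> val e s = flag \<xi> v"
    and independent: "\<And>g s. (\<And>i. n \<le> i \<Longrightarrow> i < 2 * n \<Longrightarrow> g i = s 2 i) \<Longrightarrow> s 0 0 = n \<Longrightarrow> s 0 16 < n \<Longrightarrow>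
       val e (s(2 := g)) = val e s"
  defines "P \<equiv> machine e" and "T0 \<equiv> time_bound e W k (length xs) n m"
  shows "\<exists>F S. (\<forall>T\<ge>T0. run P T (initial xs) = map_pmf F (coins {..<2*n})) \<and>
    (\<forall>\<xi>. halted P (F \<xi>) \<and> cost (F \<xi>) \<le> T0 \<and>
      input.outcome n m cap C us vs nums dens (flag \<xi>) \<xi> (S \<xi>) \<and> (\<forall>y<2*n+m. mem (F \<xi>) y = S \<xi> 13 y)) \<and>
    (\<forall>\<xi> \<xi>' a. (\<forall>i\<in>{n..<2*n}. \<xi> i = \<xi>' i) \<longrightarrow> a \<in> {4, 5, 6, 7, 8, 9} \<longrightarrow> S \<xi> a = S \<xi>' a)"
proof -
  let ?Z = "size_bound W" and ?K = "kappa (size_bound W)" and ?len = "length xs"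
  let ?N = "2 * n" and ?sz = "2 * n + m"
  define ys where "ys = compile 14 0 (main_prog e)"
  define x where "x = 14 + length ys"
  have P: "P = entry_code (x + 12) @ ys @ exit_code x"
    by (simp add: P_def machine_def ys_def x_def Let_def)
  note len14 = length_entry_code[of "x + 12"]
  have lenP: "length P = x + 12" unfolding P length_append len14 length_exit_code by (simp add: x_def)
  have "code_at P 0 P" by (simp add: code_at_def)
  then have code: "code_at P 0 (entry_code (x + 12))" "code_at P 14 ys" "code_at P x (exit_code x)"
    unfolding P code_at_append len14 by (simp_all add: x_def)
  have linear: "16*(C + n + m) + 200 \<le> W" using W_ge by simp
  have Z: "16 * W + 48 = ?Z" by (simp add: size_bound_def)
  have len4: "4 \<le> ?len" using xs by simp
  let ?m0 = "mem (initial xs)"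
  have m0: "?m0 0 = ?len" "\<And>i. 1 \<le> i \<Longrightarrow> i \<le> ?len \<Longrightarrow> ?m0 i = xs ! (i - 1)"
    by (simp_all add: initial_def)
  have "\<exists>m'. reaches P ?K (5 * ?len + 3) 0 ?m0 10 m' \<and> m' 0 = 2 * n \<and> m' 1 = cell 2 0 \<and>
    (\<forall>i. 1 \<le> i \<longrightarrow> i \<le> ?len \<longrightarrow> i \<noteq> 3 \<longrightarrow> m' (cell 1 i) = ?m0 i)"
  proof (rule entry_correct[OF code(1)])
    show "?m0 1 = n" using m0(2)[of 1] xs len4 by simp
    show "?m0 i \<le> ?Z" if "i \<le> ?len" for i
    proof (cases "i = 0")
      case False
      then have "?m0 i \<in> set xs" using m0(2)[of i] that by simp
      then show ?thesis using small(1) Z by fastforce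
    qed (use m0 small Z in simp)
  qed (use m0 len4 xs small linear Z in \<open>auto simp: cell_def\<close>)
  then obtain M0 where M0: "reaches P ?K (5 * ?len + 3) 0 ?m0 10 M0" "M0 0 = 2 * n" "M0 1 = cell 2 0"
    "\<And>i. 1 \<le> i \<Longrightarrow> i \<le> ?len \<Longrightarrow> i \<noteq> 3 \<Longrightarrow> M0 (cell 1 i) = xs ! (i - 1)"
    using m0(2) by auto
  from M0(1) obtain j0 w1 where w1: "(dstep P ^^ j0) \<lparr>pc = 0, mem = ?m0, cost = 0\<rparr> \<lparr>pc = 10, mem = M0, cost = w1\<rparr>"
    "j0 \<le> w1" "w1 \<le> ?K * (5 * ?len + 3)"
    unfolding reaches_def by (metis add_0)
  have init: "initial xs = \<lparr>pc = 0, mem = ?m0, cost = 0\<rparr>" by (simp add: initial_def)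
  have M0_tossed: "M0 = tossed M0 ?N 0 (\<lambda>_. False)"
    using M0(2,3) by (auto simp: tossed_def fun_eq_iff)
  define w2 where "w2 = w1 + (\<Sum>i<?N. toss_cost ?N i)"
  have "(\<Sum>i<?N. toss_cost ?N i) \<le> (\<Sum>i<?N. 2 * ?K)"
    by (intro sum_mono toss_cost_le) (use linear Z in \<open>auto simp: cell_def\<close>)
  also have "\<dots> \<le> ?K * (8 * n)" by simp
  finally have w2: "w2 \<le> ?K * (5 * ?len + 3) + ?K * (8 * n)" using w1(3) by (simp add: w2_def)
  let ?c = "\<lambda>\<xi>. \<lparr>pc = 14, mem = tossed M0 ?N ?N \<xi>, cost = w2\<rparr>"
  let ?R = "time k (main_prog e) + (4 * ?sz + 8)"
  have toss: "run P (4 * ?N) \<lparr>pc = 10, mem = M0, cost = w1\<rparr> = map_pmf ?c (coins {..<?N})"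
    using toss_run[OF code(1), of ?N ?N M0 w1] xs(5) M0_tossed[symmetric] by (simp add: w2_def)
  \<comment> \<open>The initial state is read off the memory, with all that the raw input left in
    the arrays.\<close>
  define s0 where "s0 \<xi> = (\<lambda>a i. if a < stride then tossed M0 ?N ?N \<xi> (cell a i) else 0)" for \<xi>
  let ?S = "\<lambda>\<xi>. exec (main_prog e) (s0 \<xi>)"
  have coin: "s0 \<xi> 2 i = of_bool (\<xi> i)" if "i < ?N" for \<xi> i
    using that by (simp add: s0_def tossed_coin)
  have other: "tossed M0 ?N ?N \<xi> (cell a i) = M0 (cell a i)" if "a < stride" "a \<noteq> 2 \<or> ?N \<le> i" for \<xi> a i
  proof -
    have "\<not> (\<exists>i'<?N. cell a i = cell 2 i')" "cell a i \<noteq> 0" "cell a i \<noteq> 1"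
      using that by (auto simp: cell_eq_iff) (simp_all add: cell_def)
    then show ?thesis by (auto simp: tossed_def)
  qed
  have input1: "s0 \<xi> 1 i = xs ! (i - 1)" if "1 \<le> i" "i \<le> ?len" "i \<noteq> 3" for \<xi> i
    using other[where \<xi> = \<xi> and a = 1 and i = i] M0(4)[OF that] by (simp add: s0_def)
  have "\<exists>c'. (\<exists>j. (dstep P ^^ j) (?c \<xi>) c' \<and> j \<le> ?K * ?R) \<and> halted P c' \<and> cost c' \<le> T0 \<and>
     input.outcome n m cap C us vs nums dens (flag \<xi>) \<xi> (?S \<xi>) \<and> (\<forall>y<?sz. mem c' y = ?S \<xi> 13 y)" for \<xi>
  proof -
    interpret input n m cap C W k us vs nums dens "flag \<xi>" by (rule input)
    let ?M = "tossed M0 ?N ?N \<xi>"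
    let ?s0 = "s0 \<xi>"
    note s1 = input1[where \<xi> = \<xi>] and s2 = coin[where \<xi> = \<xi>]
    have rep: "represents ?M ?s0" by (simp add: represents_def s0_def)
    have raw: "raw ?s0"
      unfolding raw_def
    proof (intro conjI allI impI)
      fix j assume j: "j < m"
      then have "2 + n + 4*j + 4 \<le> ?len" using xs(1) by simp
      then show "?s0 1 (3 + n + 4*j) = us j" "?s0 1 (4 + n + 4*j) = vs j" "?s0 1 (5 + n + 4*j) = nums j"
        "?s0 1 (6 + n + 4*j) = dens j"
        using edges[OF j] xs(5) s1[of "3 + n + 4*j"] s1[of "4 + n + 4*j"] s1[of "5 + n + 4*j"] s1[of "6 + n + 4*j"]
        by (simp_all add: add.assoc)
    qed (use s1[of 1] s1[of 2] s1[of 4] xs len4 in simp_all)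
    define Q where "Q s' \<longleftrightarrow> outcome \<xi> s' \<and> s' 0 25 = ?sz \<and> s' 13 ?sz = s' 13 0 \<and>
      s' 13 (?sz + 1) = s' 13 2 \<and> s' 13 (?sz + 2) = s' 13 1" for s' :: state
    have "wp W k (main_prog e) Q ?s0"
    proof (rule wp_main[OF raw xs(5)])
      show "\<forall>v<n. ?s0 2 v = of_bool (\<xi> v)" using s2 by simp
      show "bounded_exp W e s' \<and> val e s' = flag \<xi> v"
        if "v < n" "loaded s'" "s' 0 16 = v" "s' 1 = ?s0 1" "s' 2 = ?s0 2" for v s'
        by (rule src) (use that s1 s2 in \<open>auto simp: loaded_def\<close>)
    qed (use simple W_ge in \<open>auto simp: Q_def\<close>)
    then have bnd: "bounded W k (main_prog e) ?s0" and Q: "Q (exec (main_prog e) ?s0)" by (simp_all add: wp_def)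
    let ?s = "exec (main_prog e) ?s0"
    obtain M1 where M1: "reaches P ?K (time k (main_prog e)) 14 ?M x M1" "represents M1 ?s"
      using compile_correct[OF code(2)[unfolded ys_def] rep bnd wf_main[OF e(1)]] temps_main[OF e(2)] linear
      by (auto simp: x_def ys_def)
    have out: "outcome \<xi> ?s" using Q by (simp add: Q_def)
    have out_le: "?s 13 i \<le> ?Z" if "i < ?sz" for i
    proof -
      have "\<exists>p :: nat \<Rightarrow> nat. (\<forall>u<2*n. p u \<le> C) \<and> (\<forall>v<n. ?s 13 (2 * v) = p (if \<xi> v then v + n else v) \<and> ?s 13 (2 * v + 1) = D)"
        using out unfolding outcome_def by blast
      then have "?s 13 (2 * v) \<le> C \<and> ?s 13 (2 * v + 1) = D" if "v < n" for v using that by auto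
      moreover have "?s 13 (?N + j) \<le> 1" if "j < m" for j
        using out that unfolding outcome_def by auto
      moreover have "(\<exists>v<n. i = 2 * v \<or> i = 2 * v + 1) \<or> (\<exists>j<m. i = ?N + j)"
      proof (cases "i < ?N")
        case True
        then have "i div 2 < n" "i = 2 * (i div 2) \<or> i = 2 * (i div 2) + 1" by auto
        then show ?thesis by blast
      next
        case False
        then show ?thesis using that by (intro disjI2 exI[of _ "i - ?N"]) auto
      qed
      moreover have "D \<le> ?Z" "C \<le> ?Z" "1 \<le> ?Z" using D_le linear Z by (simp_all add: D_def)
      ultimately show ?thesis by (metis order_trans)
    qed
    obtain M2 where M2: "reaches P ?K (4 * ?sz + 8) x M1 (x + 12) M2" "\<forall>i<?sz. M2 i = ?s 13 i"
      using exit_correct[OF code(3) M1(2), of ?sz ?Z] Q out_le linear Z xs(5) by (auto simp: Q_def cell_def)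
    have "reaches P ?K ?R 14 ?M (x + 12) M2" by (rule reaches_trans[OF M1(1) M2(1)])
    then obtain j w3 where w3: "(dstep P ^^ j) (?c \<xi>) \<lparr>pc = x + 12, mem = M2, cost = w3\<rparr>" "w2 + j \<le> w3" "w3 \<le> w2 + ?K * ?R"
      unfolding reaches_def by blast
    show ?thesis
    proof (intro exI[of _ "\<lparr>pc = x + 12, mem = M2, cost = w3\<rparr>"] conjI)
      show "\<exists>j. (dstep P ^^ j) (?c \<xi>) \<lparr>pc = x + 12, mem = M2, cost = w3\<rparr> \<and> j \<le> ?K * ?R" using w3 by auto
      show "halted P \<lparr>pc = x + 12, mem = M2, cost = w3\<rparr>" by (simp add: halted_def lenP)
      show "cost \<lparr>pc = x + 12, mem = M2, cost = w3\<rparr> \<le> T0"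
        using w2 w3 by (simp add: T0_def time_bound_def distrib_left)
      show "outcome \<xi> (?S \<xi>)" "\<forall>y<?sz. mem \<lparr>pc = x + 12, mem = M2, cost = w3\<rparr> y = ?S \<xi> 13 y"
        using out M2 by simp_all
    qed
  qed
  then have "\<forall>\<xi>. \<exists>c'. (\<exists>j. (dstep P ^^ j) (?c \<xi>) c' \<and> j \<le> ?K * ?R) \<and> halted P c' \<and> cost c' \<le> T0 \<and>
     input.outcome n m cap C us vs nums dens (flag \<xi>) \<xi> (?S \<xi>) \<and> (\<forall>y<?sz. mem c' y = ?S \<xi> 13 y)" by blast
  then obtain F where F: "\<And>\<xi>. (\<exists>j. (dstep P ^^ j) (?c \<xi>) (F \<xi>) \<and> j \<le> ?K * ?R) \<and> halted P (F \<xi>) \<and> cost (F \<xi>) \<le> T0 \<and>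
     input.outcome n m cap C us vs nums dens (flag \<xi>) \<xi> (?S \<xi>) \<and> (\<forall>y<?sz. mem (F \<xi>) y = ?S \<xi> 13 y)"
    by (metis (no_types))
  have "run P T (initial xs) = map_pmf F (coins {..<?N})" if T: "T0 \<le> T" for T
  proof -
    have "1 * (8 * n) \<le> ?K * (8 * n)" by (rule mult_right_mono[OF kappa_pos]) simp
    moreover have "T0 = ?K * (5 * ?len + 3) + ?K * (8 * n) + ?K * ?R"
      unfolding T0_def time_bound_def by (simp only: distrib_left add.assoc)
    \<comment> \<open>Steps are bounded by costs: \<open>j0 \<le> w1\<close>, and four instructions
      for each of \<open>2 * n\<close> coins account for \<open>8 * n\<close>.\<close>
    ultimately have "j0 + 4 * ?N + ?K * ?R \<le> T0"
      using w1(2,3) by linarith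
    then have le: "j0 + 4 * ?N + ?K * ?R \<le> T" using T by (rule order_trans)
    define rest where "rest = T - (j0 + 4 * ?N)"
    have rest: "T = j0 + (4 * ?N + rest)" "?K * ?R \<le> rest" using le unfolding rest_def by linarith+
    have fin: "run P rest (?c \<xi>) = return_pmf (F \<xi>)" for \<xi>
    proof -
      from F[of \<xi>] obtain j where j: "(dstep P ^^ j) (?c \<xi>) (F \<xi>)" "j \<le> ?K * ?R" "halted P (F \<xi>)" by auto
      then have "rest = j + (rest - j)" using rest by simp
      then have "run P rest (?c \<xi>) = bind_pmf (run P j (?c \<xi>)) (run P (rest - j))" by (metis run_add)
      then show ?thesis using run_relpowp[OF j(1)] run_halted[OF j(3)] by (simp add: bind_return_pmf)
    qed
    have "run P T (initial xs) = bind_pmf (run P j0 (initial xs)) (run P (4 * ?N + rest))"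
      unfolding rest by (rule run_add)
    also have "\<dots> = run P (4 * ?N + rest) \<lparr>pc = 10, mem = M0, cost = w1\<rparr>"
      using run_relpowp[OF w1(1)] by (simp add: init[symmetric] bind_return_pmf)
    also have "\<dots> = bind_pmf (map_pmf ?c (coins {..<?N})) (run P rest)"
      unfolding run_add toss ..
    also have "\<dots> = bind_pmf (coins {..<?N}) (\<lambda>\<xi>. return_pmf (F \<xi>))"
      by (simp only: bind_map_pmf fin)
    finally show ?thesis by (simp only: map_pmf_def)
  qed
  moreover have "?S \<xi> a = ?S \<xi>' a" if eq: "\<forall>i\<in>{n..<2*n}. \<xi> i = \<xi>' i" and a: "a \<in> {4, 5, 6, 7, 8, 9}" for \<xi> \<xi>' a
  proof -
    \<comment> \<open>The two initial states differ in the coin array only, so exchanging that array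
      turns one into the other.\<close>
    define s1 where "s1 = (s0 \<xi>')(2 := s0 \<xi> 2)"
    have "exec (main_prog e) s1 a = exec (main_prog e) (s0 \<xi>') a"
      unfolding s1_def
    proof (rule exec_main_independent[OF _ a])
      fix t :: state assume t: "t 2 = s0 \<xi>' 2" "t 0 0 = s0 \<xi>' 1 1" "t 0 16 < t 0 0"
      show "val e (t(2 := s0 \<xi> 2)) = val e t"
      proof (rule independent)
        fix i assume i: "n \<le> i" "i < 2 * n"
        then have "\<xi> i = \<xi>' i" using eq by auto
        then have "s0 \<xi> 2 i = s0 \<xi>' 2 i"
          using coin[where \<xi> = \<xi> and i = i] coin[where \<xi> = \<xi>' and i = i] i by simp
        then show "s0 \<xi> 2 i = t 2 i" by (simp only: t(1))
      next
        show "t 0 0 = n" using t(2) input1[where i = 1 and \<xi> = \<xi>'] xs(2) len4 by simp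
        then show "t 0 16 < n" using t(3) by simp
      qed
    qed
    moreover have "s1 = s0 \<xi>"
    proof (intro ext)
      fix b i
      show "s1 b i = s0 \<xi> b i"
        using other[where \<xi> = \<xi> and a = b and i = i] other[where \<xi> = \<xi>' and a = b and i = i]
        by (cases "b = 2") (simp_all add: s1_def s0_def)
    qed
    ultimately show ?thesis by simp
  qed
  ultimately have "(\<forall>T\<ge>T0. run P T (initial xs) = map_pmf F (coins {..<2*n})) \<and>
    (\<forall>\<xi>. halted P (F \<xi>) \<and> cost (F \<xi>) \<le> T0 \<and>
      input.outcome n m cap C us vs nums dens (flag \<xi>) \<xi> (?S \<xi>) \<and> (\<forall>y<2*n+m. mem (F \<xi>) y = ?S \<xi> 13 y)) \<and>
    (\<forall>\<xi> \<xi>' a. (\<forall>i\<in>{n..<2*n}. \<xi> i = \<xi>' i) \<longrightarrow> a \<in> {4, 5, 6, 7, 8, 9} \<longrightarrow> ?S \<xi> a = ?S \<xi>' a)"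
    using F by (intro conjI allI impI) blast+
  then show ?thesis by (rule exI[of _ F, OF exI[of _ ?S]])
qed

text \<open>Only three instructions are executed, and every charged number on this path is 0 or 1,
  hence the bound in terms of \<open>kappa 1\<close>.\<close>

lemma machine_trivial:
  assumes "2 \<le> length xs" "xs ! 0 < 2" "3 * kappa 1 \<le> T"
  shows "\<exists>w. run (machine e) T (initial xs) =
      return_pmf \<lparr>pc = length (machine e), mem = (mem (initial xs))(0 := 0), cost = w\<rparr> \<and> w \<le> 3 * kappa 1"
proof -
  let ?P = "machine e" and ?m = "mem (initial xs)"
  have "length ?P = 14 + length (compile 14 0 (main_prog e)) + 12"
    by (simp add: machine_def Let_def length_entry_code length_exit_code)
  then have jump: "?P ! 2 = jump (length ?P)"
    by (simp add: machine_def Let_def nth_append length_entry_code) (simp add: entry_code_def)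
  have code: "?P ! 0 = IfLess (Const 1) (At (Cell 1)) 3" "?P ! 1 = Arith Plus (Cell 0) (Const 0) (Const 0)"
    and len: "2 < length ?P" "1 < length ?P" "0 < length ?P"
    by (simp_all add: machine_def Let_def entry_code_def exit_code_def)
  have m1: "?m 1 = xs ! 0" using assms(1) by (simp add: initial_def)
  have "reaches ?P (kappa 1) 1 0 ?m 1 ?m"
    using reaches_IfLess[OF len(3) code(1), of 1 ?m] m1 assms(2) by simp
  moreover have "reaches ?P (kappa 1) 1 1 ?m 2 (?m(0 := 0))"
    using reaches_Arith[OF len(2) code(2), of 1 ?m] by (simp add: eval_nat_numeral)
  moreover have "reaches ?P (kappa 1) 1 2 (?m(0 := 0)) (length ?P) (?m(0 := 0))"
    using reaches_jump[OF len(1) jump, of 1] by simp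
  ultimately have "reaches ?P (kappa 1) (1 + 1 + 1) 0 ?m (length ?P) (?m(0 := 0))"
    by (blast intro: reaches_trans)
  then obtain j w where w: "(dstep ?P ^^ j) \<lparr>pc = 0, mem = ?m, cost = 0\<rparr> \<lparr>pc = length ?P, mem = ?m(0 := 0), cost = w\<rparr>"
    "j \<le> w" "w \<le> kappa 1 * (1 + 1 + 1)"
    unfolding reaches_def by (metis add_0)
  have "T = j + (T - j)" using w assms(3) by simp
  then have "run ?P T (initial xs) = bind_pmf (run ?P j (initial xs)) (run ?P (T - j))" by (metis run_add)
  moreover have "initial xs = \<lparr>pc = 0, mem = ?m, cost = 0\<rparr>" by (simp add: initial_def)
  ultimately have "run ?P T (initial xs) = return_pmf \<lparr>pc = length ?P, mem = ?m(0 := 0), cost = w\<rparr>"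
    using run_relpowp[OF w(1)] by (simp add: bind_return_pmf run_halted halted_def)
  then show ?thesis using w by auto
qed


section \<open>Solutions and their expected revenue\<close>

definition fst_end :: "pricing_instance \<Rightarrow> nat \<Rightarrow> nat" where "fst_end I j = fst (customers I ! j)"
definition snd_end :: "pricing_instance \<Rightarrow> nat \<Rightarrow> nat" where "snd_end I j = fst (snd (customers I ! j))"
definition num :: "pricing_instance \<Rightarrow> nat \<Rightarrow> nat" where
  "num I j = nat (fst (quotient_of (snd (snd (customers I ! j)))))"
definition den :: "pricing_instance \<Rightarrow> nat \<Rightarrow> nat" where
  "den I j = nat (snd (quotient_of (snd (snd (customers I ! j)))))"

lemma customer_eq: "customers I ! j = (fst_end I j, snd_end I j, snd (snd (customers I ! j)))"
  by (simp add: fst_end_def snd_end_def)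

lemma ends_customer: "ends (customers I ! j) = {fst_end I j, snd_end I j}"
  by (subst customer_eq) simp

lemma bundle_price_customer: "bundle_price p (customers I ! j) = p (fst_end I j) + p (snd_end I j)"
  by (subst customer_eq) simp

lemma instance_edge:
  assumes "pricing_instance I" "j < nedges I"
  shows "fst_end I j < nverts I" "snd_end I j < nverts I" "fst_end I j \<noteq> snd_end I j"
    "0 < den I j" "real_of_rat (budget (customers I ! j)) = real (num I j) / real (den I j)"
proof -
  obtain u v b where c: "customers I ! j = (u, v, b)" by (cases "customers I ! j")
  have in_set: "(u, v, b) \<in> set (customers I)" using assms(2) c by (metis nth_mem)
  then have *: "u < nverts I" "v < nverts I" "u \<noteq> v" "b \<ge> 0"
    using assms(1) by (auto simp: pricing_instance_def)
  then show "fst_end I j < nverts I" "snd_end I j < nverts I" "fst_end I j \<noteq> snd_end I j"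
    by (simp_all add: fst_end_def snd_end_def c)
  obtain x y where q: "quotient_of b = (x, y)" by (cases "quotient_of b")
  have y: "0 < y" using quotient_of_denom_pos[OF q] .
  have b: "b = of_int x / of_int y" using quotient_of_div[OF q] .
  then have x: "0 \<le> x" using * y by (simp add: zero_le_divide_iff)
  show "0 < den I j" using y by (simp add: den_def c q)
  have "real_of_rat b = real_of_int x / real_of_int y" unfolding b by (simp add: of_rat_divide)
  moreover have "num I j = nat x" "den I j = nat y" by (simp_all add: num_def den_def c q)
  ultimately show "real_of_rat (budget (customers I ! j)) = real (num I j) / real (den I j)"
    using x y by (simp add: c)
qed

lemma simple_ends:
  assumes "simple I" "i < nedges I" "j < nedges I" "{fst_end I i, snd_end I i} = {fst_end I j, snd_end I j}"
  shows "i = j"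
  using assms by (auto simp: simple_def distinct_conv_nth ends_customer[symmetric])

lemma uniform_nth:
  assumes "uniform_capacity I" "v < nverts I" "w < nverts I"
  shows "capacities I ! v = capacities I ! w"
  using assms unfolding uniform_capacity_def by (metis nth_mem)

locale pricing = input "nverts I" "nedges I" cap C W k "fst_end I" "snd_end I" "num I" "den I" flag
  for I :: pricing_instance and cap C W k :: nat and flag :: "nat \<Rightarrow> nat" +
  assumes inst: "pricing_instance I" and simple_inst: "simple I" and uniform: "uniform_capacity I"
    and two: "2 \<le> nverts I" and cap_eq: "cap = encode_capacity (capacities I ! 1)"
begin

abbreviation "n \<equiv> nverts I"
abbreviation "m \<equiv> nedges I"

text \<open>No set of customers has more than \<open>m\<close> elements, so cutting the capacity
  down to \<open>m\<close> does not change the constraint; this also turns an infinite capacity into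
  a number.\<close>

lemma mu_le_iff:
  assumes "X \<subseteq> {..<m}" "w < n"
  shows "enat (card X) \<le> capacities I ! w \<longleftrightarrow> card X \<le> mu"
proof -
  have "card X \<le> m" using card_mono[OF _ assms(1)] by simp
  moreover have "capacities I ! w = capacities I ! 1" by (rule uniform_nth) (use uniform assms two in auto)
  ultimately show ?thesis
    unfolding mu_def unfolding cap_eq by (cases "capacities I ! 1") auto
qed

lemma D_pos: "0 < D"
  unfolding D_def by (rule prod_pos) (use dens in auto)

lemma bud_D:
  assumes "j < m" "flag (fst_end I j) \<noteq> flag (snd_end I j)"
  shows "real (bud j) / real D = real_of_rat (budget (customers I ! j))"
proof -
  have "den I j dvd D" unfolding D_def by (rule dvd_prodI) (use assms in auto)
  then have "real (D div den I j) = real D / real (den I j)" by (rule real_of_nat_div)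
  then show ?thesis
    using assms instance_edge[OF inst assms(1)] D_pos by (simp add: bud_def)
qed

lemma flags_lft_rgt:
  assumes "j < m" "0 < bud j" shows "flag (lft j) = 1" "flag (rgt j) = 0"
  using assms flag_le[of "fst_end I j"] flag_le[of "snd_end I j"] ends[OF assms(1)]
  by (auto simp: bud_def lft_def rgt_def split: if_splits)

lemma ends_lft_rgt: "ends (customers I ! j) = {lft j, rgt j}"
  "bundle_price p (customers I ! j) = p (lft j) + p (rgt j)"
  by (auto simp: ends_customer bundle_price_customer lft_def rgt_def)

definition sold_offer :: "state \<Rightarrow> (nat \<Rightarrow> bool) \<Rightarrow> nat \<Rightarrow> nat" where
  "sold_offer S \<omega> j = S 8 (if \<omega> (S 5 j) then j + m else j)"

definition sold_set :: "state \<Rightarrow> (nat \<Rightarrow> bool) \<Rightarrow> nat set" where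
  "sold_set S \<omega> = {j. j < m \<and> 0 < sold_offer S \<omega> j \<and> rank {f. f < m \<and> S 6 f = S 6 j} (sold_offer S \<omega>) j < mu}"

text \<open>A vertex with a nonzero price is the left end of a customer of positive scaled budget,
  hence flagged. So right ends are free and a sold customer pays its accepted offer. The ranking
  enforces the right capacities; the left ones hold for the chosen sets and survive
  rejections.\<close>

lemma solution:
  assumes out: "outcome \<omega> S" and M: "\<forall>y<2*n+m. M y = S 13 y"
  defines "sol \<equiv> decode_pricing I M"
  shows "feasible I sol" "\<And>v. v < n \<Longrightarrow> flag v = 0 \<Longrightarrow> fst sol v = 0"
    "revenue I sol = (\<Sum>j\<in>sold_set S \<omega>. real (sold_offer S \<omega> j)) / real D"
proof -
  let ?p = "fst sol" and ?F = "snd sol"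
  note out = out[unfolded outcome_def]
  have p: "?p v = real (S 9 (if \<omega> v then v + n else v)) / real D" if "v < n" for v
  proof -
    have "M (2 * v) = S 9 (if \<omega> v then v + n else v)" "M (2 * v + 1) = D"
      using M out that by simp_all
    then show ?thesis by (simp add: sol_def decode_pricing_def)
  qed
  have F: "?F = sold_set S \<omega>"
    using M out by (auto simp: sol_def decode_pricing_def sold_set_def sold_offer_def[abs_def])
  have side: "lft j < n" "rgt j < n" if "j < m" for j using lft_rgt[OF that] by auto
  have "feasible I sol \<and> (\<forall>v<n. flag v = 0 \<longrightarrow> ?p v = 0) \<and>
    revenue I sol = (\<Sum>j\<in>sold_set S \<omega>. real (sold_offer S \<omega> j)) / real D"
  proof (cases "mu = 0")
    case True
    then have empty: "?F = {}" "sold_set S \<omega> = {}" and zero: "\<And>v. v < n \<Longrightarrow> ?p v = 0"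
      using F p out by (auto simp: sold_set_def)
    then have "feasible I (?p, ?F)" "revenue I (?p, ?F) = 0"
      by (simp_all add: feasible_def revenue_def zero_enat_def[symmetric])
    then have "feasible I sol" "revenue I sol = 0" by (simp_all only: prod.collapse)
    then show ?thesis using empty zero by simp
  next
    case False
    then interpret mk: market m n mu "S 5" "S 6" "S 4" "S 7" using out by simp
    have reach: "mk.reach (2*n) (S 8) (S 9)" using out False by simp
    note facts = mk.reach_facts[OF reach]
    have loc: "S 5 j = lft j" "S 6 j = rgt j" "S 4 j = bud j" "S 5 (j + m) = lft j + n"
      "S 6 (j + m) = rgt j" "S 4 (j + m) = bud j" if "j < m" for j
      using out that mk.l_copy[OF that] mk.r_copy[OF that] mk.B_copy[OF that] by simp_all
    have priced: "flag v = 1" if v: "v < n" and nz: "S 9 (if \<omega> v then v + n else v) \<noteq> 0" for v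
    proof -
      have "(if \<omega> v then v + n else v) < 2*n" using v by auto
      then obtain e where e: "e < 2*m" "S 5 e = (if \<omega> v then v + n else v)" "0 < S 4 e"
        using facts nz by blast
      obtain j where j: "j < m" "e = j \<or> e = j + m"
        using e(1) by (cases "e < m") (auto intro!: that[of "e - m"] simp: that)
      have "lft j = v" "0 < bud j" using e j loc[OF j(1)] side[OF j(1)] v by (auto split: if_splits)
      then show ?thesis using flags_lft_rgt[OF j(1)] by simp
    qed
    have zero: "?p v = 0" if "v < n" "flag v = 0" for v
    proof -
      have "S 9 (if \<omega> v then v + n else v) = 0"
      proof (rule ccontr)
        assume "S 9 (if \<omega> v then v + n else v) \<noteq> 0"
        from priced[OF that(1) this] that(2) show False by simp
      qed
      then show ?thesis using p[OF that(1)] by simp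
    qed
    have sold: "0 < bud j" "?p (lft j) = sold_offer S \<omega> j / real D" "?p (rgt j) = 0" "sold_offer S \<omega> j \<le> bud j"
      if "j \<in> sold_set S \<omega>" for j
    proof -
      have j: "j < m" "0 < sold_offer S \<omega> j" using that by (auto simp: sold_set_def)
      let ?e = "if \<omega> (lft j) then j + m else j"
      have e: "sold_offer S \<omega> j = S 8 ?e" "?e < 2*m" using j loc by (auto simp: sold_offer_def)
      then have A: "S 8 ?e = S 9 (S 5 ?e)" "S 8 ?e \<le> S 4 ?e" using facts j by force+
      have "S 5 ?e = (if \<omega> (lft j) then lft j + n else lft j)" "S 4 ?e = bud j" using loc[OF j(1)] by auto
      then show "?p (lft j) = sold_offer S \<omega> j / real D" "0 < bud j" "sold_offer S \<omega> j \<le> bud j"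
        using A e j p[of "lft j"] side[OF j(1)] by auto
      then show "?p (rgt j) = 0" using zero side flags_lft_rgt[OF j(1)] j(1) by auto
    qed
    have jm: "j < m" if "j \<in> sold_set S \<omega>" for j using that by (simp add: sold_set_def)
    have fin: "finite (sold_set S \<omega>)" by (rule finite_subset[of _ "{..<m}"]) (auto simp: jm)
    have price: "bundle_price ?p (customers I ! j) = sold_offer S \<omega> j / real D" if "j \<in> sold_set S \<omega>" for j
      using sold[OF that] by (simp add: ends_lft_rgt)
    have cap: "card {j \<in> sold_set S \<omega>. w \<in> ends (customers I ! j)} \<le> mu" if w: "w < n" for w
    proof (cases "flag w = 0")
      case True
      have "{j \<in> sold_set S \<omega>. w \<in> ends (customers I ! j)} \<subseteq> top_set mu {f. f < m \<and> S 6 f = w} (sold_offer S \<omega>)"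
      proof
        fix j assume j: "j \<in> {j \<in> sold_set S \<omega>. w \<in> ends (customers I ! j)}"
        then have "rgt j = w" using True sold(1)[of j] flags_lft_rgt[of j] jm by (auto simp: ends_lft_rgt)
        then have "S 6 j = w" using j jm loc by auto
        then show "j \<in> top_set mu {f. f < m \<and> S 6 f = w} (sold_offer S \<omega>)"
          using j by (auto simp: top_set_def sold_set_def)
      qed
      from card_mono[OF _ this] have "card {j \<in> sold_set S \<omega>. w \<in> ends (customers I ! j)} \<le>
          card (top_set mu {f. f < m \<and> S 6 f = w} (sold_offer S \<omega>))"
        using finite_subset[OF top_set_subset, of "{f. f < m \<and> S 6 f = w}"] by simp
      then show ?thesis using card_top_set[of "{f. f < m \<and> S 6 f = w}" mu "sold_offer S \<omega>"] by simp
    next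
      case False
      \<comment> \<open>The coin of \<open>w\<close> fixes one of its copies, and the customers sold
        at \<open>w\<close> embed into the edges of this copy with a positive offer.\<close>
      let ?u = "if \<omega> w then w + n else w" and ?f = "\<lambda>j. if \<omega> w then j + m else j"
      have "?f ` {j \<in> sold_set S \<omega>. w \<in> ends (customers I ! j)} \<subseteq> {e. e < 2*m \<and> S 5 e = ?u \<and> 0 < S 8 e}"
      proof (clarify)
        fix j assume j: "j \<in> sold_set S \<omega>" "w \<in> ends (customers I ! j)"
        then have "lft j = w" using False sold(1)[of j] flags_lft_rgt[of j] jm by (auto simp: ends_lft_rgt)
        then show "?f j < 2*m \<and> S 5 (?f j) = ?u \<and> 0 < S 8 (?f j)"
          using j jm[OF j(1)] loc[OF jm[OF j(1)]] by (auto simp: sold_set_def sold_offer_def)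
      qed
      then have "card (?f ` {j \<in> sold_set S \<omega>. w \<in> ends (customers I ! j)}) \<le>
          card {e. e < 2*m \<and> S 5 e = ?u \<and> 0 < S 8 e}"
        by (rule card_mono[rotated]) auto
      also have "\<dots> \<le> mu" using facts w by auto
      also have "card (?f ` {j \<in> sold_set S \<omega>. w \<in> ends (customers I ! j)}) =
          card {j \<in> sold_set S \<omega>. w \<in> ends (customers I ! j)}"
        by (rule card_image) (auto simp: inj_on_def)
      finally show ?thesis .
    qed
    have "feasible I (?p, ?F)"
      unfolding feasible_def F split_conv
    proof (intro conjI allI impI ballI)
      fix j assume j: "j \<in> sold_set S \<omega>"
      then have "flag (fst_end I j) \<noteq> flag (snd_end I j)" using sold(1)[OF j] by (auto simp: bud_def)
      then have "real_of_rat (budget (customers I ! j)) = real (bud j) / real D" using bud_D[OF jm[OF j]] by simp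
      then show "bundle_price ?p (customers I ! j) \<le> real_of_rat (budget (customers I ! j))"
        using price[OF j] sold(4)[OF j] by (simp add: divide_right_mono)
    next
      fix w assume w: "w < n"
      have "{j \<in> sold_set S \<omega>. w \<in> ends (customers I ! j)} \<subseteq> {..<m}" using jm by auto
      from mu_le_iff[OF this w] cap[OF w]
      show "enat (card {j \<in> sold_set S \<omega>. w \<in> ends (customers I ! j)}) \<le> capacities I ! w" by simp
    qed (use p jm in auto)
    moreover have "revenue I (?p, ?F) = (\<Sum>j\<in>sold_set S \<omega>. real (sold_offer S \<omega> j)) / real D"
      unfolding revenue_def F split_conv using price by (simp add: sum_divide_distrib)
    ultimately show ?thesis using zero by simp
  qed
  then show "feasible I sol" "\<And>v. v < n \<Longrightarrow> flag v = 0 \<Longrightarrow> fst sol v = 0"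
    "revenue I sol = (\<Sum>j\<in>sold_set S \<omega>. real (sold_offer S \<omega> j)) / real D" by auto
qed

text \<open>The side coins \<open>g\<close> are fixed and the average is over the rounding coins
  \<open>f\<close>; the assumption \<open>same\<close> makes the half-offers constant in this
  average, so the bound for one fixed market applies.\<close>

lemma expected_solution:
  assumes out: "\<And>f. outcome (\<lambda>x. if x < n then f x else g x) (S f)"
    and same: "\<And>f a. a \<in> {4, 5, 6, 7, 8, 9} \<Longrightarrow> S f a = S0 a"
    and opt: "feasible I (p, F)"
  shows "5/9 * (\<Sum>j | j \<in> F \<and> flag (fst_end I j) \<noteq> flag (snd_end I j). p (lft j)) \<le>
    measure_pmf.expectation (coins {..<n})
      (\<lambda>f. (\<Sum>j\<in>sold_set (S f) (\<lambda>x. if x < n then f x else g x).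
         real (sold_offer (S f) (\<lambda>x. if x < n then f x else g x) j)) / real D)"
proof -
  let ?F = "{j. j \<in> F \<and> flag (fst_end I j) \<noteq> flag (snd_end I j)}"
  let ?h = "\<lambda>f x. if x < n then f x else g x"
  have F: "F \<subseteq> {..<m}" and p: "\<And>v. v < n \<Longrightarrow> 0 \<le> p v"
    and afford: "\<And>j. j \<in> F \<Longrightarrow> p (lft j) + p (rgt j) \<le> real_of_rat (budget (customers I ! j))"
    and cap: "\<And>w. w < n \<Longrightarrow> enat (card {j \<in> F. w \<in> ends (customers I ! j)}) \<le> capacities I ! w"
    using opt by (auto simp: feasible_def ends_lft_rgt)
  have finF: "finite F" using F finite_subset by auto
  have deg: "card {j \<in> ?F. lft j = w} \<le> mu \<and> card {j \<in> ?F. rgt j = w} \<le> mu" for w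
  proof (cases "w < n")
    case True
    have "{j \<in> F. w \<in> ends (customers I ! j)} \<subseteq> {..<m}" using F by auto
    from mu_le_iff[OF this True] cap[OF True] have le: "card {j \<in> F. w \<in> ends (customers I ! j)} \<le> mu" by simp
    have "card {j \<in> ?F. lft j = w} \<le> card {j \<in> F. w \<in> ends (customers I ! j)}"
      "card {j \<in> ?F. rgt j = w} \<le> card {j \<in> F. w \<in> ends (customers I ! j)}"
      by (rule card_mono, use finF in \<open>auto simp: ends_lft_rgt\<close>)+
    then show ?thesis using le by simp
  next
    case False
    then have "{j \<in> ?F. lft j = w} = {}" "{j \<in> ?F. rgt j = w} = {}" using F lft_rgt by auto
    then show ?thesis by (simp only: card.empty) simp
  qed
  show ?thesis
  proof (cases "mu = 0")
    case True
    have "?F = {}"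
    proof (rule ccontr)
      assume "?F \<noteq> {}"
      then obtain j where j: "j \<in> ?F" by blast
      then have "0 < card {i \<in> ?F. lft i = lft j}" using finF by (auto simp: card_gt_0_iff)
      then show False using deg[of "lft j"] True by simp
    qed
    then show ?thesis using True by (simp only: sold_set_def) simp
  next
    case False
    have out0: "outcome (?h (\<lambda>_. False)) (S (\<lambda>_. False))" by (rule out)
    then have mk: "market m n mu (S0 5) (S0 6) (S0 4) (S0 7)"
      and reach: "market.reach m n mu (S0 5) (S0 6) (S0 4) (S0 7) (2*n) (S0 8) (S0 9)"
      using False by (simp_all add: outcome_def same)
    interpret mk: market m n mu "S0 5" "S0 6" "S0 4" "S0 7" by (rule mk)
    have loc: "S0 5 j = lft j" "S0 6 j = rgt j" "S0 4 j = bud j" if "j < m" for j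
      using out0 that by (simp_all add: outcome_def same)
    \<comment> \<open>The benchmark price at a left vertex is the least budget among its customers
      in the given solution: all of them can afford it, and it is at least the price there, because
      each of them affords that price.\<close>
    define sg where "sg u = arg_min_on bud {j \<in> ?F. lft j = u}" for u
    have sg: "sg (lft j) \<in> ?F" "lft (sg (lft j)) = lft j" "bud (sg (lft j)) \<le> bud j" if "j \<in> ?F" for j
    proof -
      have ne: "{i \<in> ?F. lft i = lft j} \<noteq> {}" and fin: "finite {i \<in> ?F. lft i = lft j}" using that finF by auto
      show "sg (lft j) \<in> ?F" "lft (sg (lft j)) = lft j"
        using arg_min_if_finite(1)[OF fin ne, of bud] by (auto simp: sg_def)
      show "bud (sg (lft j)) \<le> bud j"
        unfolding sg_def by (rule arg_min_least[OF fin ne]) (use that in auto)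
    qed
    have Fm: "j < m" if "j \<in> ?F" for j using that F by auto
    have "p (lft j) \<le> real (bud (sg (lft j))) / real D" if "j \<in> ?F" for j
    proof -
      have s: "sg (lft j) \<in> ?F" "sg (lft j) < m" using sg[OF that] Fm by auto
      have "p (lft j) + p (rgt (sg (lft j))) \<le> real_of_rat (budget (customers I ! sg (lft j)))"
        using afford[of "sg (lft j)"] s sg(2)[OF that] by auto
      moreover have "0 \<le> p (rgt (sg (lft j)))" using p lft_rgt[OF s(2)] by auto
      ultimately show ?thesis using bud_D[OF s(2)] s(1) by simp
    qed
    then have "(\<Sum>j\<in>?F. p (lft j)) \<le> (\<Sum>j\<in>?F. real (bud (sg (lft j))) / real D)" by (rule sum_mono)
    also have "\<dots> = (\<Sum>j\<in>?F. real (S0 4 (sg (S0 5 j)))) / real D"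
      unfolding sum_divide_distrib by (intro sum.cong refl) (use loc Fm sg in auto)
    finally have "5/9 * (\<Sum>j\<in>?F. p (lft j)) \<le> (5/9 * (\<Sum>j\<in>?F. real (S0 4 (sg (S0 5 j))))) / real D" by simp
    also have "\<dots> \<le> measure_pmf.expectation (coins {..<n}) (\<lambda>f. \<Sum>j\<in>mk.sold (S0 8) f. real (mk.offer (S0 8) f j)) / real D"
    proof (intro divide_right_mono mk.expected_revenue[OF reach])
      show "?F \<subseteq> {..<m}" using Fm by auto
      fix j assume "j \<in> ?F"
      then show "sg (S0 5 j) < m \<and> S0 5 (sg (S0 5 j)) = S0 5 j \<and> S0 4 (sg (S0 5 j)) \<le> S0 4 j"
        using loc Fm sg by auto
    next
      fix w
      have "{j \<in> ?F. S0 5 j = w} = {j \<in> ?F. lft j = w}" "{j \<in> ?F. S0 6 j = w} = {j \<in> ?F. rgt j = w}"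
        using loc Fm by auto
      then show "card {j \<in> ?F. S0 5 j = w} \<le> mu" "card {j \<in> ?F. S0 6 j = w} \<le> mu" using deg[of w] by simp_all
    qed simp
    also have "\<dots> = measure_pmf.expectation (coins {..<n}) (\<lambda>f. (\<Sum>j\<in>sold_set (S f) (?h f). real (sold_offer (S f) (?h f) j)) / real D)"
    proof -
      define H where "H f x = (if x < n then f x else g x)" for f x
      have H: "(\<lambda>x. if x < n then f x else g x) = H f" for f by (simp add: H_def fun_eq_iff)
      have offer: "sold_offer (S f) (H f) j = mk.offer (S0 8) f j" if "j < m" for f j
        using that loc lft_rgt by (simp add: sold_offer_def mk.offer_def same H_def)
      have sold: "sold_set (S f) (H f) = mk.sold (S0 8) f" for f
      proof -
        have "rank {i. i < m \<and> S0 6 i = S0 6 j} (sold_offer (S f) (H f)) j =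
          rank {i. i < m \<and> S0 6 i = S0 6 j} (mk.offer (S0 8) f) j" if "j < m" for j
          by (rule rank_cong) (use that offer in auto)
        moreover have "S f 6 = S0 6" by (rule same) simp
        ultimately show ?thesis by (auto simp: sold_set_def mk.sold_def offer)
      qed
      have "(\<Sum>j\<in>sold_set (S f) (H f). real (sold_offer (S f) (H f) j)) = (\<Sum>j\<in>mk.sold (S0 8) f. real (mk.offer (S0 8) f j))" for f
        unfolding sold by (rule sum.cong) (auto simp: offer mk.sold_def)
      then show ?thesis unfolding H by simp
    qed
    finally show ?thesis .
  qed
qed

end

section \<open>Averages over side coins and rounding coins\<close>

lemma coins_split: "coins {..<2*n} = bind_pmf (coins {n..<2*n}) (\<lambda>g. map_pmf (\<lambda>f x. if x < n then f x else g x) (coins {..<n}))"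
proof -
  have eq: "{..<2*n} = {..<n} \<union> {n..<2*n}" by auto
  have "coins {..<2*n} = map_pmf (\<lambda>(f, g) x. if x \<in> {..<n} then f x else g x) (pair_pmf (coins {..<n}) (coins {n..<2*n}))"
    unfolding eq by (rule Pi_pmf_union) auto
  also have "\<dots> = bind_pmf (coins {n..<2*n}) (\<lambda>g. map_pmf (\<lambda>f x. if x < n then f x else g x) (coins {..<n}))"
    unfolding pair_pmf_def map_bind_pmf map_return_pmf map_pmf_def
    by (subst bind_commute_pmf) (simp add: bind_assoc_pmf bind_return_pmf)
  finally show ?thesis .
qed

lemma expectation_bind_ge:
  fixes h :: "'b \<Rightarrow> real"
  assumes "finite (set_pmf p)" "\<And>x. finite (set_pmf (q x))" "\<And>x. v x \<le> measure_pmf.expectation (q x) h"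
  shows "measure_pmf.expectation p v \<le> measure_pmf.expectation (bind_pmf p q) h"
proof -
  have "measure_pmf.expectation p v = (\<Sum>x\<in>set_pmf p. pmf p x *\<^sub>R v x)"
    by (rule integral_measure_pmf) (use assms in auto)
  also have "\<dots> \<le> (\<Sum>x\<in>set_pmf p. pmf p x *\<^sub>R measure_pmf.expectation (q x) h)"
    by (intro sum_mono scaleR_left_mono assms) auto
  also have "\<dots> = measure_pmf.expectation (bind_pmf p q) h"
    by (rule pmf_expectation_bind[symmetric]) (use assms in auto)
  finally show ?thesis .
qed

text \<open>The indicator is a product with one factor per coin, so independence gives
  \<open>1/2 * 1/2\<close>.\<close>

lemma expectation_two_coins:
  assumes "finite X" "a \<in> X" "b \<in> X" "a \<noteq> b"
  shows "measure_pmf.expectation (coins X) (\<lambda>g. of_bool (g a \<and> \<not> g b)) = (1/4 :: real)"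
proof -
  let ?h = "\<lambda>x v. if x = a then of_bool v else if x = b then of_bool (\<not> v) else (1 :: real)"
  have X: "X = insert a (insert b (X - {a, b}))" using assms by auto
  have "(\<Prod>x\<in>X. ?h x (g x)) = of_bool (g a \<and> \<not> g b)" for g
  proof -
    have "(\<Prod>x\<in>insert a (insert b (X - {a, b})). ?h x (g x)) = ?h a (g a) * (?h b (g b) * (\<Prod>x\<in>X - {a, b}. ?h x (g x)))"
      using assms by simp
    also have "(\<Prod>x\<in>X - {a, b}. ?h x (g x)) = 1" by (rule prod.neutral) auto
    finally show ?thesis using X assms(4) by auto
  qed
  then have "measure_pmf.expectation (coins X) (\<lambda>g. of_bool (g a \<and> \<not> g b)) =
    measure_pmf.expectation (coins X) (\<lambda>g. \<Prod>x\<in>X. ?h x (g x))" by simp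
  also have "\<dots> = (\<Prod>x\<in>X. measure_pmf.expectation (bernoulli_pmf (1/2)) (?h x))"
    by (rule expectation_prod_Pi_pmf) (use assms in \<open>auto intro: integrable_measure_pmf_finite\<close>)
  also have "\<dots> = (\<Prod>x\<in>X. if x = a \<or> x = b then 1/2 else 1)"
    by (rule prod.cong) (use assms in auto)
  also have "\<dots> = (\<Prod>x\<in>insert a (insert b (X - {a, b})). if x = a \<or> x = b then 1/2 else 1)"
    using X by simp
  also have "\<dots> = 1/2 * (1/2 * (\<Prod>x\<in>X - {a, b}. if x = a \<or> x = b then 1/2 else 1))" using assms by simp
  also have "(\<Prod>x\<in>X - {a, b}. if x = a \<or> x = b then 1/2 else (1::real)) = 1" by (rule prod.neutral) auto
  finally show ?thesis by simp
qed


section \<open>Polynomial bounds\<close>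

lemma less_power_nbits: "x < 2 ^ nbits x"
  using floor_log_exp2_gt[of x] by (simp add: nbits_def)

lemma nbits_le: assumes "x < 2 ^ t" "0 < t" shows "nbits x \<le> t"
proof (cases "x = 0")
  case False
  then have "2 ^ floor_log x \<le> x" by (simp add: floor_log_exp2_le)
  then have "(2::nat) ^ floor_log x < 2 ^ t" using assms(1) by (rule le_less_trans)
  then have "floor_log x < t" by (rule power_less_imp_less_exp[rotated]) simp
  then show ?thesis by (simp add: nbits_def)
qed (use assms in \<open>simp add: nbits_def\<close>)

lemma nbits_le_input_size: "x \<in> set xs \<Longrightarrow> nbits x \<le> input_size xs"
  unfolding input_size_def using member_le_sum_list[of "nbits x" "map nbits xs"] by auto

lemma less_power_input_size: "x \<in> set xs \<Longrightarrow> x < 2 ^ input_size xs"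
  by (rule less_le_trans[OF less_power_nbits power_increasing[OF nbits_le_input_size]]) simp_all

lemma length_le_input_size: "length xs \<le> input_size xs"
proof -
  have "(\<Sum>x\<leftarrow>xs. 1) \<le> (\<Sum>x\<leftarrow>xs. nbits x)" by (rule sum_list_mono) (simp add: nbits_def)
  then show ?thesis by (simp add: input_size_def sum_list_triv)
qed

lemma length_encode_customers: "length (concat (map encode_customer cs)) = 4 * length cs"
  by (induction cs) (auto simp: length_concat split: prod.splits)

lemma length_encode_pricing: "length (encode_pricing I) = 2 + nverts I + 4 * nedges I"
  by (simp add: encode_pricing_def length_encode_customers)

lemma nth_encode_customers:
  "j < length cs \<Longrightarrow> c < 4 \<Longrightarrow> concat (map encode_customer cs) ! (4 * j + c) = encode_customer (cs ! j) ! c"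
proof (induction cs arbitrary: j)
  case (Cons a cs)
  have len: "length (encode_customer a) = 4" by (cases a) auto
  show ?case using Cons len by (cases j) (auto simp: nth_append)
qed simp

lemma nth_encode_pricing:
  shows "encode_pricing I ! 0 = nverts I" "encode_pricing I ! 1 = nedges I"
    "2 \<le> nverts I \<Longrightarrow> encode_pricing I ! 3 = encode_capacity (capacities I ! 1)"
    and "j < nedges I \<Longrightarrow> encode_pricing I ! (2 + nverts I + 4 * j) = fst_end I j \<and>
      encode_pricing I ! (3 + nverts I + 4 * j) = snd_end I j \<and>
      encode_pricing I ! (4 + nverts I + 4 * j) = num I j \<and> encode_pricing I ! (5 + nverts I + 4 * j) = den I j"
proof -
  have far: "encode_pricing I ! (2 + nverts I + i) = concat (map encode_customer (customers I)) ! i" for i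
    by (simp add: encode_pricing_def nth_append)
  show "encode_pricing I ! 0 = nverts I" "encode_pricing I ! 1 = nedges I" by (simp_all add: encode_pricing_def)
  show "encode_pricing I ! 3 = encode_capacity (capacities I ! 1)" if "2 \<le> nverts I"
    using that by (simp add: encode_pricing_def nth_append numeral_3_eq_3)
  show "encode_pricing I ! (2 + nverts I + 4 * j) = fst_end I j \<and>
      encode_pricing I ! (3 + nverts I + 4 * j) = snd_end I j \<and>
      encode_pricing I ! (4 + nverts I + 4 * j) = num I j \<and> encode_pricing I ! (5 + nverts I + 4 * j) = den I j"
    if j: "j < nedges I"
  proof -
    have "encode_customer (customers I ! j) = [fst_end I j, snd_end I j, num I j, den I j]"
      by (subst customer_eq) (simp add: num_def den_def)
    then show ?thesis
      using nth_encode_customers[OF j, of 0] nth_encode_customers[OF j, of 1] nth_encode_customers[OF j, of 2]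
        nth_encode_customers[OF j, of 3] far[of "4 * j"] far[of "4 * j + 1"] far[of "4 * j + 2"] far[of "4 * j + 3"]
      by (simp add: ac_simps numeral_2_eq_2 numeral_3_eq_3 eval_nat_numeral)
  qed
qed

text \<open>With \<open>C = 2 ^ (Z * Z + Z)\<close>, the factor \<open>2 * m * (m * C) + 1\<close>
  takes \<open>Z * Z + 3 * Z + 2\<close> in the exponent and \<open>(2 * m) ^ (2 * m)\<close> takes
  \<open>2 * (Z * Z) + 2 * Z\<close>; the constant 16 absorbs the linear terms.\<close>

definition wexp :: "nat \<Rightarrow> nat" where "wexp Z = 3 * (Z * Z) + 5 * Z + 16"

lemma word_bound:
  assumes "n \<le> Z" "m \<le> Z"
  shows "(2*m*(m*2^(Z*Z+Z)) + 1) * (2*m)^(2*m) + 16*(2^(Z*Z+Z) + n + m) + 200 \<le> (2::nat) ^ wexp Z"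
proof -
  let ?E = "3*(Z*Z) + 5*Z"
  have Z: "Z < 2 ^ Z" by simp
  then have m: "m \<le> 2 ^ Z" "n \<le> 2 ^ Z" using assms by linarith+
  have "2*m*(m*2^(Z*Z+Z)) \<le> 2*2^Z*(2^Z*2^(Z*Z+Z))" using m by (intro mult_le_mono) auto
  also have "\<dots> = 2^(Z*Z+3*Z+1)" by (simp add: power_add[symmetric] mult.assoc[symmetric] flip: power_Suc)
  finally have "2*m*(m*2^(Z*Z+Z)) \<le> 2^(Z*Z+3*Z+1)" .
  moreover have "(1::nat) \<le> 2^(Z*Z+3*Z+1)" by (rule one_le_power) simp
  moreover have "(2::nat)^(Z*Z+3*Z+2) = 2*2^(Z*Z+3*Z+1)" by simp
  ultimately have 1: "2*m*(m*2^(Z*Z+Z)) + 1 \<le> 2^(Z*Z+3*Z+2)" by linarith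
  have "(2*m)^(2*m) \<le> (2^(Z+1))^(2*m)" using m by (intro power_mono) auto
  also have "\<dots> = 2^((Z+1)*(2*m))" by (rule power_mult[symmetric])
  also have "\<dots> \<le> 2^(2*(Z*Z)+2*Z)"
  proof (rule power_increasing)
    have "(Z+1)*(2*m) \<le> (Z+1)*(2*Z)" using assms by (intro mult_le_mono) auto
    then show "(Z+1)*(2*m) \<le> 2*(Z*Z)+2*Z" by (simp add: algebra_simps)
  qed simp
  finally have "(2*m*(m*2^(Z*Z+Z)) + 1) * (2*m)^(2*m) \<le> 2^(Z*Z+3*Z+2) * 2^(2*(Z*Z)+2*Z)"
    using 1 by (intro mult_le_mono)
  also have "\<dots> = 2^(?E+2)" by (simp add: power_add[symmetric])
  finally have A: "(2*m*(m*2^(Z*Z+Z)) + 1) * (2*m)^(2*m) \<le> 4 * 2^?E" by (simp add: power_add)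
  have "(2::nat)^(Z*Z+Z) \<le> 2^?E" "(2::nat)^Z \<le> 2^?E" by (rule power_increasing; simp)+
  moreover have "(1::nat) \<le> 2^?E" by simp
  moreover have "(2::nat) ^ wexp Z = 65536 * 2^?E" by (simp add: wexp_def power_add)
  moreover have "A' + 16*(B + n + m) + 200 \<le> V" if "B \<le> P" "Q \<le> P" "1 \<le> P" "V = 65536 * P" "A' \<le> 4 * P" "m \<le> Q" "n \<le> Q"
    for A' B P Q V :: nat using that by simp
  ultimately show ?thesis using A m by blast
qed

lemma kappa_word: "kappa (size_bound (2 ^ wexp Z)) \<le> 8 * (wexp Z + 5)"
proof -
  have "(2::nat)^6 \<le> 2 ^ wexp Z" by (rule power_increasing) (simp_all add: wexp_def)
  then have "size_bound (2 ^ wexp Z) < 2 ^ (wexp Z + 5)" by (simp add: size_bound_def power_add)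
  then have "nbits (size_bound (2 ^ wexp Z)) \<le> wexp Z + 5" by (rule nbits_le) simp
  then show ?thesis by (simp add: kappa_def)
qed

section \<open>The time bound is a polynomial\<close>

definition polynomial :: "(nat \<Rightarrow> nat) \<Rightarrow> bool" where
  "polynomial f \<longleftrightarrow> (\<exists>q. \<forall>x. poly q x = f x)"

lemma polynomial_const: "polynomial (\<lambda>_. c)"
  unfolding polynomial_def by (rule exI[of _ "[:c:]"]) simp

lemma polynomial_id: "polynomial (\<lambda>x. x)"
  unfolding polynomial_def by (rule exI[of _ "[:0, 1:]"]) simp

lemma polynomial_add: "polynomial f \<Longrightarrow> polynomial g \<Longrightarrow> polynomial (\<lambda>x. f x + g x)"
  unfolding polynomial_def by (metis poly_add)

lemma polynomial_mult: "polynomial f \<Longrightarrow> polynomial g \<Longrightarrow> polynomial (\<lambda>x. f x * g x)"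
  unfolding polynomial_def by (metis poly_mult)

lemma polynomial_compose: "polynomial f \<Longrightarrow> polynomial g \<Longrightarrow> polynomial (\<lambda>x. f (g x))"
  unfolding polynomial_def by (metis poly_pcompose)

lemmas polynomial_intros = polynomial_const polynomial_id polynomial_add polynomial_mult

lemma polynomial_time: "polynomial (\<lambda>k. time k c)"
  by (induction c) (unfold time.simps, (intro polynomial_intros | assumption)+)

text \<open>This is \<open>time_bound\<close> with its parameters replaced by bounds in the input
  size \<open>Z\<close>: the length and both counts by \<open>Z\<close>, the loop bound by
  \<open>2 * Z\<close>, and \<open>kappa\<close> by the estimate \<open>kappa_word\<close>.\<close>

definition total_time :: "exp \<Rightarrow> nat \<Rightarrow> nat" where
  "total_time e Z = 8 * (wexp Z + 5) * ((5 * Z + 3) + 8 * Z + (time (2 * Z) (main_prog e) + (4 * (2 * Z + Z) + 8)))"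

lemma polynomial_total_time: "polynomial (total_time e)"
  unfolding total_time_def wexp_def
  by (intro polynomial_intros polynomial_compose[OF polynomial_time])

lemma time_bound_le:
  assumes "len \<le> Z" "n \<le> Z" "m \<le> Z"
  shows "time_bound e (2 ^ wexp Z) (2 * Z) len n m \<le> total_time e Z"
  unfolding time_bound_def total_time_def
  by (rule mult_le_mono[OF kappa_word]) (use assms in simp)

lemma kappa_1_le: "3 * kappa 1 \<le> total_time e Z"
proof -
  have "8 * 5 * 8 \<le> total_time e Z" unfolding total_time_def by (intro mult_le_mono) auto
  moreover have "nbits 1 = 1" by (simp add: nbits_def)
  ultimately show ?thesis by (simp add: kappa_def)
qed

text \<open>The interface between the machine and the two problems: only the expression
  \<open>e\<close> and its meaning \<open>flag\<close> are specific to a problem. In the bound on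
  the revenue the outer average is over the side coins; the rounding coins have already been
  averaged out for each of their outcomes.\<close>

lemma machine_solution:
  fixes flag :: "(nat \<Rightarrow> bool) \<Rightarrow> nat \<Rightarrow> nat" and I :: pricing_instance and xs ys :: "nat list"
  defines "n \<equiv> nverts I" and "m \<equiv> nedges I" and "Z \<equiv> input_size xs"
  assumes I: "pricing_instance I" "simple I" "uniform_capacity I" "2 \<le> n"
    and xs: "xs = encode_pricing I @ ys"
    and e: "wf_exp e" "temps_exp e \<le> 10"
    and flag_le: "\<And>\<xi> v. v < n \<Longrightarrow> flag \<xi> v \<le> 1"
    and flag_cong: "\<And>\<xi> \<xi>'. \<forall>i\<in>{n..<2*n}. \<xi> i = \<xi>' i \<Longrightarrow> flag \<xi> = flag \<xi>'"
    and src: "\<And>\<xi> v s. v < n \<Longrightarrow> s 0 16 = v \<Longrightarrow> s 0 0 = n \<Longrightarrow> s 0 1 = m \<Longrightarrow>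
       (\<And>i. 4 \<le> i \<Longrightarrow> i \<le> length xs \<Longrightarrow> s 1 i = xs ! (i - 1)) \<Longrightarrow>
       (\<And>i. i < 2 * n \<Longrightarrow> s 2 i = of_bool (\<xi> i)) \<Longrightarrow>
       bounded_exp (2 ^ wexp Z) e s \<and> val e s = flag \<xi> v"
    and independent: "\<And>g s. (\<And>i. n \<le> i \<Longrightarrow> i < 2 * n \<Longrightarrow> g i = s 2 i) \<Longrightarrow> s 0 0 = n \<Longrightarrow> s 0 16 < n \<Longrightarrow>
       val e (s(2 := g)) = val e s"
  shows "\<exists>F. run (machine e) (total_time e Z) (initial xs) = map_pmf F (coins {..<2*n}) \<and>
    (\<forall>\<xi>. halted (machine e) (F \<xi>) \<and> cost (F \<xi>) \<le> total_time e Z \<and> feasible I (decode_pricing I (mem (F \<xi>))) \<and>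
       (\<forall>v<n. flag \<xi> v = 0 \<longrightarrow> fst (decode_pricing I (mem (F \<xi>))) v = 0)) \<and>
    (\<forall>p F'. feasible I (p, F') \<longrightarrow>
       measure_pmf.expectation (coins {n..<2*n}) (\<lambda>g. 5/9 * (\<Sum>j | j \<in> F' \<and> flag g (fst_end I j) \<noteq> flag g (snd_end I j).
          p (if flag g (fst_end I j) < flag g (snd_end I j) then snd_end I j else fst_end I j))) \<le>
       measure_pmf.expectation (coins {..<2*n}) (\<lambda>\<xi>. revenue I (decode_pricing I (mem (F \<xi>)))))"
proof -
  \<comment> \<open>Numerators and denominators are below \<open>2 ^ Z\<close>. A product of
    \<open>m \<le> Z\<close> denominators is at most \<open>2 ^ (Z * Z)\<close>, and a scaled budget
    has one more factor.\<close>
  let ?C = "2 ^ (Z*Z+Z) :: nat" and ?W = "2 ^ wexp Z :: nat" and ?cap = "encode_capacity (capacities I ! 1)"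
  let ?k = "2 * Z"
  have len: "2 + n + 4 * m \<le> length xs" by (simp add: xs length_encode_pricing n_def m_def)
  have lenZ: "length xs \<le> Z" unfolding Z_def by (rule length_le_input_size)
  then have nm: "n \<le> Z" "m \<le> Z" using len by simp_all
  have old: "xs ! i = encode_pricing I ! i" if "i < 2 + n + 4 * m" for i
    using that by (simp add: xs nth_append length_encode_pricing n_def m_def)
  have edges: "xs ! (2 + n + 4*j) = fst_end I j \<and> xs ! (3 + n + 4*j) = snd_end I j \<and>
        xs ! (4 + n + 4*j) = num I j \<and> xs ! (5 + n + 4*j) = den I j" if "j < m" for j
    using nth_encode_pricing(4)[of j I] that old[of "2 + n + 4*j"] old[of "3 + n + 4*j"] old[of "4 + n + 4*j"] old[of "5 + n + 4*j"]
    by (simp add: n_def m_def)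
  have small: "x < 2 ^ Z" if "x \<in> set xs" for x unfolding Z_def by (rule less_power_input_size[OF that])
  have nth_small: "xs ! i < 2 ^ Z" if "i < length xs" for i using small that by simp
  have ZW: "(2::nat) ^ Z \<le> ?W" by (rule power_increasing) (simp_all add: wexp_def)
  have W_ge: "(2*m*(m*?C) + 1) * (2*m)^(2*m) + 16*(?C + n + m) + 200 \<le> ?W" by (rule word_bound[OF nm])
  have nd: "num I j < 2 ^ Z" "den I j < 2 ^ Z" if "j < m" for j
    using edges[OF that] nth_small[of "4 + n + 4*j"] nth_small[of "5 + n + 4*j"] that len by auto
  have "(\<Prod>j<m. den I j) \<le> (\<Prod>j<m. 2 ^ Z)" by (rule prod_mono) (use nd in \<open>auto simp: less_imp_le\<close>)
  also have "\<dots> = 2 ^ (Z * m)" by (simp add: power_mult)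
  also have "\<dots> \<le> 2 ^ (Z * Z)" using nm by (intro power_increasing) auto
  finally have D_le: "(\<Prod>j<m. den I j) \<le> 2 ^ (Z * Z)" .
  have "?cap < 2 ^ Z"
    using nth_small[of 3] old[of 3] nth_encode_pricing(3)[of I] I(4) len by (simp add: n_def)
  then have cap_le: "?cap \<le> ?W" using ZW by (rule order_trans[OF less_imp_le])
  have pricing: "pricing I ?cap ?C ?W ?k (flag \<xi>)" for \<xi>
  proof (intro pricing.intro input.intro pricing_axioms.intro)
    show "num I j * (\<Prod>j<nedges I. den I j) \<le> ?C" if "j < nedges I" for j
    proof -
      have "num I j * (\<Prod>j<m. den I j) \<le> 2 ^ Z * 2 ^ (Z * Z)"
        using nd[of j] that D_le by (intro mult_le_mono) (auto simp: m_def)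
      then show ?thesis by (simp add: power_add m_def mult.commute)
    qed
    show "(\<Prod>j<nedges I. den I j) \<le> ?W"
      using D_le unfolding m_def by (rule order_trans) (rule power_increasing, simp_all add: wexp_def)
    show "8 * (?C + nverts I + nedges I) + 200 \<le> ?W" using W_ge unfolding n_def m_def by linarith
    show "num I j \<le> ?W \<and> den I j \<le> ?W" if "j < nedges I" for j
      using nd[of j] that ZW unfolding m_def by linarith
    show "2 * nverts I \<le> ?k" "2 * nedges I \<le> ?k" using nm unfolding n_def m_def by linarith+
    show "flag \<xi> v \<le> 1" if "v < nverts I" for v using flag_le that unfolding n_def .
    show "fst_end I j < nverts I \<and> snd_end I j < nverts I" "0 < den I j" if "j < nedges I" for j
      using instance_edge[OF I(1) that] by auto
    show "2 \<le> nverts I" using I(4) unfolding n_def .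
  qed (rule cap_le I(1-3) refl)+
  have input: "input n m ?cap ?C ?W ?k (fst_end I) (snd_end I) (num I) (den I) (flag \<xi>)" for \<xi>
    unfolding n_def m_def using pricing by (rule pricing.axioms(1))
  have xs3: "xs ! 3 = ?cap"
  proof (cases "m = 0")
    case True
    then show ?thesis using nth_encode_pricing(3)[of I] I(4) len old[of 3] by (cases "n = 2"; simp add: n_def)
  next
    case False
    then show ?thesis using old[of 3] nth_encode_pricing(3)[of I] I(4) by (simp add: n_def)
  qed
  have xs01: "xs ! 0 = n" "xs ! 1 = m"
    using old[of 0] old[of 1] nth_encode_pricing(1,2)[of I] by (simp_all add: n_def m_def)
  have "\<exists>F S. (\<forall>T\<ge>time_bound e ?W ?k (length xs) n m. run (machine e) T (initial xs) = map_pmf F (coins {..<2*n})) \<and>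
    (\<forall>\<xi>. halted (machine e) (F \<xi>) \<and> cost (F \<xi>) \<le> time_bound e ?W ?k (length xs) n m \<and>
      input.outcome n m ?cap ?C (fst_end I) (snd_end I) (num I) (den I) (flag \<xi>) \<xi> (S \<xi>) \<and> (\<forall>y<2*n+m. mem (F \<xi>) y = S \<xi> 13 y)) \<and>
    (\<forall>\<xi> \<xi>' a. (\<forall>i\<in>{n..<2*n}. \<xi> i = \<xi>' i) \<longrightarrow> a \<in> {4, 5, 6, 7, 8, 9} \<longrightarrow> S \<xi> a = S \<xi>' a)"
  proof (rule machine_correct[OF e len xs01 xs3 I(4) edges input _ W_ge _ _ src independent])
    show "i = j" if "i < m" "j < m" "{fst_end I i, snd_end I i} = {fst_end I j, snd_end I j}" for i j
      using simple_ends[OF I(2)] that unfolding m_def by blast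
    show "x \<le> ?W" if "x \<in> set xs" for x using small[OF that] ZW by linarith
    have "Z < 2 ^ Z" by simp
    then show "length xs \<le> ?W" using ZW lenZ by linarith
  qed
  then obtain F S where FS: "\<forall>T\<ge>time_bound e ?W ?k (length xs) n m. run (machine e) T (initial xs) = map_pmf F (coins {..<2*n})"
    "\<forall>\<xi>. halted (machine e) (F \<xi>) \<and> cost (F \<xi>) \<le> time_bound e ?W ?k (length xs) n m \<and>
      input.outcome n m ?cap ?C (fst_end I) (snd_end I) (num I) (den I) (flag \<xi>) \<xi> (S \<xi>) \<and> (\<forall>y<2*n+m. mem (F \<xi>) y = S \<xi> 13 y)"
    "\<forall>\<xi> \<xi>' a. (\<forall>i\<in>{n..<2*n}. \<xi> i = \<xi>' i) \<longrightarrow> a \<in> {4, 5, 6, 7, 8, 9} \<longrightarrow> S \<xi> a = S \<xi>' a"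
    by (elim exE conjE) (rule that)
  note out = FS(2)[THEN spec, THEN conjunct2, THEN conjunct2, THEN conjunct1]
    and cells = FS(2)[THEN spec, THEN conjunct2, THEN conjunct2, THEN conjunct2]
    and same = FS(3)[rule_format]
  have T: "time_bound e ?W ?k (length xs) n m \<le> total_time e Z" by (rule time_bound_le[OF lenZ nm])
  have sols: "feasible I (decode_pricing I (mem (F \<xi>))) \<and> (\<forall>v<n. flag \<xi> v = 0 \<longrightarrow> fst (decode_pricing I (mem (F \<xi>))) v = 0)" for \<xi>
    using pricing.solution(1,2)[OF pricing out[unfolded n_def m_def] cells[unfolded n_def m_def]] by (simp add: n_def)
  have expected: "measure_pmf.expectation (coins {n..<2*n}) (\<lambda>g. 5/9 * (\<Sum>j | j \<in> F' \<and> flag g (fst_end I j) \<noteq> flag g (snd_end I j).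
          p (if flag g (fst_end I j) < flag g (snd_end I j) then snd_end I j else fst_end I j))) \<le>
       measure_pmf.expectation (coins {..<2*n}) (\<lambda>\<xi>. revenue I (decode_pricing I (mem (F \<xi>))))"
    if opt: "feasible I (p, F')" for p F'
    unfolding coins_split[of n]
  proof (rule expectation_bind_ge)
    fix g :: "nat \<Rightarrow> bool"
    let ?h = "\<lambda>f x. if x < n then f x else g x"
    interpret g: pricing I ?cap ?C ?W ?k "flag g" by (rule pricing)
    have fl: "flag (?h f) = flag g" for f by (rule flag_cong) auto
    have S: "S (?h f) a = S g a" if "a \<in> {4, 5, 6, 7, 8, 9}" for f a by (rule same) (use that in auto)
    have out': "g.outcome (?h f) (S (?h f))" for f using out[of "?h f"] unfolding fl unfolding n_def m_def .
    have rev: "revenue I (decode_pricing I (mem (F (?h f)))) =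
      (\<Sum>j\<in>g.sold_set (S (?h f)) (?h f). real (g.sold_offer (S (?h f)) (?h f) j)) / real g.D" for f
      by (rule g.solution(3)[OF out' cells[unfolded n_def m_def]])
    have "5/9 * (\<Sum>j | j \<in> F' \<and> flag g (fst_end I j) \<noteq> flag g (snd_end I j). p (g.lft j)) \<le>
      measure_pmf.expectation (coins {..<n}) (\<lambda>f. revenue I (decode_pricing I (mem (F (?h f)))))"
      unfolding rev unfolding n_def
      by (rule g.expected_solution[of g "\<lambda>f. S (?h f)" "S g" p F', unfolded n_def, OF out'[unfolded n_def] S[unfolded n_def] opt])
    then show "5/9 * (\<Sum>j | j \<in> F' \<and> flag g (fst_end I j) \<noteq> flag g (snd_end I j).
          p (if flag g (fst_end I j) < flag g (snd_end I j) then snd_end I j else fst_end I j)) \<le>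
      measure_pmf.expectation (map_pmf ?h (coins {..<n})) (\<lambda>\<xi>. revenue I (decode_pricing I (mem (F \<xi>))))"
      by (simp add: g.lft_def)
  qed (simp_all add: finite_coins)
  show ?thesis
  proof (rule exI[of _ F], intro conjI allI impI)
    show "cost (F \<xi>) \<le> total_time e Z" for \<xi>
      using FS(2)[THEN spec, THEN conjunct2, THEN conjunct1] T by (rule order_trans)
  qed (use FS(1) T FS(2) sols expected in simp_all)
qed


section \<open>Approximation ratios\<close>

lemma length_word: "length xs + 1 \<le> 2 ^ wexp (input_size xs)"
proof -
  have "length xs < 2 ^ input_size xs" using length_le_input_size[of xs] less_exp[of "input_size xs"] by linarith
  moreover have "(2::nat) ^ input_size xs \<le> 2 ^ wexp (input_size xs)"
    by (rule power_increasing) (simp_all add: wexp_def)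
  ultimately show ?thesis by linarith
qed

lemma word_ge: "16 \<le> (2::nat) ^ wexp Z"
proof -
  have "(2::nat) ^ 4 \<le> 2 ^ wexp Z" by (rule power_increasing) (simp_all add: wexp_def)
  then show ?thesis by simp
qed

text \<open>The guarantee for one instance, stated against every feasible solution instead of the
  supremum.\<close>

definition solves :: "exp \<Rightarrow> nat list \<Rightarrow> ('s \<Rightarrow> bool) \<Rightarrow> (mem \<Rightarrow> 's) \<Rightarrow> ('s \<Rightarrow> real) \<Rightarrow> real \<Rightarrow> bool" where
  "solves e xs feas dec rv c \<longleftrightarrow> (let T = total_time e (input_size xs); D = run (machine e) T (initial xs) in
     (\<forall>x\<in>set_pmf D. halted (machine e) x \<and> cost x \<le> T \<and> feas (dec (mem x))) \<and>
     (\<forall>s. feas s \<longrightarrow> c * rv s \<le> measure_pmf.expectation D (\<lambda>x. rv (dec (mem x)))))"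

text \<open>A solution of revenue 0 makes the supremum one over a nonempty set and the expectation
  nonnegative; the latter permits weakening the factor \<open>c\<close> to
  \<open>1 / \<alpha>\<close>.\<close>

lemma has_randomized_approximationI:
  assumes "\<And>I. inst I \<Longrightarrow> solves e (enc I) (feas I) (dec I) (rv I) c"
    and zero: "\<And>I. inst I \<Longrightarrow> \<exists>s. feas I s \<and> rv I s = 0"
    and c: "0 < c" "0 \<le> \<alpha>" "1 / \<alpha> \<le> c"
  shows "has_randomized_approximation inst enc dec feas rv \<alpha>"
proof -
  obtain q where q: "\<And>x. poly q x = total_time e x"
    using polynomial_total_time[of e] unfolding polynomial_def by blast
  show ?thesis
    unfolding has_randomized_approximation_def
  proof (intro exI[of _ "machine e"] exI[of _ q] allI impI)
    fix I assume I: "inst I"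
    let ?T = "total_time e (input_size (enc I))"
    let ?D = "run (machine e) ?T (initial (enc I))"
    let ?E = "measure_pmf.expectation ?D (\<lambda>x. rv I (dec I (mem x)))"
    have s: "\<forall>x\<in>set_pmf ?D. halted (machine e) x \<and> cost x \<le> ?T \<and> feas I (dec I (mem x))"
      "\<And>s. feas I s \<Longrightarrow> c * rv I s \<le> ?E"
      using assms(1)[OF I] by (auto simp: solves_def Let_def)
    obtain z where z: "feas I z" "rv I z = 0" using zero[OF I] by blast
    have E: "0 \<le> ?E" using s(2)[OF z(1)] z(2) by simp
    have sup: "(SUP s \<in> {s. feas I s}. rv I s) \<le> ?E / c"
    proof (rule cSUP_least)
      show "{s. feas I s} \<noteq> {}" using z by blast
      show "rv I s \<le> ?E / c" if "s \<in> {s. feas I s}" for s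
        using s(2)[of s] that c by (simp add: field_simps)
    qed
    have "1 / \<alpha> * (SUP s \<in> {s. feas I s}. rv I s) \<le> 1 / \<alpha> * (?E / c)"
      by (rule mult_left_mono[OF sup]) (use c in simp)
    also have "\<dots> \<le> c * (?E / c)" by (rule mult_right_mono) (use c E in simp_all)
    also have "\<dots> = ?E" using c by simp
    finally show "let T = poly q (input_size (enc I)); D = run (machine e) T (initial (enc I))
      in (\<forall>c\<in>set_pmf D. halted (machine e) c \<and> cost c \<le> T \<and> feas I (dec I (mem c))) \<and>
         1 / \<alpha> * (SUP s \<in> {s. feas I s}. rv I s) \<le> measure_pmf.expectation D (\<lambda>c. rv I (dec I (mem c)))"
      using s(1) by (simp add: q Let_def)
  qed
qed

text \<open>Loops are excluded, so with fewer than two vertices there is no customer and every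
  revenue is 0.\<close>

lemma solves_trivial:
  assumes I: "pricing_instance I" "nverts I < 2" and xs: "xs = encode_pricing I @ ys"
    and feas: "\<And>s. feas s \<Longrightarrow> snd s \<subseteq> {..<nedges I}"
      "\<And>p. (\<And>v. v < nverts I \<Longrightarrow> p v = 0) \<Longrightarrow> feasible I (p, {}) \<Longrightarrow> feas (p, {})"
  shows "solves e xs feas (decode_pricing I) (revenue I) c"
proof -
  have no: "nedges I = 0"
  proof (rule ccontr)
    assume "nedges I \<noteq> 0"
    then show False using instance_edge(1-3)[OF I(1), of 0] I(2) by simp
  qed
  then have rev: "revenue I s = 0" if "snd s = {}" for s
    using that by (simp add: revenue_def split_beta)
  let ?M = "(mem (initial xs))(0 := 0)"
  have dec: "decode_pricing I ?M = (\<lambda>v. real (?M (2 * v)) / real (?M (2 * v + 1)), {})"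
    using no by (simp add: decode_pricing_def)
  have zero: "real (?M (2 * v)) / real (?M (2 * v + 1)) = 0" if "v < nverts I" for v using that I(2) by simp
  have "feasible I (decode_pricing I ?M)"
    unfolding dec using zero by (simp add: feasible_def zero_enat_def[symmetric])
  then have ok: "feas (decode_pricing I ?M)" unfolding dec using zero by (intro feas(2))
  have "2 \<le> length xs" "xs ! 0 < 2"
    using nth_encode_pricing(1)[of I] I(2) by (simp_all add: xs nth_append length_encode_pricing)
  from machine_trivial[OF this, where T = "total_time e (input_size xs)"] obtain w where
    w: "run (machine e) (total_time e (input_size xs)) (initial xs) =
      return_pmf \<lparr>pc = length (machine e), mem = ?M, cost = w\<rparr>" "w \<le> 3 * kappa 1"
    using kappa_1_le by blast
  have "w \<le> total_time e (input_size xs)" using w(2) kappa_1_le by (rule order_trans)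
  moreover have "snd s = {}" if "feas s" for s using feas(1)[OF that] no by simp
  ultimately show ?thesis
    unfolding solves_def Let_def w(1) using ok rev by (simp add: halted_def dec)
qed

lemma encode_lsided_eq: "encode_lsided (L, I) = encode_pricing I @ map (\<lambda>v. of_bool (v \<in> L)) [0..<nverts I]"
  by (simp add: encode_lsided_def)

text \<open>The indicator of the left side follows the customers in the input, from position
  \<open>3 + n + 4 * m\<close> on.\<close>

definition side_exp :: exp where
  "side_exp = Arr 1 (Lit 3 [+] V 0 [+] Lit 4 [*] V 1 [+] V 16)"

text \<open>Every customer joins the two sides and its right end is free, so the benchmark sum is
  the whole revenue of the given solution.\<close>

lemma solves_lsided:
  assumes inst: "lsided_instance (L, I)" and simple: "simple I" and uniform: "uniform_capacity I"
  shows "solves side_exp (encode_lsided (L, I)) (lsided_feasible (L, I)) (decode_lsided (L, I)) (lsided_revenue (L, I)) (5/9)"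
proof -
  let ?xs = "encode_lsided (L, I)" and ?n = "nverts I" and ?m = "nedges I"
  have I: "pricing_instance I" and L: "L \<subseteq> {..<?n}" using inst by (auto simp: lsided_instance_def)
  have cross: "fst_end I j \<in> L \<longleftrightarrow> snd_end I j \<notin> L" if "j < ?m" for j
  proof -
    have "customers I ! j \<in> set (customers I)" using that by simp
    then have "(fst_end I j, snd_end I j, snd (snd (customers I ! j))) \<in> set (customers I)"
      using customer_eq[of I j] by simp
    then show ?thesis using inst by (auto simp: lsided_instance_def)
  qed
  have rev: "lsided_revenue (L, I) = revenue I" "decode_lsided (L, I) = decode_pricing I"
    by (simp_all add: lsided_revenue_def decode_lsided_def)
  have len: "length ?xs = 2 + 2 * ?n + 4 * ?m"
    by (simp add: encode_lsided_eq length_encode_pricing)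
  have ind: "?xs ! (2 + ?n + 4 * ?m + v) = of_bool (v \<in> L)" if "v < ?n" for v
    using that nth_append_length_plus[of "encode_pricing I" "map (\<lambda>v. of_bool (v \<in> L)) [0..<?n]" v]
    by (simp add: encode_lsided_eq length_encode_pricing)
  show ?thesis
  proof (cases "?n < 2")
    case True
    show ?thesis unfolding rev
    proof (rule solves_trivial[OF I True encode_lsided_eq])
      show "snd s \<subseteq> {..<?m}" if "lsided_feasible (L, I) s" for s
        using that by (cases s) (simp add: lsided_feasible_def feasible_def)
      show "lsided_feasible (L, I) (p, {})" if "\<And>v. v < ?n \<Longrightarrow> p v = 0" "feasible I (p, {})" for p
        using that by (simp add: lsided_feasible_def)
    qed
  next
    case False
    let ?flag = "\<lambda>(_ :: nat \<Rightarrow> bool) v. of_bool (v \<in> L) :: nat" and ?T = "total_time side_exp (input_size ?xs)"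
    have W: "3 + 2 * ?n + 4 * ?m \<le> 2 ^ wexp (input_size ?xs)" using length_word[of ?xs] len by simp
    obtain F where F: "run (machine side_exp) ?T (initial ?xs) = map_pmf F (coins {..<2 * ?n})"
      "\<forall>\<xi>. halted (machine side_exp) (F \<xi>) \<and> cost (F \<xi>) \<le> ?T \<and> feasible I (decode_pricing I (mem (F \<xi>))) \<and>
       (\<forall>v<?n. of_bool (v \<in> L) = (0::nat) \<longrightarrow> fst (decode_pricing I (mem (F \<xi>))) v = 0)"
      "\<forall>p F'. feasible I (p, F') \<longrightarrow>
       measure_pmf.expectation (coins {?n..<2 * ?n}) (\<lambda>g. 5/9 * (\<Sum>j | j \<in> F' \<and> ?flag g (fst_end I j) \<noteq> ?flag g (snd_end I j).
          p (if ?flag g (fst_end I j) < ?flag g (snd_end I j) then snd_end I j else fst_end I j))) \<le>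
       measure_pmf.expectation (coins {..<2 * ?n}) (\<lambda>\<xi>. revenue I (decode_pricing I (mem (F \<xi>))))"
    proof (atomize_elim, rule machine_solution[OF I simple uniform _ encode_lsided_eq, where flag = ?flag])
      fix \<xi> :: "nat \<Rightarrow> bool" and v :: nat and s :: state
      assume v: "v < ?n" "s 0 16 = v" "s 0 0 = ?n" "s 0 1 = ?m"
        and s: "\<And>i. 4 \<le> i \<Longrightarrow> i \<le> length ?xs \<Longrightarrow> s 1 i = ?xs ! (i - 1)"
      have "s 1 (3 + ?n + 4 * ?m + v) = of_bool (v \<in> L)"
        using s[of "3 + ?n + 4 * ?m + v"] ind[OF v(1)] v(1) len by (simp add: add.assoc)
      then show "bounded_exp (2 ^ wexp (input_size ?xs)) side_exp s \<and> val side_exp s = of_bool (v \<in> L)"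
        using v W word_ge by (simp add: side_exp_def)
    qed (use False in \<open>auto simp: side_exp_def\<close>)
    have feas: "lsided_feasible (L, I) (decode_pricing I (mem (F \<xi>)))" for \<xi>
      using F(2)[rule_format, of \<xi>] by (cases "decode_pricing I (mem (F \<xi>))") (auto simp: lsided_feasible_def)
    have opt: "5/9 * revenue I s \<le> measure_pmf.expectation (coins {..<2 * ?n}) (\<lambda>\<xi>. revenue I (decode_pricing I (mem (F \<xi>))))"
      if s: "lsided_feasible (L, I) s" for s
    proof -
      obtain p F' where sp: "s = (p, F')" by (cases s)
      have f: "feasible I (p, F')" "\<And>v. v < ?n \<Longrightarrow> v \<notin> L \<Longrightarrow> p v = 0"
        using s by (auto simp: sp lsided_feasible_def)
      then have F': "F' \<subseteq> {..<?m}" by (simp add: feasible_def)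
      have "revenue I s = (\<Sum>j\<in>F'. p (fst_end I j) + p (snd_end I j))"
        by (simp add: revenue_def sp bundle_price_customer)
      also have "\<dots> = (\<Sum>j | j \<in> F' \<and> of_bool (fst_end I j \<in> L) \<noteq> (of_bool (snd_end I j \<in> L) :: nat).
          p (if of_bool (fst_end I j \<in> L) < (of_bool (snd_end I j \<in> L) :: nat) then snd_end I j else fst_end I j))"
      proof (rule sum.cong)
        show "F' = {j. j \<in> F' \<and> of_bool (fst_end I j \<in> L) \<noteq> (of_bool (snd_end I j \<in> L) :: nat)}"
          using F' cross by auto
        show "p (fst_end I j) + p (snd_end I j) =
          p (if of_bool (fst_end I j \<in> L) < (of_bool (snd_end I j \<in> L) :: nat) then snd_end I j else fst_end I j)"
          if "j \<in> {j. j \<in> F' \<and> of_bool (fst_end I j \<in> L) \<noteq> (of_bool (snd_end I j \<in> L) :: nat)}" for j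
        proof -
          have "j < ?m" using that F' by auto
          then show ?thesis using f(2) cross[of j] instance_edge(1,2)[OF I, of j] by auto
        qed
      qed
      finally show ?thesis using F(3)[rule_format, OF f(1)] by simp
    qed
    show ?thesis
      unfolding solves_def Let_def rev F(1) using F(2) feas opt by simp
  qed
qed

text \<open>The coins from \<open>n\<close> on decide the sides; the first \<open>n\<close> select
  the half-offers.\<close>

definition coin_exp :: exp where
  "coin_exp = Arr 2 (V 0 [+] V 16)"

text \<open>A customer contributes \<open>p u\<close> if only \<open>u\<close> is flagged and
  \<open>p v\<close> if only \<open>v\<close> is, each with probability one quarter; forgoing the
  price of the other end keeps the customer affordable. Hence
  \<open>5/36 = 5/9 * 1/4\<close>.\<close>

lemma solves_general:
  assumes I: "pricing_instance I" and simple: "simple I" and uniform: "uniform_capacity I"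
  shows "solves coin_exp (encode_pricing I) (feasible I) (decode_pricing I) (revenue I) (5/36)"
proof -
  let ?xs = "encode_pricing I" and ?n = "nverts I" and ?m = "nedges I"
  have xs: "?xs = ?xs @ []" by simp
  have len: "length ?xs = 2 + ?n + 4 * ?m" by (simp add: length_encode_pricing)
  show ?thesis
  proof (cases "?n < 2")
    case True
    show ?thesis
      by (rule solves_trivial[OF I True xs]) (auto simp: feasible_def)
  next
    case False
    \<comment> \<open>The guard on \<open>v\<close> makes the whole function depend only on the
      coins in \<open>?X\<close>, as the congruence condition on \<open>flag\<close>
      demands.\<close>
    let ?flag = "\<lambda>\<xi> v. of_bool (v < ?n \<and> \<xi> (?n + v)) :: nat" and ?T = "total_time coin_exp (input_size ?xs)"
    let ?X = "{?n..<2 * ?n}"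
    have W: "2 * ?n \<le> 2 ^ wexp (input_size ?xs)"
    proof -
      have "?n < 2 ^ input_size ?xs" using length_le_input_size[of ?xs] len less_exp[of "input_size ?xs"] by linarith
      moreover have "(2::nat) ^ (input_size ?xs + 1) \<le> 2 ^ wexp (input_size ?xs)"
        by (rule power_increasing) (simp_all add: wexp_def)
      ultimately show ?thesis by simp
    qed
    obtain F where F: "run (machine coin_exp) ?T (initial ?xs) = map_pmf F (coins {..<2 * ?n})"
      "\<forall>\<xi>. halted (machine coin_exp) (F \<xi>) \<and> cost (F \<xi>) \<le> ?T \<and> feasible I (decode_pricing I (mem (F \<xi>))) \<and>
       (\<forall>v<?n. ?flag \<xi> v = 0 \<longrightarrow> fst (decode_pricing I (mem (F \<xi>))) v = 0)"
      "\<forall>p F'. feasible I (p, F') \<longrightarrow>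
       measure_pmf.expectation (coins ?X) (\<lambda>g. 5/9 * (\<Sum>j | j \<in> F' \<and> ?flag g (fst_end I j) \<noteq> ?flag g (snd_end I j).
          p (if ?flag g (fst_end I j) < ?flag g (snd_end I j) then snd_end I j else fst_end I j))) \<le>
       measure_pmf.expectation (coins {..<2 * ?n}) (\<lambda>\<xi>. revenue I (decode_pricing I (mem (F \<xi>))))"
    proof (atomize_elim, rule machine_solution[OF I simple uniform _ xs, where flag = ?flag])
      fix \<xi> :: "nat \<Rightarrow> bool" and v :: nat and s :: state
      assume v: "v < ?n" "s 0 16 = v" "s 0 0 = ?n" "s 0 1 = ?m"
        and s: "\<And>i. i < 2 * ?n \<Longrightarrow> s 2 i = of_bool (\<xi> i)"
      have "s 2 (?n + v) = of_bool (\<xi> (?n + v))" using s[of "?n + v"] v(1) by simp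
      then show "bounded_exp (2 ^ wexp (input_size ?xs)) coin_exp s \<and> val coin_exp s = ?flag \<xi> v"
        using v W False word_ge by (simp add: coin_exp_def)
    next
      fix \<xi> \<xi>' :: "nat \<Rightarrow> bool" assume "\<forall>i\<in>?X. \<xi> i = \<xi>' i"
      then show "?flag \<xi> = ?flag \<xi>'" by (intro ext) auto
    qed (use False in \<open>auto simp: coin_exp_def\<close>)
    have opt: "5/36 * revenue I s \<le> measure_pmf.expectation (coins {..<2 * ?n}) (\<lambda>\<xi>. revenue I (decode_pricing I (mem (F \<xi>))))"
      if s: "feasible I s" for s
    proof -
      obtain p F' where sp: "s = (p, F')" by (cases s)
      have F': "F' \<subseteq> {..<?m}" using s by (simp add: feasible_def sp)
      then have fin: "finite F'" by (rule finite_subset) simp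
      let ?u = "fst_end I" and ?v = "snd_end I"
      let ?t = "\<lambda>g j. of_bool (g (?n + ?u j) \<and> \<not> g (?n + ?v j)) * p (?u j) + of_bool (g (?n + ?v j) \<and> \<not> g (?n + ?u j)) * p (?v j)"
      have edge: "?u j < ?n" "?v j < ?n" "?u j \<noteq> ?v j" if "j \<in> F'" for j
        using instance_edge(1-3)[OF I, of j] that F' by auto
      have split: "(\<Sum>j | j \<in> F' \<and> ?flag g (?u j) \<noteq> ?flag g (?v j). p (if ?flag g (?u j) < ?flag g (?v j) then ?v j else ?u j)) =
          (\<Sum>j\<in>F'. ?t g j)" for g
      proof -
        have "(\<Sum>j | j \<in> F' \<and> ?flag g (?u j) \<noteq> ?flag g (?v j). p (if ?flag g (?u j) < ?flag g (?v j) then ?v j else ?u j)) =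
          (\<Sum>j\<in>F'. if ?flag g (?u j) \<noteq> ?flag g (?v j) then p (if ?flag g (?u j) < ?flag g (?v j) then ?v j else ?u j) else 0)"
          by (rule sum.inter_filter[OF fin])
        also have "\<dots> = (\<Sum>j\<in>F'. ?t g j)"
          by (rule sum.cong) (use edge in auto)
        finally show ?thesis .
      qed
      have int: "integrable (measure_pmf (coins ?X)) h" for h :: "(nat \<Rightarrow> bool) \<Rightarrow> real" by (rule integrable_coins) simp
      have one: "measure_pmf.expectation (coins ?X) (\<lambda>g. ?t g j) = 1/4 * (p (?u j) + p (?v j))" if "j \<in> F'" for j
      proof -
        have "measure_pmf.expectation (coins ?X) (\<lambda>g. ?t g j) =
          measure_pmf.expectation (coins ?X) (\<lambda>g. of_bool (g (?n + ?u j) \<and> \<not> g (?n + ?v j))) * p (?u j) +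
          measure_pmf.expectation (coins ?X) (\<lambda>g. of_bool (g (?n + ?v j) \<and> \<not> g (?n + ?u j))) * p (?v j)"
          by (simp add: Bochner_Integration.integral_add int)
        then show ?thesis
          using edge[OF that] expectation_two_coins[of ?X "?n + ?u j" "?n + ?v j"]
            expectation_two_coins[of ?X "?n + ?v j" "?n + ?u j"]
          by simp
      qed
      have "5/36 * revenue I s = 5/9 * (\<Sum>j\<in>F'. 1/4 * (p (?u j) + p (?v j)))"
        by (simp add: revenue_def sp bundle_price_customer sum_distrib_left)
      also have "\<dots> = 5/9 * (\<Sum>j\<in>F'. measure_pmf.expectation (coins ?X) (\<lambda>g. ?t g j))"
        by (simp only: sum.cong[OF refl one])
      also have "\<dots> = measure_pmf.expectation (coins ?X) (\<lambda>g. 5/9 * (\<Sum>j\<in>F'. ?t g j))"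
        by (simp only: Bochner_Integration.integral_sum[OF int] integral_mult_right_zero)
      also have "\<dots> \<le> measure_pmf.expectation (coins {..<2 * ?n}) (\<lambda>\<xi>. revenue I (decode_pricing I (mem (F \<xi>))))"
        using F(3)[rule_format, of p F'] s unfolding split sp by simp
      finally show ?thesis .
    qed
    show ?thesis
      unfolding solves_def Let_def F(1) using F(2) opt by simp
  qed
qed

theorem theorem3:
  shows "has_randomized_approximation
           (\<lambda>(L, I). lsided_instance (L, I) \<and> simple I \<and> uniform_capacity I)
           encode_lsided decode_lsided lsided_feasible lsided_revenue 1.952381 \<and>
         has_randomized_approximation
           (\<lambda>I. pricing_instance I \<and> simple I \<and> uniform_capacity I)
           encode_pricing decode_pricing feasible revenue 7.8096"
proof
  show "has_randomized_approximation
           (\<lambda>(L, I). lsided_instance (L, I) \<and> simple I \<and> uniform_capacity I)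
           encode_lsided decode_lsided lsided_feasible lsided_revenue 1.952381"
  proof (rule has_randomized_approximationI[where c = "5/9"])
    fix LI :: "nat set \<times> pricing_instance"
    assume "case LI of (L, I) \<Rightarrow> lsided_instance (L, I) \<and> simple I \<and> uniform_capacity I"
    then show "solves side_exp (encode_lsided LI) (lsided_feasible LI) (decode_lsided LI) (lsided_revenue LI) (5/9)"
      by (cases LI) (simp add: solves_lsided)
    show "\<exists>s. lsided_feasible LI s \<and> lsided_revenue LI s = 0"
      by (cases LI, rule exI[of _ "(\<lambda>_. 0, {})"]) (simp add: zero_solution lsided_revenue_def revenue_def)
  qed simp_all
  show "has_randomized_approximation
           (\<lambda>I. pricing_instance I \<and> simple I \<and> uniform_capacity I)
           encode_pricing decode_pricing feasible revenue 7.8096"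
  proof (rule has_randomized_approximationI[where c = "5/36"])
    fix I assume "pricing_instance I \<and> simple I \<and> uniform_capacity I"
    then show "solves coin_exp (encode_pricing I) (feasible I) (decode_pricing I) (revenue I) (5/36)"
      by (simp add: solves_general)
    show "\<exists>s. feasible I s \<and> revenue I s = 0"
      by (rule exI[of _ "(\<lambda>_. 0, {})"]) (simp add: zero_solution revenue_def)
  qed simp_all
qed

end
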